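(* Let $p\ge1$, and let $\hat\mu_d=\sum_{i=1}^n q_i^1\delta_{x_i}$ and $\hat\nu_d=\sum_{j=1}^m q_j^2\delta_{y_j}$ be discrete probability measures on $\mathbb{R}^d$ having $k$-dimensional effective structure with semi-orthogonal matrix $U\in\mathbb{R}^{d\times k}$ (as defined in the context). Let $\hat\mu_k,\hat\nu_k$ be their pushforwards under $x\mapsto U^\top x$. Then, for $\theta\in\mathbb{S}^{d-1}$ and $\theta^k=U^\top\theta/\|U^\top\theta\|$, $$\nabla_x W_p^p(\theta_\#\hat\mu_d,\theta_\#\hat\nu_d)=\|U^\top\theta\|^p\,\nabla_x W_p^p(\theta^k_\#\hat\mu_k,\theta^k_\#\hat\nu_k).$$ This extends to the Sliced-Wasserstein case in the following sense. Let $\theta_1^d,\theta_2^d,\dots$ be i.i.d. with law $\mathcal{U}(\mathbb{S}^{d-1})$, let $\theta^k_l=U^\top\theta^d_l/\|U^\top\theta^d_l\|$, let $\widehat{ESSF}(L)=\frac1L\sum_{l=1}^L\|U^\top\theta^d_l\|^p$, and define the empirical gradient error for each $x_i$ by $$\epsilon_L(x_i):=\nabla_{x_i}SW_p^p\Big(\hat\mu_d,\hat\nu_d;\tfrac1L\sum_{l=1}^L\delta_{\theta^d_l}\Big)-\widehat{ESSF}(L)\cdot\nabla_{x_i}SW_p^p\Big(\hat\mu_k,\hat\nu_k;\tfrac1L\sum_{l=1}^L\delta_{\theta^k_l}\Big).$$ Then: 1. $\epsilon_L(x_i)\to 0_d$ in probability as $L\to\infty$; 2. $\mathbb{P}(\|\epsilon_L(x_i)\|\le\epsilon)\ge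 1-2e^{-\epsilon^2L/(p\,q_i^1K)^2}$ for $\epsilon>0$, where $K=\max_{x_i,y_j}\|x_i-y_j\|^{p-1}<\infty$.
   Context: $\mathbb{S}^{d-1}$ is the Euclidean unit sphere in $\mathbb{R}^d$ and $\mathcal{U}(\mathbb{S}^{d-1})$ its uniform probability measure; $0_d$ is the zero vector of $\mathbb{R}^d$. For a vector $\theta$, $\theta_\#\mu$ is the pushforward of $\mu$ under $x\mapsto\theta^\top x$. $W_p$ is the $p$-Wasserstein distance, $W_p^p(\mu,\nu)=\inf_{\gamma}\int\|x-y\|^p\,d\gamma(x,y)$ over couplings $\gamma$ of $\mu$ and $\nu$. For a probability measure $\sigma$ of slicing directions, $SW_p^p(\mu,\nu;\sigma)=\int W_p^p(\theta_\#\mu,\theta_\#\nu)\,d\sigma(\theta)$. $\nabla_{x_i}$ denotes the gradient with respect to the support point $x_i\in\mathbb{R}^d$ of $\hat\mu_d$, and $\nabla_x$ the gradient with respect to such a support point $x$; note that $\hat\mu_k=\sum_i q_i^1\delta_{U^\top x_i}$ and $\hat\nu_k=\sum_j q_j^2\delta_{U^\top y_j}$. Effective subspace structure: a pair $(\mu^d,\nu^d)$ of probability measures on $\mathbb{R}^d$ has $k$-dimensional effective structure if: (1) there is $U\in\mathbb{R}^{d\times k}$ with $U^\top U=I_k$ such that $\mathrm{supp}(\mu^d),\mathrm{supp}(\nu^d)\subset V_k:=\text{column span of }U$; (2) $k$ is minimal, i.e. no such matrix with $k'<k$ columns satisfies (1); (3) for any measurable $A\subset\mathbb{R}^d$, $\mu^d(A)=\mu^d(P_{V_k}^{-1}(A))$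 and $\nu^d(A)=\nu^d(P_{V_k}^{-1}(A))$, where $P_{V_k}(x)=UU^\top x$ is the orthogonal projection onto $V_k$; (4) $W_p(\mu^k,\nu^k)<\infty$ for some $p\ge1$, where $\mu^k,\nu^k$ are the pushforwards of $\mu^d,\nu^d$ under $x\mapsto U^\top x$. Convention: $\theta^k=0_k$ (the zero vector of $\mathbb{R}^k$) if $U^\top\theta=0$.
   Formalization: Gradients in x_i are taken along the subspace V_k (x_i varied inside V_k), since with the full gradient in R^d the identity and item 2 fail (p=1, U=e_1, x=e_1, y=0); where no gradient exists it is set to 0, and x_i is assumed to have positive weight. *)

theory Defs
  imports "HOL-Analysis.Analysis" "HOL-Probability.Probability"
begin

subsection \<open>Wasserstein and sliced Wasserstein distances\<close>

definition couplings :: "'a measure \<Rightarrow> 'b measure \<Rightarrow> ('a \<times> 'b) measure set" where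
  "couplings \<mu> \<nu> = {\<gamma>. sets \<gamma> = sets (\<mu> \<Otimes>\<^sub>M \<nu>) \<and> distr \<gamma> \<mu> fst = \<mu> \<and> distr \<gamma> \<nu> snd = \<nu>}"

text \<open>The \<open>p\<close>-th power \<open>W\<^sub>p\<^sup>p\<close>; in particular \<open>W\<^sub>p < \<infinity>\<close> means that this quantity is below \<open>\<top>\<close>.\<close>

definition wasserstein_pow :: "real \<Rightarrow> 'a::real_normed_vector measure \<Rightarrow> 'a measure \<Rightarrow> ennreal" where
  "wasserstein_pow p \<mu> \<nu> =
     (INF \<gamma>\<in>couplings \<mu> \<nu>. \<integral>\<^sup>+ z. ennreal (norm (fst z - snd z) powr p) \<partial>\<gamma>)"

definition slice :: "'a::euclidean_space \<Rightarrow> 'a measure \<Rightarrow> real measure" where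
  "slice \<theta> \<mu> = distr \<mu> borel (\<lambda>x. \<theta> \<bullet> x)"

definition sliced_wasserstein_pow ::
  "real \<Rightarrow> 'a::euclidean_space measure \<Rightarrow> 'a measure \<Rightarrow> 'a measure \<Rightarrow> ennreal" where
  "sliced_wasserstein_pow p \<mu> \<nu> \<sigma> = (\<integral>\<^sup>+ \<theta>. wasserstein_pow p (slice \<theta> \<mu>) (slice \<theta> \<nu>) \<partial>\<sigma>)"


subsection \<open>Discrete measures and the uniform measure on the sphere\<close>

text \<open>\<open>discrete_measure n q x\<close> is \<open>\<Sum>i<n. q i \<cdot> \<delta>\<^bsub>x i\<^esub>\<close> on the Borel sets; indices start at 0.\<close>

definition discrete_measure :: "nat \<Rightarrow> (nat \<Rightarrow> real) \<Rightarrow> (nat \<Rightarrow> 'a::topological_space) \<Rightarrow> 'a measure" where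
  "discrete_measure n q x = distr (point_measure {..<n} (\<lambda>i. ennreal (q i))) borel x"

lemma emeasure_discrete_measure:
  assumes "A \<in> sets borel"
  shows "emeasure (discrete_measure n q x) A = (\<Sum>i<n. ennreal (q i) * indicator A (x i))"
proof -
  have "emeasure (discrete_measure n q x) A
      = emeasure (point_measure {..<n} (\<lambda>i. ennreal (q i))) (x -` A \<inter> {..<n})"
    unfolding discrete_measure_def
    by (subst emeasure_distr) (use assms in \<open>auto simp: space_point_measure\<close>)
  also have "\<dots> = (\<Sum>i\<in>x -` A \<inter> {..<n}. ennreal (q i))"
    by (rule emeasure_point_measure_finite) auto
  also have "\<dots> = (\<Sum>i<n. ennreal (q i) * indicator A (x i))"
    by (rule sum.mono_neutral_cong_left) (auto simp: indicator_def)
  finally show ?thesis .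
qed

definition empirical_measure :: "nat \<Rightarrow> (nat \<Rightarrow> 'a::topological_space) \<Rightarrow> 'a measure" where
  "empirical_measure L \<theta> = discrete_measure L (\<lambda>_. 1 / real L) \<theta>"

text \<open>The normalised surface measure of the unit sphere, obtained as its cone measure: the law of
  \<open>x / \<parallel>x\<parallel>\<close> for \<open>x\<close> uniform in the unit ball.\<close>

definition uniform_sphere :: "'a::euclidean_space measure" where
  "uniform_sphere = distr (uniform_measure lborel (ball 0 1)) borel (\<lambda>x. x /\<^sub>R norm x)"


subsection \<open>Effective subspace structure\<close>

definition measure_support :: "'a::topological_space measure \<Rightarrow> 'a set" where
  "measure_support \<mu> = {x. \<forall>S. open S \<longrightarrow> x \<in> S \<longrightarrow> 0 < emeasure \<mu> S}"

definition column_span :: "real^'k^'d \<Rightarrow> (real^'d) set" where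
  "column_span U = span (columns U)"

definition reduce :: "real^'k^'d \<Rightarrow> (real^'d) measure \<Rightarrow> (real^'k) measure" where
  "reduce U \<mu> = distr \<mu> borel (\<lambda>x. transpose U *v x)"

text \<open>A competing semi-orthogonal matrix with \<open>k'\<close> columns, \<open>1 \<le> k' < k\<close>, is given by the
  orthonormal sequence \<open>u 0, \<dots>, u (k' - 1)\<close> of its columns, as \<open>k'\<close> ranges over numbers and not
  over types.\<close>

definition effective_structure ::
  "real^'k^'d \<Rightarrow> (real^'d) measure \<Rightarrow> (real^'d) measure \<Rightarrow> bool" where
  "effective_structure U \<mu> \<nu> \<longleftrightarrow>
     transpose U ** U = mat 1 \<and>
     measure_support \<mu> \<subseteq> column_span U \<and> measure_support \<nu> \<subseteq> column_span U \<and>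
     (\<forall>k' (u :: nat \<Rightarrow> real^'d).
        1 \<le> k' \<and> k' < CARD('k) \<and> (\<forall>i<k'. \<forall>j<k'. u i \<bullet> u j = (if i = j then 1 else 0)) \<longrightarrow>
        \<not> (measure_support \<mu> \<subseteq> span (u ` {..<k'}) \<and> measure_support \<nu> \<subseteq> span (u ` {..<k'}))) \<and>
     (\<forall>A\<in>sets borel.
        emeasure \<mu> A = emeasure \<mu> ((\<lambda>x. (U ** transpose U) *v x) -` A) \<and>
        emeasure \<nu> A = emeasure \<nu> ((\<lambda>x. (U ** transpose U) *v x) -` A)) \<and>
     (\<exists>p\<ge>1. wasserstein_pow p (reduce U \<mu>) (reduce U \<nu>) < \<top>)"

text \<open>For \<open>U\<^sup>T \<theta> = 0\<close> this is the zero vector.\<close>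

definition reduced_direction :: "real^'k^'d \<Rightarrow> real^'d \<Rightarrow> real^'k" where
  "reduced_direction U \<theta> = (transpose U *v \<theta>) /\<^sub>R norm (transpose U *v \<theta>)"


subsection \<open>Gradients\<close>

text \<open>The gradient at a point of a linear subspace \<open>V\<close>, for variations of the point inside \<open>V\<close>; it
  is a vector of \<open>V\<close>, hence of the ambient space. A pair with effective structure along \<open>U\<close> has its
  support points in \<open>V = column_span U\<close>, and they are varied there. Unconstrained variation would
  not do: for \<open>\<theta> \<notin> V\<close> the ambient gradient of \<open>x \<mapsto> W\<^sub>p\<^sup>p(\<theta>\<^sub>#\<mu>, \<theta>\<^sub>#\<nu>)\<close> is a multiple of \<open>\<theta>\<close>,
  whereas the gradient of an expression in \<open>U\<^sup>T x\<close> lies in \<open>V\<close>. For \<open>V = UNIV\<close> this is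
  \<open>GDERIV\<close>.\<close>

definition has_gradient_on :: "('a::real_inner \<Rightarrow> real) \<Rightarrow> 'a set \<Rightarrow> 'a \<Rightarrow> 'a \<Rightarrow> bool" where
  "has_gradient_on f V x g \<longleftrightarrow> g \<in> V \<and> (f has_derivative (\<lambda>h. h \<bullet> g)) (at x within V)"

text \<open>Zero where there is no (unique) gradient.\<close>

definition gradient_on :: "('a::real_inner \<Rightarrow> real) \<Rightarrow> 'a set \<Rightarrow> 'a \<Rightarrow> 'a" where
  "gradient_on f V x =
     (if \<exists>!g. has_gradient_on f V x g then THE g. has_gradient_on f V x g else 0)"

lemma has_gradient_on_unique:
  assumes V: "subspace V" and x: "x \<in> V"
    and g: "has_gradient_on f V x g" and g': "has_gradient_on f V x g'"
  shows "g = g'"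
proof (rule ccontr)
  assume ne: "g \<noteq> g'"
  define v where "v = g - g'"
  have v: "v \<in> V" "v \<noteq> 0"
    using g g' V ne by (auto simp: v_def has_gradient_on_def subspace_diff)
  have line: "((\<lambda>t::real. x + t *\<^sub>R v) has_derivative (\<lambda>t. t *\<^sub>R v)) (at 0)"
    by (auto intro!: derivative_eq_intros)
  have sub: "(\<lambda>t::real. x + t *\<^sub>R v) ` UNIV \<subseteq> V"
    using V x v by (auto intro: subspace_add subspace_scale)
  have D: "((\<lambda>t::real. f (x + t *\<^sub>R v)) has_derivative (\<lambda>t. (t *\<^sub>R v) \<bullet> w)) (at 0)"
    if "has_gradient_on f V x w" for w
  proof -
    have "(f has_derivative (\<lambda>h. h \<bullet> w)) (at (x + 0 *\<^sub>R v) within range (\<lambda>t::real. x + t *\<^sub>R v))"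
      using that sub by (simp add: has_gradient_on_def) (metis has_derivative_subset)
    from has_derivative_in_compose[OF line this] show ?thesis by simp
  qed
  have "(\<lambda>t. (t *\<^sub>R v) \<bullet> g) = (\<lambda>t::real. (t *\<^sub>R v) \<bullet> g')"
    by (rule has_derivative_unique[OF D[OF g] D[OF g']])
  from fun_cong[OF this, of 1] have "v \<bullet> v = 0"
    by (simp add: v_def inner_diff_right)
  with v show False by simp
qed

lemma gradient_on_eq:
  assumes "subspace V" "x \<in> V" "has_gradient_on f V x g"
  shows "gradient_on f V x = g"
proof -
  have ex1: "\<exists>!g. has_gradient_on f V x g"
    by (rule ex1I[where a = g], rule assms(3))
      (rule has_gradient_on_unique[OF assms(1,2) _ assms(3)])
  show ?thesis
    unfolding gradient_on_def if_P[OF ex1] using ex1 assms(3) by (rule the1_equality)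
qed


subsection \<open>The empirical gradient error\<close>

text \<open>The functions of the position \<open>z\<close> of the \<open>i\<close>-th support point \<open>x i\<close> that are differentiated,
  all other data being fixed.\<close>

definition slice_loss ::
  "real \<Rightarrow> nat \<Rightarrow> (nat \<Rightarrow> real) \<Rightarrow> (nat \<Rightarrow> real^'d) \<Rightarrow> nat \<Rightarrow> (nat \<Rightarrow> real) \<Rightarrow> (nat \<Rightarrow> real^'d) \<Rightarrow>
   nat \<Rightarrow> real^'d \<Rightarrow> real^'d \<Rightarrow> real" where
  "slice_loss p n q1 x m q2 y i \<theta> z =
     enn2real (wasserstein_pow p (slice \<theta> (discrete_measure n q1 (x(i := z))))
                                 (slice \<theta> (discrete_measure m q2 y)))"

definition reduced_slice_loss ::
  "real^'k^'d \<Rightarrow> real \<Rightarrow> nat \<Rightarrow> (nat \<Rightarrow> real) \<Rightarrow> (nat \<Rightarrow> real^'d) \<Rightarrow> nat \<Rightarrow> (nat \<Rightarrow> real) \<Rightarrow>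
   (nat \<Rightarrow> real^'d) \<Rightarrow> nat \<Rightarrow> real^'k \<Rightarrow> real^'d \<Rightarrow> real" where
  "reduced_slice_loss U p n q1 x m q2 y i \<theta> z =
     enn2real (wasserstein_pow p (slice \<theta> (reduce U (discrete_measure n q1 (x(i := z)))))
                                 (slice \<theta> (reduce U (discrete_measure m q2 y))))"

definition sw_loss ::
  "real \<Rightarrow> nat \<Rightarrow> (nat \<Rightarrow> real) \<Rightarrow> (nat \<Rightarrow> real^'d) \<Rightarrow> nat \<Rightarrow> (nat \<Rightarrow> real) \<Rightarrow> (nat \<Rightarrow> real^'d) \<Rightarrow>
   nat \<Rightarrow> (real^'d) measure \<Rightarrow> real^'d \<Rightarrow> real" where
  "sw_loss p n q1 x m q2 y i \<sigma> z =
     enn2real (sliced_wasserstein_pow p (discrete_measure n q1 (x(i := z)))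
                                        (discrete_measure m q2 y) \<sigma>)"

definition reduced_sw_loss ::
  "real^'k^'d \<Rightarrow> real \<Rightarrow> nat \<Rightarrow> (nat \<Rightarrow> real) \<Rightarrow> (nat \<Rightarrow> real^'d) \<Rightarrow> nat \<Rightarrow> (nat \<Rightarrow> real) \<Rightarrow>
   (nat \<Rightarrow> real^'d) \<Rightarrow> nat \<Rightarrow> (real^'k) measure \<Rightarrow> real^'d \<Rightarrow> real" where
  "reduced_sw_loss U p n q1 x m q2 y i \<sigma> z =
     enn2real (sliced_wasserstein_pow p (reduce U (discrete_measure n q1 (x(i := z))))
                                        (reduce U (discrete_measure m q2 y)) \<sigma>)"

definition empirical_ESSF :: "real^'k^'d \<Rightarrow> real \<Rightarrow> nat \<Rightarrow> (nat \<Rightarrow> real^'d) \<Rightarrow> real" where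
  "empirical_ESSF U p L \<theta> = 1 / real L * (\<Sum>l<L. norm (transpose U *v \<theta> l) powr p)"

definition gradient_error ::
  "real^'k^'d \<Rightarrow> real \<Rightarrow> nat \<Rightarrow> (nat \<Rightarrow> real) \<Rightarrow> (nat \<Rightarrow> real^'d) \<Rightarrow> nat \<Rightarrow> (nat \<Rightarrow> real) \<Rightarrow>
   (nat \<Rightarrow> real^'d) \<Rightarrow> nat \<Rightarrow> nat \<Rightarrow> (nat \<Rightarrow> real^'d) \<Rightarrow> real^'d" where
  "gradient_error U p n q1 x m q2 y i L \<theta> =
     gradient_on (sw_loss p n q1 x m q2 y i (empirical_measure L \<theta>)) (column_span U) (x i)
     - empirical_ESSF U p L \<theta> *\<^sub>R
       gradient_on
         (reduced_sw_loss U p n q1 x m q2 y i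
            (empirical_measure L (\<lambda>l. reduced_direction U (\<theta> l))))
         (column_span U) (x i)"

text \<open>The case distinction implements \<open>0\<^sup>0 = 1\<close>, as \<open>0 powr 0 = 0\<close>.\<close>

definition max_dist_pow ::
  "real \<Rightarrow> nat \<Rightarrow> (nat \<Rightarrow> 'a::real_normed_vector) \<Rightarrow> nat \<Rightarrow> (nat \<Rightarrow> 'a) \<Rightarrow> real" where
  "max_dist_pow p n x m y =
     Max ((\<lambda>(i, j). if p = 1 then 1 else norm (x i - y j) powr (p - 1)) ` ({..<n} \<times> {..<m}))"

definition tendsto_in_prob ::
  "'w measure \<Rightarrow> (nat \<Rightarrow> 'w \<Rightarrow> 'a::euclidean_space) \<Rightarrow> 'a \<Rightarrow> bool" where
  "tendsto_in_prob M X c \<longleftrightarrow>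
     (\<forall>L. X L \<in> borel_measurable M) \<and>
     (\<forall>\<delta>>0. (\<lambda>L. measure M {\<omega> \<in> space M. norm (X L \<omega> - c) > \<delta>}) \<longlonglongrightarrow> 0)"

end

theory Submission
  imports Defs
begin

text \<open>On the column span of \<open>U\<close> every slice loss is \<open>\<parallel>U\<^sup>T \<theta>\<parallel>\<^sup>p\<close> times the reduced one, and the latter is
  a function of \<open>(z - x i) \<bullet> U t\<close>, where \<open>t\<close> is the reduced direction. As the optimal value of a
  transport problem is a concave Lipschitz function of the cost matrix, this function has one-sided
  derivatives. Kinks in different directions cannot cancel, and those in opposite directions are
  equal, so a weighted sum of slice losses is differentiable exactly if all its terms are, whatever
  the positive weights. Hence the gradient error is either zero or
  \<open>1/L \<Sum>\<^sub>l c\<^sub>l (g\<^sub>l - g)\<close>, where \<open>c\<^sub>l = \<parallel>U\<^sup>T \<theta>\<^sub>l\<parallel>\<^sup>p\<close> and \<open>g\<^sub>l\<close> is the reduced gradient, which depends on the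
  direction of \<open>U\<^sup>T \<theta>\<^sub>l\<close> only, and \<open>g\<close> is the mean of the \<open>g\<^sub>l\<close>. Norm and direction of \<open>U\<^sup>T \<theta>\<^sub>l\<close> are
  independent, because scaling the column span and its orthogonal complement separately rescales
  Lebesgue measure. Conditionally on the directions the \<open>c\<^sub>l\<close> may therefore be centred, and the
  exponential moment of \<open>cosh \<parallel>\<cdot>\<parallel>\<close> gives a dimension-free Hoeffding inequality.\<close>

subsection \<open>Discrete optimal transport\<close>

text \<open>The obstacle is that \<open>gradient_on\<close> returns 0 where no gradient exists. If
  the full loss had a gradient where the reduced one had none, the error would be a full gradient,
  which does not shrink with L. Such samples are not null events: already for p = n = m = k = 1 and
  coinciding support points the loss has a kink in every nonzero reduced direction, and for k = 1
  any two nonzero directions agree up to sign. So both losses are shown to have gradients at exactly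
  the same samples, without generic differentiability. Hoeffding's inequality for independent
  summands does not fit the error as it stands, because the mean g couples all terms. With the
  directions frozen, the vectors g_l - g are constants with sum zero, so the common expectation of
  the c_l can be subtracted for free. The c_l lie in [0, 1], and the sum of the squared norms of g_l
  - g is at most L C^2 with C = p q_i K, since centring does not increase a sum of squares. The
  resulting tail is 2 exp(-2 \<epsilon>^2 L / C^2), which is stronger than the claim by a factor 2
  in the exponent.\<close>

definition transport_plans ::
  "nat \<Rightarrow> (nat \<Rightarrow> real) \<Rightarrow> nat \<Rightarrow> (nat \<Rightarrow> real) \<Rightarrow> (nat \<Rightarrow> nat \<Rightarrow> real) set" where
  "transport_plans n q1 m q2 =
     {\<gamma>. (\<forall>i<n. \<forall>j<m. 0 \<le> \<gamma> i j) \<and> (\<forall>i<n. (\<Sum>j<m. \<gamma> i j) = q1 i) \<and>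
         (\<forall>j<m. (\<Sum>i<n. \<gamma> i j) = q2 j)}"

definition plan_cost :: "nat \<Rightarrow> nat \<Rightarrow> (nat \<Rightarrow> nat \<Rightarrow> real) \<Rightarrow> (nat \<Rightarrow> nat \<Rightarrow> real) \<Rightarrow> real" where
  "plan_cost n m C \<gamma> = (\<Sum>i<n. \<Sum>j<m. \<gamma> i j * C i j)"

definition transport_cost ::
  "nat \<Rightarrow> (nat \<Rightarrow> real) \<Rightarrow> nat \<Rightarrow> (nat \<Rightarrow> real) \<Rightarrow> (nat \<Rightarrow> nat \<Rightarrow> real) \<Rightarrow> real" where
  "transport_cost n q1 m q2 C = (INF \<gamma>\<in>transport_plans n q1 m q2. plan_cost n m C \<gamma>)"

locale discrete_marginals =
  fixes n m :: nat and q1 q2 :: "nat \<Rightarrow> real"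
  assumes q1_nonneg: "\<And>i. i < n \<Longrightarrow> 0 \<le> q1 i" and q1_sum: "(\<Sum>i<n. q1 i) = 1"
    and q2_nonneg: "\<And>j. j < m \<Longrightarrow> 0 \<le> q2 j" and q2_sum: "(\<Sum>j<m. q2 j) = 1"
begin

abbreviation "plans \<equiv> transport_plans n q1 m q2"
abbreviation "cost \<equiv> plan_cost n m"
abbreviation "OT \<equiv> transport_cost n q1 m q2"

lemma plans_nonempty: "plans \<noteq> {}"
proof -
  have "(\<lambda>i j. q1 i * q2 j) \<in> plans"
    using q1_nonneg q2_nonneg
    by (auto simp: transport_plans_def q1_sum q2_sum
        simp flip: sum_distrib_left sum_distrib_right)
  then show ?thesis by blast
qed

lemma plan_le_row:
  assumes "\<gamma> \<in> plans" "i < n" "j < m"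
  shows "\<gamma> i j \<le> q1 i"
proof -
  have "\<gamma> i j \<le> (\<Sum>j<m. \<gamma> i j)"
    using assms by (intro member_le_sum) (auto simp: transport_plans_def)
  then show ?thesis using assms by (simp add: transport_plans_def)
qed

lemma bdd_below_cost: "bdd_below (cost C ` plans)"
proof (rule bdd_belowI2)
  fix \<gamma> assume g: "\<gamma> \<in> plans"
  have "- (q1 i * \<bar>C i j\<bar>) \<le> \<gamma> i j * C i j" if "i < n" "j < m" for i j
  proof -
    have "\<gamma> i j * \<bar>C i j\<bar> \<le> q1 i * \<bar>C i j\<bar>"
      using plan_le_row[OF g that] by (intro mult_right_mono) auto
    moreover have "- (\<gamma> i j * \<bar>C i j\<bar>) \<le> \<gamma> i j * C i j"
    proof -
      have "0 \<le> \<gamma> i j" using g that by (auto simp: transport_plans_def)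
      then have "\<gamma> i j * (- \<bar>C i j\<bar>) \<le> \<gamma> i j * C i j" by (intro mult_left_mono) auto
      then show ?thesis by simp
    qed
    ultimately show ?thesis by linarith
  qed
  then show "(\<Sum>i<n. \<Sum>j<m. - (q1 i * \<bar>C i j\<bar>)) \<le> cost C \<gamma>"
    unfolding plan_cost_def by (intro sum_mono) auto
qed

lemma OT_le: "\<gamma> \<in> plans \<Longrightarrow> OT C \<le> cost C \<gamma>"
  unfolding transport_cost_def by (rule cINF_lower[OF bdd_below_cost])

lemma OT_greatest: "(\<And>\<gamma>. \<gamma> \<in> plans \<Longrightarrow> B \<le> cost C \<gamma>) \<Longrightarrow> B \<le> OT C"
  unfolding transport_cost_def by (rule cINF_greatest[OF plans_nonempty])

lemma OT_nonneg:
  assumes "\<And>i j. i < n \<Longrightarrow> j < m \<Longrightarrow> 0 \<le> C i j"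
  shows "0 \<le> OT C"
  using assms by (intro OT_greatest) (auto simp: plan_cost_def transport_plans_def intro!: sum_nonneg)

lemma cost_diff: "cost C \<gamma> - cost C' \<gamma> = (\<Sum>i<n. \<Sum>j<m. \<gamma> i j * (C i j - C' i j))"
  by (simp add: plan_cost_def sum_subtractf algebra_simps)

lemma OT_diff_le:
  assumes "\<And>\<gamma>. \<gamma> \<in> plans \<Longrightarrow> \<bar>cost C \<gamma> - cost C' \<gamma>\<bar> \<le> e"
  shows "\<bar>OT C - OT C'\<bar> \<le> e"
proof -
  have "OT C - e \<le> OT C'"
    using OT_le[of _ C] assms by (intro OT_greatest) (smt (verit))
  moreover have "OT C' - e \<le> OT C"
    using OT_le[of _ C'] assms by (intro OT_greatest) (smt (verit))
  ultimately show ?thesis by linarith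
qed

text \<open>Every plan has total mass one, so a uniform change \<open>e\<close> of the cost matrix
  changes the cost of each plan, and hence the infimum, by at most \<open>e\<close>.\<close>

lemma OT_lipschitz:
  assumes e: "\<And>i j. i < n \<Longrightarrow> j < m \<Longrightarrow> \<bar>C i j - C' i j\<bar> \<le> e"
  shows "\<bar>OT C - OT C'\<bar> \<le> e"
proof (rule OT_diff_le)
  fix \<gamma> assume g: "\<gamma> \<in> plans"
  have "\<bar>cost C \<gamma> - cost C' \<gamma>\<bar> \<le> (\<Sum>i<n. \<Sum>j<m. \<bar>\<gamma> i j * (C i j - C' i j)\<bar>)"
    unfolding cost_diff by (rule order_trans[OF sum_abs]) (intro sum_mono sum_abs)
  also have "\<dots> \<le> (\<Sum>i<n. \<Sum>j<m. \<gamma> i j * e)"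
    using g e by (intro sum_mono) (auto simp: abs_mult transport_plans_def intro!: mult_left_mono)
  also have "\<dots> = e"
    using g by (simp add: transport_plans_def q1_sum flip: sum_distrib_right)
  finally show "\<bar>cost C \<gamma> - cost C' \<gamma>\<bar> \<le> e" .
qed

text \<open>Every plan puts mass exactly \<open>q1 i\<close> on row \<open>i\<close>. This is the
  origin of the factor \<open>q1 i\<close> in the final constant.\<close>

lemma OT_lipschitz_row:
  assumes i: "i < n" and eq: "\<And>i' j. i' < n \<Longrightarrow> i' \<noteq> i \<Longrightarrow> j < m \<Longrightarrow> C i' j = C' i' j"
    and e: "\<And>j. j < m \<Longrightarrow> \<bar>C i j - C' i j\<bar> \<le> e"
  shows "\<bar>OT C - OT C'\<bar> \<le> q1 i * e"
proof (rule OT_diff_le)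
  fix \<gamma> assume g: "\<gamma> \<in> plans"
  have "cost C \<gamma> - cost C' \<gamma> = (\<Sum>j<m. \<gamma> i j * (C i j - C' i j))"
    unfolding cost_diff using i eq
    by (subst sum.remove[of _ i]) (auto intro!: sum.neutral)
  also have "\<bar>\<dots>\<bar> \<le> (\<Sum>j<m. \<bar>\<gamma> i j * (C i j - C' i j)\<bar>)"
    by (rule sum_abs)
  also have "\<dots> \<le> (\<Sum>j<m. \<gamma> i j * e)"
    using g e i by (intro sum_mono) (auto simp: abs_mult transport_plans_def intro!: mult_left_mono)
  also have "\<dots> = q1 i * e"
    using g i by (simp add: transport_plans_def flip: sum_distrib_right)
  finally show "\<bar>cost C \<gamma> - cost C' \<gamma>\<bar> \<le> q1 i * e" .
qed

lemma OT_scale: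
  assumes c: "0 \<le> c"
  shows "OT (\<lambda>i j. c * C i j) = c * OT C"
proof -
  have cost: "cost (\<lambda>i j. c * C i j) \<gamma> = c * cost C \<gamma>" for c C \<gamma>
    by (simp add: plan_cost_def sum_distrib_left algebra_simps)
  have ge: "c * OT C \<le> OT (\<lambda>i j. c * C i j)" if "0 \<le> c" for c C
    using that by (intro OT_greatest) (auto simp: cost intro!: mult_left_mono OT_le)
  show ?thesis
  proof (cases "c = 0")
    case True
    have "OT (\<lambda>i j. 0) = 0"
      using plans_nonempty by (simp add: transport_cost_def plan_cost_def)
    with True show ?thesis by simp
  next
    case False
    with c have c: "0 < c" by simp
    \<comment> \<open>The inequality \<open>ge\<close> for the factor \<open>1 / c\<close> and the
      scaled matrix is the converse inequality.\<close>
    have "(1 / c) * OT (\<lambda>i j. c * C i j) \<le> OT (\<lambda>i j. (1 / c) * (c * C i j))"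
      using c by (intro ge) auto
    also have "\<dots> = OT C" using c by simp
    finally have "OT (\<lambda>i j. c * C i j) \<le> c * OT C" using c by (simp add: field_simps)
    with ge[of c C] c show ?thesis by simp
  qed
qed

text \<open>For a fixed plan the cost is linear in the matrix, and an infimum of linear functions is
  concave.\<close>

lemma OT_concave:
  assumes t: "0 \<le> t" "t \<le> 1"
  shows "(1 - t) * OT C + t * OT C' \<le> OT (\<lambda>i j. (1 - t) * C i j + t * C' i j)"
proof (rule OT_greatest)
  fix \<gamma> assume g: "\<gamma> \<in> plans"
  have "cost (\<lambda>i j. (1 - t) * C i j + t * C' i j) \<gamma> = (1 - t) * cost C \<gamma> + t * cost C' \<gamma>"
    by (simp add: plan_cost_def sum_distrib_left sum.distrib[symmetric] algebra_simps)
  then show "(1 - t) * OT C + t * OT C' \<le> cost (\<lambda>i j. (1 - t) * C i j + t * C' i j) \<gamma>"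
    using t g by (auto intro!: add_mono mult_left_mono OT_le)
qed

text \<open>Concavity settles the case of affine rows, and the Lipschitz bound reduces to it.\<close>

lemma OT_row_right_derivative:
  fixes c :: "real \<Rightarrow> nat \<Rightarrow> real" and C :: "nat \<Rightarrow> nat \<Rightarrow> real"
  assumes i: "i < n"
    and d: "\<And>j. j < m \<Longrightarrow> ((\<lambda>h. (c h j - c 0 j) / h) \<longlongrightarrow> d j) (at_right 0)"
    and B: "\<And>j. j < m \<Longrightarrow> \<bar>d j\<bar> \<le> B"
  defines "F \<equiv> \<lambda>h. OT (\<lambda>i' j. if i' = i then c h j else C i' j)"
  obtains \<alpha> where "((\<lambda>h. (F h - F 0) / h) \<longlongrightarrow> \<alpha>) (at_right 0)" "\<bar>\<alpha>\<bar> \<le> q1 i * B"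
proof -
  \<comment> \<open>Row \<open>i\<close> is replaced by its linearisation at 0. By the Lipschitz
    bound \<open>F h - G h\<close> is o(h), so the difference quotients of \<open>F\<close> and
    \<open>G\<close> have the same limit.\<close>
  define G where "G h = OT (\<lambda>i' j. if i' = i then c 0 j + h * d j else C i' j)" for h
  define s where "s h = (G h - G 0) / h" for h
  have G0: "G 0 = F 0" by (simp add: G_def F_def cong: if_cong)
  have s_bound: "\<bar>s h\<bar> \<le> q1 i * B" if "0 < h" for h
  proof -
    have "\<bar>G h - G 0\<bar> \<le> q1 i * (h * B)"
      unfolding G_def using i B that
      by (intro OT_lipschitz_row) (auto simp: abs_mult)
    then show ?thesis
      using that by (simp add: s_def divide_simps abs_mult mult_ac)
  qed
  \<comment> \<open>By concavity \<open>G h1\<close> lies above the chord of \<open>G\<close> over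
    \<open>[0, h2]\<close>, so difference quotients decrease in \<open>h\<close>.\<close>
  have s_anti: "s h2 \<le> s h1" if "0 < h1" "h1 \<le> h2" for h1 h2
  proof -
    define t where "t = h1 / h2"
    have t: "0 \<le> t" "t \<le> 1" and h1: "h1 = t * h2" "0 < h2" using that by (auto simp: t_def)
    have "(1 - t) * G 0 + t * G h2 \<le>
        OT (\<lambda>i' j. (1 - t) * (if i' = i then c 0 j + 0 * d j else C i' j) +
                   t * (if i' = i then c 0 j + h2 * d j else C i' j))"
      unfolding G_def by (rule OT_concave[OF t])
    also have "\<dots> = G h1"
      unfolding G_def h1(1) by (intro arg_cong[where f = OT] ext) (auto simp: algebra_simps)
    finally have "t * (G h2 - G 0) \<le> G h1 - G 0" by (simp add: algebra_simps)
    then show ?thesis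
      using that unfolding s_def t_def by (simp add: field_simps)
  qed
  \<comment> \<open>An antitone function tends at \<open>0\<close> from the right to its supremum,
    which is finite by \<open>s_bound\<close>.\<close>
  define \<alpha> where "\<alpha> = (SUP h\<in>{0<..}. s h)"
  have bdd: "bdd_above (s ` {0<..})"
    using s_bound by (intro bdd_aboveI2[where M = "q1 i * B"]) (auto simp: abs_le_iff)
  have s_le: "s h \<le> \<alpha>" if "0 < h" for h
    unfolding \<alpha>_def using that by (intro cSUP_upper bdd) auto
  have s_lim: "(s \<longlongrightarrow> \<alpha>) (at_right 0)"
  proof (rule order_tendstoI)
    fix a assume "a < \<alpha>"
    then obtain h0 where h0: "0 < h0" "a < s h0"
      unfolding \<alpha>_def by (subst (asm) less_cSUP_iff) (auto simp: bdd)
    show "\<forall>\<^sub>F h in at_right 0. a < s h"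
      unfolding eventually_at_right_field
      using h0 s_anti by (intro exI[of _ h0]) (fastforce intro: less_le_trans)
  next
    fix a assume "\<alpha> < a"
    then show "\<forall>\<^sub>F h in at_right 0. s h < a"
      unfolding eventually_at_right_field
      using s_le by (intro exI[of _ 1]) (fastforce intro: le_less_trans)
  qed
  have lim0: "((\<lambda>h. (F h - F 0) / h - s h) \<longlongrightarrow> 0) (at_right 0)"
  proof (rule tendsto_rabs_zero_cancel, rule tendsto_sandwich)
    show "\<forall>\<^sub>F h in at_right 0. 0 \<le> \<bar>(F h - F 0) / h - s h\<bar>" by simp
    show "\<forall>\<^sub>F h in at_right 0. \<bar>(F h - F 0) / h - s h\<bar> \<le>
        q1 i * (\<Sum>j<m. \<bar>(c h j - c 0 j) / h - d j\<bar>)"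
    proof (rule eventually_at_right_less[THEN eventually_mono])
      fix h :: real assume h: "0 < h"
      have "\<bar>F h - G h\<bar> \<le> q1 i * (h * (\<Sum>j<m. \<bar>(c h j - c 0 j) / h - d j\<bar>))"
        unfolding F_def G_def
      proof (rule OT_lipschitz_row[OF i])
        fix j assume j: "j < m"
        have "\<bar>c h j - (c 0 j + h * d j)\<bar> = h * \<bar>(c h j - c 0 j) / h - d j\<bar>"
        proof -
          have "c h j - (c 0 j + h * d j) = h * ((c h j - c 0 j) / h - d j)"
            using h by (simp add: field_simps)
          then show ?thesis using h by (simp add: abs_mult)
        qed
        also have "\<dots> \<le> h * (\<Sum>j<m. \<bar>(c h j - c 0 j) / h - d j\<bar>)"
          using h j by (intro mult_left_mono member_le_sum) auto
        finally show "\<bar>(if i = i then c h j else C i j) - (if i = i then c 0 j + h * d j else C i j)\<bar>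
          \<le> h * (\<Sum>j<m. \<bar>(c h j - c 0 j) / h - d j\<bar>)" by simp
      qed auto
      moreover have "(F h - F 0) / h - s h = (F h - G h) / h"
        using h by (simp add: s_def G0 field_simps)
      ultimately show "\<bar>(F h - F 0) / h - s h\<bar> \<le> q1 i * (\<Sum>j<m. \<bar>(c h j - c 0 j) / h - d j\<bar>)"
        using h by (simp add: field_simps abs_mult)
    qed
    have "((\<lambda>h. q1 i * (\<Sum>j<m. \<bar>(c h j - c 0 j) / h - d j\<bar>)) \<longlongrightarrow>
        q1 i * (\<Sum>j<m. \<bar>d j - d j\<bar>)) (at_right 0)"
      by (intro tendsto_intros d) auto
    then show "((\<lambda>h. q1 i * (\<Sum>j<m. \<bar>(c h j - c 0 j) / h - d j\<bar>)) \<longlongrightarrow> 0) (at_right 0)" by simp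
  qed auto
  have "((\<lambda>h. (F h - F 0) / h) \<longlongrightarrow> \<alpha>) (at_right 0)"
    using tendsto_add[OF lim0 s_lim] by simp
  moreover have "\<bar>\<alpha>\<bar> \<le> q1 i * B"
  proof (rule tendsto_upperbound[OF tendsto_rabs[OF s_lim]])
    show "\<forall>\<^sub>F h in at_right 0. \<bar>s h\<bar> \<le> q1 i * B"
      by (rule eventually_at_right_less[THEN eventually_mono]) (rule s_bound)
  qed simp
  ultimately show thesis by (rule that)
qed

end

subsection \<open>Wasserstein distance of discrete measures\<close>

lemma sets_discrete_measure [simp, measurable_cong]: "sets (discrete_measure n q x) = sets borel"
  and space_discrete_measure [simp]: "space (discrete_measure n q x) = UNIV"
  by (auto simp: discrete_measure_def)

lemma nn_integral_discrete_measure: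
  assumes [measurable]: "f \<in> borel_measurable borel"
  shows "(\<integral>\<^sup>+ z. f z \<partial>discrete_measure n q x) = (\<Sum>i<n. ennreal (q i) * f (x i))"
  unfolding discrete_measure_def
  by (subst nn_integral_distr) (auto simp: nn_integral_point_measure_finite mult.commute)

text \<open>Points of weight 0 are exempt because the effective structure says nothing about their
  position.\<close>

lemma discrete_measure_cong:
  assumes "\<And>i. i < n \<Longrightarrow> q i \<noteq> 0 \<Longrightarrow> x i = y i"
  shows "discrete_measure n q x = discrete_measure n q y"
proof (rule measure_eqI)
  fix A assume "A \<in> sets (discrete_measure n q x)"
  moreover have "ennreal (q i) * indicator A (x i) = ennreal (q i) * indicator A (y i)" if "i < n" for i
    using assms[OF that] by (cases "q i = 0") auto
  ultimately show "emeasure (discrete_measure n q x) A = emeasure (discrete_measure n q y) A"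
    by (simp add: emeasure_discrete_measure)
qed simp

lemma distr_discrete_measure:
  assumes [measurable]: "f \<in> borel_measurable borel"
  shows "distr (discrete_measure n q x) borel f = discrete_measure n q (\<lambda>i. f (x i))"
  unfolding discrete_measure_def by (subst distr_distr) (auto simp: comp_def)

text \<open>The conditional probability of index \<open>i\<close> given the location \<open>a\<close>; a coupling of the
  measures is split with these weights when support points coincide.\<close>

definition index_weight :: "nat \<Rightarrow> (nat \<Rightarrow> real) \<Rightarrow> (nat \<Rightarrow> 'a) \<Rightarrow> nat \<Rightarrow> 'a \<Rightarrow> real" where
  "index_weight n q x i a = (if x i = a then q i / (\<Sum>k | k < n \<and> x k = a. q k) else 0)"

text \<open>Where the total mass \<open>Q a\<close> is 0 all weights are 0, as
  \<open>0 / 0 = 0\<close>, and their sum is 0 instead of 1. These locations form a null set, hence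
  the sum identity holds only almost everywhere.\<close>

lemma index_weight:
  fixes x :: "nat \<Rightarrow> 'a::{t1_space, topological_space}"
  assumes q: "\<And>i. i < n \<Longrightarrow> 0 \<le> q i"
  shows index_weight_nonneg: "i < n \<Longrightarrow> 0 \<le> index_weight n q x i a"
    and index_weight_measurable: "index_weight n q x i \<in> borel_measurable borel"
    and sum_index_weight: "AE a in discrete_measure n q x. (\<Sum>i<n. ennreal (index_weight n q x i a)) = 1"
    and nn_integral_index_weight:
      "i < n \<Longrightarrow> (\<integral>\<^sup>+ a. ennreal (index_weight n q x i a) \<partial>discrete_measure n q x) = ennreal (q i)"
proof -
  define Q where "Q a = (\<Sum>k | k < n \<and> x k = a. q k)" for a
  have Q0: "0 \<le> Q a" for a unfolding Q_def using q by (intro sum_nonneg) auto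
  have nonneg: "0 \<le> index_weight n q x i a" if "i < n" for i a
    using Q0[of a] q[OF that] by (auto simp: index_weight_def Q_def)
  then show "i < n \<Longrightarrow> 0 \<le> index_weight n q x i a" .
  have "index_weight n q x i = (\<lambda>a. q i / Q (x i) * indicator {x i} a)" for i
    by (auto simp: index_weight_def Q_def fun_eq_iff)
  then show meas: "index_weight n q x i \<in> borel_measurable borel" for i by simp
  note [measurable] = meas
  have total: "(\<Sum>i<n. index_weight n q x i a) = 1" if "Q a \<noteq> 0" for a
  proof -
    have "(\<Sum>i<n. index_weight n q x i a) = (\<Sum>i | i < n \<and> x i = a. q i / Q a)"
      by (rule sum.mono_neutral_cong_right) (auto simp: index_weight_def Q_def)
    also have "\<dots> = 1" using that by (simp add: Q_def flip: sum_divide_distrib)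
    finally show ?thesis .
  qed
  have q_le: "q i \<le> Q (x i)" if "i < n" for i
    unfolding Q_def using that q by (intro member_le_sum) auto
  have "AE a in discrete_measure n q x. (\<Sum>i<n. index_weight n q x i a) = 1"
  proof (rule AE_I)
    let ?N = "{a. (\<Sum>i<n. index_weight n q x i a) \<noteq> 1}"
    show "{a \<in> space (discrete_measure n q x). \<not> (\<Sum>i<n. index_weight n q x i a) = 1} \<subseteq> ?N"
      by simp
    show "?N \<in> sets (discrete_measure n q x)" by simp
    have "ennreal (q i) * indicator ?N (x i) = 0" if "i < n" for i
    proof (cases "q i = 0")
      case False
      then have "Q (x i) \<noteq> 0" using q_le[OF that] q[OF that] by linarith
      then show ?thesis using total[of "x i"] by simp
    qed simp
    then show "emeasure (discrete_measure n q x) ?N = 0"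
      by (subst emeasure_discrete_measure, simp) (blast intro: sum.neutral)
  qed
  then show "AE a in discrete_measure n q x. (\<Sum>i<n. ennreal (index_weight n q x i a)) = 1"
    by eventually_elim (subst sum_ennreal, auto simp: nonneg)
  show "(\<integral>\<^sup>+ a. ennreal (index_weight n q x i a) \<partial>discrete_measure n q x) = ennreal (q i)"
    if i: "i < n"
  proof -
    have "(\<integral>\<^sup>+ a. ennreal (index_weight n q x i a) \<partial>discrete_measure n q x)
        = (\<Sum>k<n. ennreal (q k * index_weight n q x i (x k)))"
      using q nonneg i
      by (subst nn_integral_discrete_measure) (auto simp: ennreal_mult intro!: sum.cong)
    also have "\<dots> = ennreal (\<Sum>k<n. q k * index_weight n q x i (x k))"
      using q nonneg i by (intro sum_ennreal) auto
    also have "(\<Sum>k<n. q k * index_weight n q x i (x k)) = (\<Sum>k | k < n \<and> x k = x i. q k * (q i / Q (x i)))"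
      by (rule sum.mono_neutral_cong_right) (auto simp: index_weight_def Q_def)
    also have "\<dots> = Q (x i) * (q i / Q (x i))"
      unfolding sum_distrib_right[symmetric] by (simp add: Q_def)
    also have "\<dots> = q i"
      using q_le[OF i] q[OF i] by (cases "Q (x i) = 0") auto
    finally show ?thesis .
  qed
qed

context discrete_marginals begin

lemma coupling_of_plan:
  fixes s r :: "nat \<Rightarrow> 'a::euclidean_space"
  assumes g: "\<gamma> \<in> plans"
  obtains \<Gamma> where "\<Gamma> \<in> couplings (discrete_measure n q1 s) (discrete_measure m q2 r)"
    "\<And>f. f \<in> borel_measurable borel \<Longrightarrow> (\<And>z. 0 \<le> f z) \<Longrightarrow>
      (\<integral>\<^sup>+ z. ennreal (f z) \<partial>\<Gamma>) = ennreal (cost (\<lambda>i j. f (s i, r j)) \<gamma>)"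
proof -
  let ?\<mu> = "discrete_measure n q1 s" and ?\<nu> = "discrete_measure m q2 r"
  define \<Gamma> where "\<Gamma> = distr (point_measure ({..<n} \<times> {..<m}) (\<lambda>(i, j). ennreal (\<gamma> i j)))
    (borel :: ('a \<times> 'a) measure) (\<lambda>(i, j). (s i, r j))"
  have sets[measurable_cong]: "sets \<Gamma> = sets (borel \<Otimes>\<^sub>M borel)" unfolding \<Gamma>_def borel_prod by simp
  have g0: "0 \<le> \<gamma> i j" if "i < n" "j < m" for i j
    using g that by (auto simp: transport_plans_def)
  have int: "(\<integral>\<^sup>+ z. f z \<partial>\<Gamma>) = (\<Sum>i<n. \<Sum>j<m. ennreal (\<gamma> i j) * f (s i, r j))"
    if "f \<in> borel_measurable (borel \<Otimes>\<^sub>M borel)" for f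
    using that[unfolded borel_prod] unfolding \<Gamma>_def
    by (subst nn_integral_distr)
      (auto simp: nn_integral_point_measure_finite sum.cartesian_product mult.commute intro!: sum.cong)
  have row: "(\<Sum>j<m. ennreal (\<gamma> i j)) = ennreal (q1 i)" if "i < n" for i
    using g g0[OF that] that by (subst sum_ennreal) (auto simp: transport_plans_def)
  have col: "(\<Sum>i<n. ennreal (\<gamma> i j)) = ennreal (q2 j)" if "j < m" for j
    using g g0[OF _ that] that by (subst sum_ennreal) (auto simp: transport_plans_def)
  have marg1: "distr \<Gamma> ?\<mu> fst = ?\<mu>"
  proof (rule measure_eqI)
    fix A assume "A \<in> sets (distr \<Gamma> ?\<mu> fst)"
    then have [measurable]: "A \<in> sets borel" by simp
    have [measurable]: "fst \<in> \<Gamma> \<rightarrow>\<^sub>M ?\<mu>" by measurable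
    have "emeasure (distr \<Gamma> ?\<mu> fst) A = (\<integral>\<^sup>+ a. indicator A a \<partial>distr \<Gamma> ?\<mu> fst)"
      by (subst nn_integral_indicator) auto
    also have "\<dots> = (\<integral>\<^sup>+ z. indicator A (fst z) \<partial>\<Gamma>)"
      by (subst nn_integral_distr) auto
    also have "\<dots> = (\<Sum>i<n. \<Sum>j<m. ennreal (\<gamma> i j) * indicator A (s i))"
      by (subst int) auto
    also have "\<dots> = (\<Sum>i<n. ennreal (q1 i) * indicator A (s i))"
      by (intro sum.cong refl) (simp add: row flip: sum_distrib_right)
    finally show "emeasure (distr \<Gamma> ?\<mu> fst) A = emeasure ?\<mu> A"
      by (simp add: emeasure_discrete_measure)
  qed simp
  have marg2: "distr \<Gamma> ?\<nu> snd = ?\<nu>"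
  proof (rule measure_eqI)
    fix A assume "A \<in> sets (distr \<Gamma> ?\<nu> snd)"
    then have [measurable]: "A \<in> sets borel" by simp
    have [measurable]: "snd \<in> \<Gamma> \<rightarrow>\<^sub>M ?\<nu>" by measurable
    have "emeasure (distr \<Gamma> ?\<nu> snd) A = (\<integral>\<^sup>+ a. indicator A a \<partial>distr \<Gamma> ?\<nu> snd)"
      by (subst nn_integral_indicator) auto
    also have "\<dots> = (\<integral>\<^sup>+ z. indicator A (snd z) \<partial>\<Gamma>)"
      by (subst nn_integral_distr) auto
    also have "\<dots> = (\<Sum>j<m. \<Sum>i<n. ennreal (\<gamma> i j) * indicator A (r j))"
      by (subst int, simp, subst sum.swap) auto
    also have "\<dots> = (\<Sum>j<m. ennreal (q2 j) * indicator A (r j))"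
      by (intro sum.cong refl) (simp add: col flip: sum_distrib_right)
    finally show "emeasure (distr \<Gamma> ?\<nu> snd) A = emeasure ?\<nu> A"
      by (simp add: emeasure_discrete_measure)
  qed simp
  have "sets (?\<mu> \<Otimes>\<^sub>M ?\<nu>) = sets ((borel :: 'a measure) \<Otimes>\<^sub>M (borel :: 'a measure))"
    by (rule sets_pair_measure_cong) auto
  then have "\<Gamma> \<in> couplings ?\<mu> ?\<nu>"
    unfolding couplings_def using marg1 marg2 sets by (simp add: borel_prod)
  moreover have "(\<integral>\<^sup>+ z. ennreal (f z) \<partial>\<Gamma>) = ennreal (cost (\<lambda>i j. f (s i, r j)) \<gamma>)"
    if fm: "f \<in> borel_measurable borel" and f: "\<And>z. 0 \<le> f z" for f
  proof -
    have [measurable]: "f \<in> borel_measurable (borel \<Otimes>\<^sub>M borel)" using fm by (simp add: borel_prod)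
    have "(\<integral>\<^sup>+ z. ennreal (f z) \<partial>\<Gamma>) = (\<Sum>i<n. \<Sum>j<m. ennreal (\<gamma> i j * f (s i, r j)))"
      using f g0 by (subst int) (auto simp: ennreal_mult intro!: sum.cong)
    also have "\<dots> = (\<Sum>i<n. ennreal (\<Sum>j<m. \<gamma> i j * f (s i, r j)))"
      using f g0 by (intro sum.cong refl sum_ennreal) auto
    also have "\<dots> = ennreal (cost (\<lambda>i j. f (s i, r j)) \<gamma>)"
      unfolding plan_cost_def using f g0 by (intro sum_ennreal sum_nonneg) auto
    finally show ?thesis .
  qed
  ultimately show thesis by (rule that)
qed

text \<open>The plan gives \<open>(i, j)\<close> the integral over the coupling of the product of
  the two index weights. Its marginals are right because the weights of each family sum to 1 almost
  everywhere.\<close>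

lemma plan_of_coupling:
  fixes s r :: "nat \<Rightarrow> 'a::euclidean_space"
  assumes G: "\<Gamma> \<in> couplings (discrete_measure n q1 s) (discrete_measure m q2 r)"
    and f: "f \<in> borel_measurable borel" "\<And>z. 0 \<le> f z"
  obtains \<gamma> where "\<gamma> \<in> plans" "ennreal (cost (\<lambda>i j. f (s i, r j)) \<gamma>) \<le> (\<integral>\<^sup>+ z. ennreal (f z) \<partial>\<Gamma>)"
proof -
  let ?\<mu> = "discrete_measure n q1 s" and ?\<nu> = "discrete_measure m q2 r"
  have "sets (?\<mu> \<Otimes>\<^sub>M ?\<nu>) = sets ((borel :: 'a measure) \<Otimes>\<^sub>M (borel :: 'a measure))"
    by (rule sets_pair_measure_cong) auto
  then have sets[measurable_cong]: "sets \<Gamma> = sets (borel \<Otimes>\<^sub>M borel)"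
    and m1: "distr \<Gamma> ?\<mu> fst = ?\<mu>" and m2: "distr \<Gamma> ?\<nu> snd = ?\<nu>"
    using G by (auto simp: couplings_def)
  note [measurable] = f(1)
  have f_pair[measurable]: "f \<in> borel_measurable (borel \<Otimes>\<^sub>M borel)"
    using f(1) by (simp add: borel_prod)
  have fst_m[measurable]: "fst \<in> \<Gamma> \<rightarrow>\<^sub>M ?\<mu>" and snd_m[measurable]: "snd \<in> \<Gamma> \<rightarrow>\<^sub>M ?\<nu>"
    by measurable
  define w1 where "w1 = index_weight n q1 s"
  define w2 where "w2 = index_weight m q2 r"
  note w1 = index_weight[where n = n and q = q1 and x = s, OF q1_nonneg, folded w1_def]
  note w2 = index_weight[where n = m and q = q2 and x = r, OF q2_nonneg, folded w2_def]
  have [measurable]: "w1 i \<in> borel_measurable borel" "w2 i \<in> borel_measurable borel" for i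
    using w1(2) w2(2) by auto
  have AE1: "AE z in \<Gamma>. (\<Sum>i<n. ennreal (w1 i (fst z))) = 1"
    by (rule AE_distrD[OF fst_m], subst m1, rule w1(3))
  have AE2: "AE z in \<Gamma>. (\<Sum>j<m. ennreal (w2 j (snd z))) = 1"
    by (rule AE_distrD[OF snd_m], subst m2, rule w2(3))
  have int1: "(\<integral>\<^sup>+ z. ennreal (w1 i (fst z)) \<partial>\<Gamma>) = ennreal (q1 i)" if "i < n" for i
  proof -
    have "(\<integral>\<^sup>+ a. ennreal (w1 i a) \<partial>distr \<Gamma> ?\<mu> fst) = ennreal (q1 i)"
      unfolding m1 by (rule w1(4)) (use that in auto)
    then show ?thesis by (simp add: nn_integral_distr)
  qed
  have int2: "(\<integral>\<^sup>+ z. ennreal (w2 j (snd z)) \<partial>\<Gamma>) = ennreal (q2 j)" if "j < m" for j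
  proof -
    have "(\<integral>\<^sup>+ a. ennreal (w2 j (snd a)) \<partial>\<Gamma>) = (\<integral>\<^sup>+ a. ennreal (w2 j a) \<partial>distr \<Gamma> ?\<nu> snd)"
      by (simp add: nn_integral_distr)
    also have "\<dots> = ennreal (q2 j)"
      unfolding m2 by (rule w2(4)) (use that in auto)
    finally show ?thesis .
  qed
  define g where "g i j = (\<integral>\<^sup>+ z. ennreal (w1 i (fst z)) * ennreal (w2 j (snd z)) \<partial>\<Gamma>)" for i j
  have row: "(\<Sum>j<m. g i j) = ennreal (q1 i)" if "i < n" for i
  proof -
    have "(\<Sum>j<m. g i j) = (\<integral>\<^sup>+ z. ennreal (w1 i (fst z)) * (\<Sum>j<m. ennreal (w2 j (snd z))) \<partial>\<Gamma>)"
      unfolding g_def sum_distrib_left by (subst nn_integral_sum) auto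
    also have "\<dots> = (\<integral>\<^sup>+ z. ennreal (w1 i (fst z)) \<partial>\<Gamma>)"
      by (rule nn_integral_cong_AE) (use AE2 in eventually_elim, simp)
    finally show ?thesis using int1[OF that] by simp
  qed
  have col: "(\<Sum>i<n. g i j) = ennreal (q2 j)" if "j < m" for j
  proof -
    have "(\<Sum>i<n. g i j) = (\<integral>\<^sup>+ z. (\<Sum>i<n. ennreal (w1 i (fst z))) * ennreal (w2 j (snd z)) \<partial>\<Gamma>)"
      unfolding g_def sum_distrib_right by (subst nn_integral_sum) auto
    also have "\<dots> = (\<integral>\<^sup>+ z. ennreal (w2 j (snd z)) \<partial>\<Gamma>)"
      by (rule nn_integral_cong_AE) (use AE1 in eventually_elim, simp)
    finally show ?thesis using int2[OF that] by simp
  qed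
  have fin: "g i j < \<top>" if "i < n" "j < m" for i j
  proof -
    have "g i j \<le> (\<Sum>j<m. g i j)" using that by (intro member_le_sum) auto
    then show ?thesis using row[OF that(1)] by (simp add: le_less_trans)
  qed
  define \<gamma> where "\<gamma> i j = enn2real (g i j)" for i j
  have g_eq: "g i j = ennreal (\<gamma> i j)" if "i < n" "j < m" for i j
    using fin[OF that] by (simp add: \<gamma>_def)
  have \<gamma>0: "0 \<le> \<gamma> i j" for i j by (simp add: \<gamma>_def)
  have "\<gamma> \<in> plans"
    unfolding transport_plans_def
  proof (intro CollectI conjI allI impI)
    show "0 \<le> \<gamma> i j" for i j by (rule \<gamma>0)
    show "(\<Sum>j<m. \<gamma> i j) = q1 i" if i: "i < n" for i
    proof -
      have "ennreal (\<Sum>j<m. \<gamma> i j) = ennreal (q1 i)"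
        using row[OF i] g_eq[OF i] by (subst sum_ennreal[symmetric]) (auto simp: \<gamma>0)
      then show ?thesis using q1_nonneg[OF i] by (subst (asm) ennreal_inj) (auto simp: \<gamma>0 intro: sum_nonneg)
    qed
    show "(\<Sum>i<n. \<gamma> i j) = q2 j" if j: "j < m" for j
    proof -
      have "ennreal (\<Sum>i<n. \<gamma> i j) = ennreal (q2 j)"
        using col[OF j] g_eq[OF _ j] by (subst sum_ennreal[symmetric]) (auto simp: \<gamma>0)
      then show ?thesis using q2_nonneg[OF j] by (subst (asm) ennreal_inj) (auto simp: \<gamma>0 intro: sum_nonneg)
    qed
  qed
  moreover have "ennreal (cost (\<lambda>i j. f (s i, r j)) \<gamma>) \<le> (\<integral>\<^sup>+ z. ennreal (f z) \<partial>\<Gamma>)"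
  proof -
    \<comment> \<open>The product of the weights vanishes unless \<open>z = (s i, r j)\<close>, so
      \<open>f\<close> may be evaluated at either point.\<close>
    have w_eq: "ennreal (w1 i (fst z)) * ennreal (w2 j (snd z)) * ennreal (f (s i, r j)) =
        ennreal (w1 i (fst z)) * ennreal (w2 j (snd z)) * ennreal (f z)" for i j z
      by (cases z) (auto simp: w1_def w2_def index_weight_def)
    have "ennreal (cost (\<lambda>i j. f (s i, r j)) \<gamma>) = (\<Sum>i<n. ennreal (\<Sum>j<m. \<gamma> i j * f (s i, r j)))"
      unfolding plan_cost_def using f(2)
      by (intro sum_ennreal[symmetric] sum_nonneg) (auto simp: \<gamma>0)
    also have "\<dots> = (\<Sum>i<n. \<Sum>j<m. ennreal (\<gamma> i j * f (s i, r j)))"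
      using f(2) by (intro sum.cong refl sum_ennreal[symmetric]) (auto simp: \<gamma>0)
    also have "\<dots> = (\<Sum>i<n. \<Sum>j<m. g i j * ennreal (f (s i, r j)))"
      using f(2) by (intro sum.cong refl) (auto simp: ennreal_mult g_eq \<gamma>0)
    also have "\<dots> = (\<Sum>i<n. \<Sum>j<m. \<integral>\<^sup>+ z. ennreal (w1 i (fst z)) * ennreal (w2 j (snd z)) * ennreal (f z) \<partial>\<Gamma>)"
      unfolding g_def by (intro sum.cong refl, subst nn_integral_multc[symmetric]) (auto simp: w_eq)
    also have "\<dots> = (\<integral>\<^sup>+ z. (\<Sum>i<n. \<Sum>j<m. ennreal (w1 i (fst z)) * ennreal (w2 j (snd z)) * ennreal (f z)) \<partial>\<Gamma>)"
      by (subst nn_integral_sum, simp, intro sum.cong refl, subst nn_integral_sum) auto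
    also have "\<dots> = (\<integral>\<^sup>+ z. (\<Sum>i<n. ennreal (w1 i (fst z))) * (\<Sum>j<m. ennreal (w2 j (snd z))) * ennreal (f z) \<partial>\<Gamma>)"
      unfolding sum_product unfolding sum_distrib_right ..
    also have "\<dots> = (\<integral>\<^sup>+ z. ennreal (f z) \<partial>\<Gamma>)"
      by (rule nn_integral_cong_AE) (use AE1 AE2 in eventually_elim, simp)
    finally show ?thesis by simp
  qed
  ultimately show thesis by (rule that)
qed

text \<open>The points need not be distinct. This matters because projecting to a line can merge
  distinct support points.\<close>

lemma wasserstein_discrete:
  fixes s r :: "nat \<Rightarrow> 'a::euclidean_space"
  shows "wasserstein_pow p (discrete_measure n q1 s) (discrete_measure m q2 r)
    = ennreal (OT (\<lambda>i j. norm (s i - r j) powr p))"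
proof (rule antisym)
  let ?\<mu> = "discrete_measure n q1 s" and ?\<nu> = "discrete_measure m q2 r"
  let ?f = "\<lambda>z :: 'a \<times> 'a. norm (fst z - snd z) powr p"
  have f: "?f \<in> borel_measurable borel"
    unfolding borel_prod[symmetric] by measurable
  have C: "(\<lambda>i j. ?f (s i, r j)) = (\<lambda>i j. norm (s i - r j) powr p)" by simp
  show "ennreal (OT (\<lambda>i j. norm (s i - r j) powr p)) \<le> wasserstein_pow p ?\<mu> ?\<nu>"
    unfolding wasserstein_pow_def
  proof (rule INF_greatest)
    fix \<Gamma> assume "\<Gamma> \<in> couplings ?\<mu> ?\<nu>"
    from plan_of_coupling[OF this f] obtain \<gamma> where "\<gamma> \<in> plans"
      "ennreal (cost (\<lambda>i j. ?f (s i, r j)) \<gamma>) \<le> (\<integral>\<^sup>+ z. ennreal (?f z) \<partial>\<Gamma>)" by auto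
    then show "ennreal (OT (\<lambda>i j. norm (s i - r j) powr p)) \<le> (\<integral>\<^sup>+ z. ennreal (?f z) \<partial>\<Gamma>)"
      using OT_le[of \<gamma> "\<lambda>i j. ?f (s i, r j)"] unfolding C
      by (meson ennreal_leI order_trans)
  qed
  show "wasserstein_pow p ?\<mu> ?\<nu> \<le> ennreal (OT (\<lambda>i j. norm (s i - r j) powr p))"
  proof (rule ennreal_le_epsilon)
    \<comment> \<open>An almost optimal plan takes the place of a minimiser.\<close>
    fix e :: real assume "0 < e"
    obtain \<gamma> where g: "\<gamma> \<in> plans" "cost (\<lambda>i j. norm (s i - r j) powr p) \<gamma> < OT (\<lambda>i j. norm (s i - r j) powr p) + e"
    proof -
      have "OT (\<lambda>i j. norm (s i - r j) powr p) < OT (\<lambda>i j. norm (s i - r j) powr p) + e"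
        using \<open>0 < e\<close> by simp
      then have "\<exists>\<gamma>\<in>plans. cost (\<lambda>i j. norm (s i - r j) powr p) \<gamma> < OT (\<lambda>i j. norm (s i - r j) powr p) + e"
        by (subst (asm) (1) transport_cost_def)
          (simp only: cINF_less_iff[OF plans_nonempty bdd_below_cost])
      then show ?thesis using that by blast
    qed
    from coupling_of_plan[OF g(1), of s r] obtain \<Gamma> where \<Gamma>: "\<Gamma> \<in> couplings ?\<mu> ?\<nu>"
      "\<And>f. f \<in> borel_measurable borel \<Longrightarrow> (\<And>z. 0 \<le> f z) \<Longrightarrow>
      (\<integral>\<^sup>+ z. ennreal (f z) \<partial>\<Gamma>) = ennreal (cost (\<lambda>i j. f (s i, r j)) \<gamma>)" by blast
    have "wasserstein_pow p ?\<mu> ?\<nu> \<le> (\<integral>\<^sup>+ z. ennreal (?f z) \<partial>\<Gamma>)"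
      unfolding wasserstein_pow_def by (rule INF_lower[OF \<Gamma>(1)])
    also have "\<dots> = ennreal (cost (\<lambda>i j. norm (s i - r j) powr p) \<gamma>)"
      using \<Gamma>(2)[OF f] by simp
    also have "\<dots> \<le> ennreal (OT (\<lambda>i j. norm (s i - r j) powr p) + e)"
      using g(2) by (intro ennreal_leI) simp
    also have "\<dots> = ennreal (OT (\<lambda>i j. norm (s i - r j) powr p)) + ennreal e"
      using \<open>0 < e\<close> by (intro ennreal_plus OT_nonneg) auto
    finally show "wasserstein_pow p ?\<mu> ?\<nu> \<le> ennreal (OT (\<lambda>i j. norm (s i - r j) powr p)) + ennreal e" .
  qed
qed

end

subsection \<open>Gradients of sums of ridge functions\<close>

lemma has_gradient_on_cong:
  assumes "\<And>z. z \<in> V \<Longrightarrow> f z = g z" "x \<in> V"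
  shows "has_gradient_on f V x v \<longleftrightarrow> has_gradient_on g V x v"
  unfolding has_gradient_on_def
  using assms by (metis has_derivative_transform)

lemma gradient_on_cong:
  assumes "\<And>z. z \<in> V \<Longrightarrow> f z = g z" "x \<in> V"
  shows "gradient_on f V x = gradient_on g V x"
proof -
  have "has_gradient_on f V x = has_gradient_on g V x"
    using has_gradient_on_cong[of V f g x] assms by blast
  then show ?thesis by (simp add: gradient_on_def)
qed

lemma has_gradient_on_scale:
  assumes "subspace V" "has_gradient_on f V x v"
  shows "has_gradient_on (\<lambda>z. c * f z) V x (c *\<^sub>R v)"
  using assms unfolding has_gradient_on_def
  by (auto intro!: derivative_eq_intros subspace_scale simp: inner_scaleR_right)

lemma has_gradient_on_scale_iff:
  assumes "subspace V" "c \<noteq> 0"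
  shows "(\<exists>v. has_gradient_on (\<lambda>z. c * f z) V x v) \<longleftrightarrow> (\<exists>v. has_gradient_on f V x v)"
  using has_gradient_on_scale[OF assms(1), of f x _ c]
    has_gradient_on_scale[OF assms(1), of "\<lambda>z. c * f z" x _ "1 / c"] assms(2) by auto

lemma gradient_on_eq_0:
  assumes "\<nexists>v. has_gradient_on f V x v"
  shows "gradient_on f V x = 0"
  unfolding gradient_on_def using assms by auto

lemma gradient_on_scale:
  assumes "subspace V" "x \<in> V" "c \<noteq> 0"
  shows "gradient_on (\<lambda>z. c * f z) V x = c *\<^sub>R gradient_on f V x"
proof (cases "\<exists>v. has_gradient_on f V x v")
  case True
  then obtain v where v: "has_gradient_on f V x v" by blast
  show ?thesis
    using gradient_on_eq[OF assms(1,2) v]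
      gradient_on_eq[OF assms(1,2) has_gradient_on_scale[OF assms(1) v]] by simp
next
  case False
  then show ?thesis
    using has_gradient_on_scale_iff[OF assms(1,3)] by (auto simp: gradient_on_eq_0)
qed

text \<open>The hypothesis on \<open>F\<close> says that \<open>F l\<close> has the one-sided derivatives \<open>a l \<plusminus> k l\<close> at \<open>0\<close>, and the
  condition in the conclusion that the even part of the directional derivative of \<open>f\<close> vanishes.\<close>

lemma gradient_on_ridge_sum:
  fixes u :: "'i \<Rightarrow> 'a::euclidean_space" and F :: "'i \<Rightarrow> real \<Rightarrow> real"
  assumes V: "subspace V" and x: "x \<in> V" and u: "\<And>l. l \<in> I \<Longrightarrow> u l \<in> V" and "finite I"
    and F: "\<And>l. l \<in> I \<Longrightarrow> ((\<lambda>h. F l h - k l * \<bar>h\<bar>) has_real_derivative a l) (at 0)"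
    and f: "\<And>z. z \<in> V \<Longrightarrow> f z = (\<Sum>l\<in>I. w l * F l ((z - x) \<bullet> u l))"
  shows "gradient_on f V x =
    (if \<forall>v\<in>V. (\<Sum>l\<in>I. w l * k l * \<bar>v \<bullet> u l\<bar>) = 0 then \<Sum>l\<in>I. (w l * a l) *\<^sub>R u l else 0)"
proof -
  \<comment> \<open>Without its kink each profile is differentiable at 0. Thus \<open>f\<close>
    splits into a differentiable part \<open>S\<close> and the even, positively homogeneous
    remainder \<open>E\<close>.\<close>
  define H where "H l h = F l h - k l * \<bar>h\<bar>" for l h
  define g where "g = (\<Sum>l\<in>I. (w l * a l) *\<^sub>R u l)"
  define E where "E v = (\<Sum>l\<in>I. w l * k l * \<bar>v \<bullet> u l\<bar>)" for v
  define S where "S z = (\<Sum>l\<in>I. w l * H l ((z - x) \<bullet> u l))" for z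
  have fS: "f z = S z + E (z - x)" if "z \<in> V" for z
    unfolding f[OF that] S_def E_def H_def by (simp add: algebra_simps sum.distrib[symmetric])
  have H: "((\<lambda>z. H l ((z - x) \<bullet> u l)) has_derivative (\<lambda>h. a l * (h \<bullet> u l))) (at x within V)"
    if "l \<in> I" for l
  proof -
    have "(H l has_derivative (\<lambda>h. a l * h)) (at ((x - x) \<bullet> u l))"
      using F[OF that] by (simp add: H_def[abs_def] has_field_derivative_def)
    moreover have "((\<lambda>z. (z - x) \<bullet> u l) has_derivative (\<lambda>h. h \<bullet> u l)) (at x within V)"
      by (auto intro!: derivative_eq_intros)
    ultimately show ?thesis by (rule has_derivative_compose[rotated])
  qed
  have S: "(S has_derivative (\<lambda>h. h \<bullet> g)) (at x within V)"
  proof -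
    have "(S has_derivative (\<lambda>h. \<Sum>l\<in>I. w l * (a l * (h \<bullet> u l)))) (at x within V)"
      unfolding S_def by (intro has_derivative_sum has_derivative_mult_right H)
    also have "(\<lambda>h. \<Sum>l\<in>I. w l * (a l * (h \<bullet> u l))) = (\<lambda>h. h \<bullet> g)"
      by (auto simp: g_def inner_sum_right mult.assoc)
    finally show ?thesis .
  qed
  have gV: "g \<in> V" unfolding g_def by (intro subspace_sum subspace_scale V u)
  show ?thesis
  proof (cases "\<forall>v\<in>V. E v = 0")
    case True
    have "f z = S z" if "z \<in> V" for z
      using fS[OF that] True V x that by (simp add: subspace_diff)
    then have "has_gradient_on f V x g"
      using S gV x by (subst has_gradient_on_cong[where g = S]) (auto simp: has_gradient_on_def)
    from gradient_on_eq[OF V x this] True show ?thesis by (simp add: E_def g_def)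
  next
    case False
    then obtain v where v: "v \<in> V" "E v \<noteq> 0" by blast
    have "\<not> has_gradient_on f V x d" for d
    proof
      assume "has_gradient_on f V x d"
      then have fd: "(f has_derivative (\<lambda>h. h \<bullet> d)) (at x within V)"
        by (simp add: has_gradient_on_def)
      \<comment> \<open>On the line through \<open>x\<close> in direction \<open>v\<close>,
        \<open>f - S\<close> equals \<open>|t| * E v\<close>. A derivative \<open>b\<close> of this
        even function would also be \<open>- b\<close>, hence 0, while the quotient from the right
        is constantly \<open>E v\<close>.\<close>
      define b where "b = v \<bullet> d - v \<bullet> g"
      have D1: "((\<lambda>z. f z - S z) has_derivative (\<lambda>h. h \<bullet> d - h \<bullet> g)) (at x within V)"
        by (rule has_derivative_diff[OF fd S])
      have line: "((\<lambda>t::real. x + t *\<^sub>R v) has_derivative (\<lambda>t. t *\<^sub>R v)) (at 0)"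
        by (auto intro!: derivative_eq_intros)
      have sub: "(\<lambda>t::real. x + t *\<^sub>R v) ` UNIV \<subseteq> V"
        using V x v by (auto intro: subspace_add subspace_scale)
      have "((\<lambda>z. f z - S z) has_derivative (\<lambda>h. h \<bullet> d - h \<bullet> g))
          (at (x + 0 *\<^sub>R v) within range (\<lambda>t::real. x + t *\<^sub>R v))"
        using has_derivative_subset[OF D1 sub] by simp
      from has_derivative_in_compose[OF line this]
      have "((\<lambda>t. f (x + t *\<^sub>R v) - S (x + t *\<^sub>R v)) has_derivative
          (\<lambda>t. (t *\<^sub>R v) \<bullet> d - (t *\<^sub>R v) \<bullet> g)) (at 0)" .
      moreover have "f (x + t *\<^sub>R v) - S (x + t *\<^sub>R v) = \<bar>t\<bar> * E v" for t
      proof -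
        have "x + t *\<^sub>R v \<in> V" using sub by auto
        from fS[OF this] show ?thesis
          by (simp add: E_def sum_distrib_left abs_mult mult_ac)
      qed
      moreover have "(\<lambda>t. (t *\<^sub>R v) \<bullet> d - (t *\<^sub>R v) \<bullet> g) = (*) b"
        by (auto simp: b_def algebra_simps)
      ultimately have D: "((\<lambda>t. \<bar>t\<bar> * E v) has_real_derivative b) (at 0)"
        by (simp add: has_field_derivative_def)
      have "((\<lambda>t. \<bar>t\<bar> * E v) has_real_derivative - b) (at 0)"
      proof -
        have "(uminus has_real_derivative - 1) (at (0 :: real))"
          by (auto intro!: derivative_eq_intros)
        with D have "((\<lambda>t. \<bar>- t\<bar> * E v) has_real_derivative b * - 1) (at 0)"
          by (intro DERIV_chain2[where f = "\<lambda>t. \<bar>t\<bar> * E v" and g = uminus]) auto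
        then show ?thesis by simp
      qed
      from DERIV_unique[OF D this] have "b = 0" by simp
      with D have "((\<lambda>t. \<bar>t\<bar> * E v / t) \<longlongrightarrow> 0) (at 0)"
        by (simp add: DERIV_def)
      then have "((\<lambda>t. \<bar>t\<bar> * E v / t) \<longlongrightarrow> 0) (at_right 0)"
        by (rule filterlim_mono) (auto simp: at_within_le_at)
      moreover have "\<forall>\<^sub>F t in at_right 0. \<bar>t\<bar> * E v / t = E v"
        by (rule eventually_at_right_less[THEN eventually_mono]) simp
      ultimately have "((\<lambda>t::real. E v) \<longlongrightarrow> 0) (at_right 0)"
        by (simp add: tendsto_cong)
      then have "E v = 0" by (simp add: tendsto_const_iff)
      with v(2) show False by simp
    qed
    then have "gradient_on f V x = 0" by (intro gradient_on_eq_0) blast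
    with False show ?thesis by (auto simp: E_def)
  qed
qed

text \<open>Finitely many hyperplanes do not cover a subspace that contains their nonzero normals.
  In the induction, a vector that works for \<open>S\<close> is moved along the new normal
  \<open>s\<close>.\<close>

lemma exists_nonorthogonal:
  fixes S :: "'a::real_inner set"
  assumes "finite S" "subspace W" "S \<subseteq> W" "0 \<notin> S"
  shows "\<exists>v\<in>W. \<forall>s\<in>S. v \<bullet> s \<noteq> 0"
  using assms(1,3,4)
proof (induction S)
  case empty
  then show ?case using subspace_0[OF assms(2)] by auto
next
  case (insert s S)
  then obtain v where v: "v \<in> W" "\<forall>r\<in>S. v \<bullet> r \<noteq> 0" by auto
  \<comment> \<open>For \<open>s \<bullet> r\<close> nonzero the listed value is the only
    \<open>c\<close> that makes \<open>v + c *\<^sub>R s\<close> orthogonal to \<open>r\<close>. For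
    \<open>s \<bullet> r = 0\<close> division by zero merely excludes the value 0.\<close>
  have "finite ((\<lambda>r. - (v \<bullet> r) / (s \<bullet> r)) ` insert s S)" using insert by auto
  then obtain c where c: "c \<notin> (\<lambda>r. - (v \<bullet> r) / (s \<bullet> r)) ` insert s S"
    using ex_new_if_finite[OF infinite_UNIV_char_0] by blast
  have "(v + c *\<^sub>R s) \<bullet> r \<noteq> 0" if r: "r \<in> insert s S" for r
  proof (cases "s \<bullet> r = 0")
    case True
    then have "r \<noteq> s" using insert.prems by auto
    then show ?thesis using True v r by (simp add: inner_add_left)
  next
    case False
    have "c \<noteq> - (v \<bullet> r) / (s \<bullet> r)" using c r by auto
    then show ?thesis using False by (auto simp: inner_add_left field_simps)
  qed
  moreover have "v + c *\<^sub>R s \<in> W"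
    using v insert.prems assms(2) by (auto intro: subspace_add subspace_scale)
  ultimately show ?case by blast
qed

text \<open>The kinks of \<open>\<bar>v \<bullet> u l\<bar>\<close> along different hyperplanes cannot cancel. Taking the second difference
  in direction \<open>u l0\<close> at a point that lies on no kink hyperplane but that of \<open>u l0\<close> isolates the
  terms with \<open>u l = \<plusminus> u l0\<close>.\<close>

lemma kink_sum_eq_0_iff:
  fixes u :: "'i \<Rightarrow> 'a::real_inner"
  assumes V: "subspace V" and u: "\<And>l. l \<in> I \<Longrightarrow> u l \<in> V" and fin: "finite I"
    and norm: "\<And>l. l \<in> I \<Longrightarrow> u l = 0 \<or> norm (u l) = 1"
    and w: "\<And>l. l \<in> I \<Longrightarrow> u l \<noteq> 0 \<Longrightarrow> 0 < w l"
    and k: "\<And>l j. l \<in> I \<Longrightarrow> j \<in> I \<Longrightarrow> u l = u j \<or> u l = - u j \<Longrightarrow> u l \<noteq> 0 \<Longrightarrow> k l = k j"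
  shows "(\<forall>v\<in>V. (\<Sum>l\<in>I. w l * k l * \<bar>v \<bullet> u l\<bar>) = 0) \<longleftrightarrow> (\<forall>l\<in>I. u l \<noteq> 0 \<longrightarrow> k l = 0)"
proof
  assume "\<forall>l\<in>I. u l \<noteq> 0 \<longrightarrow> k l = 0"
  then show "\<forall>v\<in>V. (\<Sum>l\<in>I. w l * k l * \<bar>v \<bullet> u l\<bar>) = 0"
    by (intro ballI sum.neutral) auto
next
  assume sum0: "\<forall>v\<in>V. (\<Sum>l\<in>I. w l * k l * \<bar>v \<bullet> u l\<bar>) = 0"
  show "\<forall>l\<in>I. u l \<noteq> 0 \<longrightarrow> k l = 0"
  proof (intro ballI impI)
    fix l0 assume l0: "l0 \<in> I" "u l0 \<noteq> 0"
    define e where "e = u l0"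
    have e: "e \<in> V" "norm e = 1" using l0 u norm by (auto simp: e_def)
    have ee: "e \<bullet> e = 1" using e by (simp add: dot_square_norm)
    define P where "P = {l \<in> I. u l = e \<or> u l = - e}"
    define Q where "Q = {l \<in> I. u l \<noteq> 0} - P"
    \<comment> \<open>Projection onto the orthogonal complement of \<open>e\<close>. A unit vector
      other than \<open>e\<close> and \<open>- e\<close> has a nonzero image, so a vector of
      \<open>W\<close> can avoid all its hyperplanes at once.\<close>
    define pr where "pr z = z - (z \<bullet> e) *\<^sub>R e" for z
    define W where "W = {v \<in> V. v \<bullet> e = 0}"
    have W: "subspace W"
      using V unfolding W_def subspace_def by (auto simp: inner_add_left)
    have pr0: "pr (u l) \<noteq> 0" if "l \<in> Q" for l
    proof
      assume "pr (u l) = 0"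
      then have eq: "u l = (u l \<bullet> e) *\<^sub>R e" by (simp add: pr_def)
      have "norm (u l) = 1" using that norm by (auto simp: Q_def)
      then have "\<bar>u l \<bullet> e\<bar> = 1" using eq e(2) by (metis mult.right_neutral norm_scaleR)
      then have "u l = e \<or> u l = - e" using eq by (metis abs_eq_iff' scaleR_minus1_left scaleR_one)
      then show False using that by (auto simp: Q_def P_def)
    qed
    have prW: "pr (u l) \<in> W" if "l \<in> I" for l
      using u[OF that] e V ee
      by (auto simp: W_def pr_def inner_diff_left intro: subspace_diff subspace_scale)
    have "\<exists>v\<in>W. \<forall>s\<in>(\<lambda>l. pr (u l)) ` Q. v \<bullet> s \<noteq> 0"
      using prW pr0 fin by (intro exists_nonorthogonal W) (auto simp: Q_def)
    then obtain v where v: "v \<in> V" "v \<bullet> e = 0" "\<And>l. l \<in> Q \<Longrightarrow> v \<bullet> pr (u l) \<noteq> 0"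
      by (auto simp: W_def)
    have vQ: "v \<bullet> u l \<noteq> 0" if "l \<in> Q" for l
      using v(3)[OF that] v(2) by (auto simp: pr_def inner_diff_right)
    \<comment> \<open>So small that moving \<open>v\<close> by at most \<open>\<tau>\<close> along
      \<open>e\<close> changes the sign of no \<open>v \<bullet> u l\<close> with \<open>l\<close>
      in \<open>Q\<close>.\<close>
    define \<tau> where "\<tau> = Min (insert 1 ((\<lambda>l. \<bar>v \<bullet> u l\<bar>) ` Q))"
    have finQ: "finite Q" using fin by (auto simp: Q_def)
    have \<tau>: "0 < \<tau>" unfolding \<tau>_def using finQ vQ by (subst Min_gr_iff) auto
    have \<tau>_le: "\<tau> \<le> \<bar>v \<bullet> u l\<bar>" if "l \<in> Q" for l
      unfolding \<tau>_def using finQ that by (intro Min_le) auto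
    \<comment> \<open>Second difference of the kink of \<open>u l\<close>: \<open>2 * \<tau>\<close>
      if the kink hyperplane contains \<open>v\<close> and is that of \<open>e\<close>, and 0 on the
      remaining terms, which are linear on the segment.\<close>
    define D where "D l = \<bar>(v + \<tau> *\<^sub>R e) \<bullet> u l\<bar> + \<bar>(v - \<tau> *\<^sub>R e) \<bullet> u l\<bar> - 2 * \<bar>v \<bullet> u l\<bar>" for l
    have DP: "D l = 2 * \<tau>" if "l \<in> P" for l
      using that v(2) ee \<tau> by (auto simp: D_def P_def inner_add_left inner_diff_left abs_mult)
    have D0: "D l = 0" if l: "l \<in> I" "l \<notin> P" for l
    proof (cases "u l = 0")
      case False
      with l have Q: "l \<in> Q" by (auto simp: Q_def)
      have "\<bar>e \<bullet> u l\<bar> \<le> 1"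
        using Cauchy_Schwarz_ineq2[of e "u l"] norm[OF l(1)] e False by simp
      then have "\<tau> * \<bar>e \<bullet> u l\<bar> \<le> \<tau> * 1" using \<tau> by (intro mult_left_mono) auto
      then have "\<bar>\<tau> * (e \<bullet> u l)\<bar> \<le> \<bar>v \<bullet> u l\<bar>"
        using \<tau>_le[OF Q] \<tau> by (simp only: abs_mult)
      then show ?thesis unfolding D_def by (simp add: inner_add_left inner_diff_left)
    qed (simp add: D_def)
    have "(\<Sum>l\<in>I. w l * k l * D l) =
        (\<Sum>l\<in>I. w l * k l * \<bar>(v + \<tau> *\<^sub>R e) \<bullet> u l\<bar>) + (\<Sum>l\<in>I. w l * k l * \<bar>(v - \<tau> *\<^sub>R e) \<bullet> u l\<bar>)
        - 2 * (\<Sum>l\<in>I. w l * k l * \<bar>v \<bullet> u l\<bar>)"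
      unfolding D_def sum_distrib_left sum.distrib[symmetric] sum_subtractf[symmetric]
      by (rule sum.cong) (auto simp: algebra_simps)
    also have "\<dots> = 0"
      using sum0 v(1) e(1) V by (simp add: subspace_add subspace_diff subspace_scale)
    finally have "(\<Sum>l\<in>I. w l * k l * D l) = 0" .
    moreover have "(\<Sum>l\<in>I. w l * k l * D l) = (\<Sum>l\<in>P. w l * k l0 * (2 * \<tau>))"
    proof (rule sum.mono_neutral_cong_right[OF fin])
      show "w l * k l * D l = w l * k l0 * (2 * \<tau>)" if "l \<in> P" for l
        using that DP[OF that] k[of l0 l] l0 by (auto simp: P_def e_def)
    qed (auto simp: P_def D0)
    moreover have "(\<Sum>l\<in>P. w l * k l0 * (2 * \<tau>)) = (\<Sum>l\<in>P. w l) * (k l0 * (2 * \<tau>))"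
      by (simp add: sum_distrib_right mult.assoc)
    moreover have "0 < (\<Sum>l\<in>P. w l)"
    proof (rule sum_pos)
      show "finite P" using fin by (auto simp: P_def)
      show "P \<noteq> {}" using l0 by (auto simp: P_def e_def)
      show "0 < w l" if "l \<in> P" for l
        using that l0 by (intro w) (auto simp: P_def e_def)
    qed
    ultimately show "k l0 = 0" using \<tau> by simp
  qed
qed

subsection \<open>Hoeffding's inequality for vectors\<close>

text \<open>In \<open>x\<close>, cosh of \<open>sqrt x\<close> is the power series with terms
  \<open>x^k / (2k)!\<close>. Its coefficients are nonnegative and each power is convex on the
  nonnegative reals.\<close>

lemma cosh_sqrt_convex:
  fixes a b t :: real
  assumes "0 \<le> a" "0 \<le> b" "0 \<le> t" "t \<le> 1"
  shows "cosh (sqrt ((1 - t) * a + t * b)) \<le> (1 - t) * cosh (sqrt a) + t * cosh (sqrt b)"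
proof -
  have convex: "convex_on {0..} (\<lambda>x :: real. x ^ k)" for k
    using convex_power_odd convex_on_subset[OF convex_power_even] by (cases "even k") auto
  \<comment> \<open>The series is indexed by the exponent of \<open>sqrt x\<close>, with zeros at
    odd places, to match the series of cosh term by term.\<close>
  define f where "f x n = (if even n then x ^ (n div 2) / fact n else 0)" for x :: real and n :: nat
  have f: "f x sums cosh (sqrt x)" if "0 \<le> x" for x
  proof -
    have "sqrt x ^ n = x ^ (n div 2)" if "even n" for n
      using that \<open>0 \<le> x\<close> by (auto elim!: evenE simp: power_mult)
    then have "f x = (\<lambda>n. if even n then sqrt x ^ n /\<^sub>R fact n else 0)"
      by (auto simp: f_def divide_inverse_commute)
    then show ?thesis using cosh_converges[of "sqrt x"] by simp
  qed
  have "f ((1 - t) * a + t * b) n \<le> (1 - t) * f a n + t * f b n" for n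
  proof (cases "even n")
    case True
    have "((1 - t) * a + t * b) ^ (n div 2) \<le> (1 - t) * a ^ (n div 2) + t * b ^ (n div 2)"
      using convex_onD[OF convex, of t a b "n div 2"] assms by simp
    then have "((1 - t) * a + t * b) ^ (n div 2) / fact n \<le>
        ((1 - t) * a ^ (n div 2) + t * b ^ (n div 2)) / fact n"
      by (intro divide_right_mono) auto
    then show ?thesis using True by (simp add: f_def add_divide_distrib)
  qed (simp add: f_def)
  then show ?thesis
    using assms by (intro sums_le[OF _ f sums_add[OF sums_mult[OF f] sums_mult[OF f]]]) auto
qed

text \<open>The weight depends only on the angle between \<open>s\<close> and \<open>x\<close>: the squared norm of \<open>s + \<xi> x\<close> is the
  corresponding mean of the squares for the two collinear configurations.\<close>

lemma cosh_norm_add_le: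
  fixes s x :: "'a::real_inner"
  obtains t where "0 \<le> t" "t \<le> 1"
    "\<And>\<xi>. cosh (norm (s + \<xi> *\<^sub>R x)) \<le>
       (1 - t) * cosh (norm s - \<xi> * norm x) + t * cosh (norm s + \<xi> * norm x)"
proof -
  \<comment> \<open>The cosine of the angle between \<open>s\<close> and \<open>x\<close>, by
    division 0 if one of them vanishes; \<open>sx\<close> holds in that case too.\<close>
  define c where "c = (s \<bullet> x) / (norm s * norm x)"
  have c: "\<bar>c\<bar> \<le> 1"
    using Cauchy_Schwarz_ineq2[of s x] by (auto simp: c_def abs_mult divide_le_eq_1)
  have sx: "s \<bullet> x = c * norm s * norm x" by (auto simp: c_def)
  \<comment> \<open>Chosen so that \<open>2 * t - 1 = c\<close>, which matches the cross terms of
    the squared norms. It does not involve \<open>\<xi>\<close>, so the inequality can be integrated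
    over \<open>\<xi>\<close>.\<close>
  define t where "t = (1 + c) / 2"
  have t: "0 \<le> t" "t \<le> 1" using c by (auto simp: t_def abs_le_iff)
  have "cosh (norm (s + \<xi> *\<^sub>R x)) \<le>
       (1 - t) * cosh (norm s - \<xi> * norm x) + t * cosh (norm s + \<xi> * norm x)" for \<xi>
  proof -
    have "(norm (s + \<xi> *\<^sub>R x))\<^sup>2 = (norm s)\<^sup>2 + 2 * \<xi> * (s \<bullet> x) + \<xi>\<^sup>2 * (norm x)\<^sup>2"
      unfolding power2_norm_eq_inner
      by (simp add: inner_add_left inner_add_right inner_commute power2_eq_square)
    also have "\<dots> = (1 - t) * (norm s - \<xi> * norm x)\<^sup>2 + t * (norm s + \<xi> * norm x)\<^sup>2"
      unfolding sx t_def by (simp add: power2_eq_square field_simps)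
    finally have "norm (s + \<xi> *\<^sub>R x) =
        sqrt ((1 - t) * (norm s - \<xi> * norm x)\<^sup>2 + t * (norm s + \<xi> * norm x)\<^sup>2)"
      by (metis norm_ge_zero real_sqrt_unique)
    then show ?thesis
      using cosh_sqrt_convex[of "(norm s - \<xi> * norm x)\<^sup>2" "(norm s + \<xi> * norm x)\<^sup>2" t] t by simp
  qed
  with t show thesis by (rule that)
qed

locale unit_interval_distribution = prob_space N for N :: "real measure" +
  assumes sets_N [measurable_cong, simp]: "sets N = sets borel"
    and AE_N: "AE \<xi> in N. \<xi> \<in> {0..1}"
begin

abbreviation "mean \<equiv> expectation (\<lambda>\<xi>. \<xi>)"

lemma space_N [simp]: "space N = UNIV"
  using sets_eq_imp_space_eq[OF sets_N] by simp

text \<open>Hoeffding's lemma for an interval of length 1, whence the constant 8. It is stated for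
  positive parameters; a negative \<open>l\<close> is treated by reflecting the variable.\<close>

lemma exp_moment: "(\<integral>\<^sup>+ \<xi>. ennreal (exp (l * (\<xi> - mean))) \<partial>N) \<le> ennreal (exp (l\<^sup>2 / 8))"
proof -
  interpret A: interval_bounded_random_variable N "\<lambda>\<xi>. \<xi>" 0 1
    by unfold_locales (use AE_N in auto)
  interpret B: interval_bounded_random_variable N "\<lambda>\<xi>. - \<xi>" "- 1" 0
    by unfold_locales (use AE_N in auto)
  consider "0 < l" | "l = 0" | "0 < - l" by linarith
  then show ?thesis
  proof cases
    case 1
    then show ?thesis using A.Hoeffdings_lemma_nn_integral[of l] by simp
  next
    case 2
    then show ?thesis by (simp add: emeasure_space_1[simplified])
  next
    case 3
    have "- l * (- \<xi> - expectation uminus) = l * (\<xi> - mean)" for \<xi>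
      by (simp add: algebra_simps)
    then show ?thesis using 3 B.Hoeffdings_lemma_nn_integral[of "- l"] by simp
  qed
qed

lemma cosh_moment:
  "(\<integral>\<^sup>+ \<xi>. ennreal (cosh (\<alpha> + (\<xi> - mean) * \<beta>)) \<partial>N) \<le> ennreal (cosh \<alpha> * exp (\<beta>\<^sup>2 / 8))"
proof -
  have "cosh (\<alpha> + (\<xi> - mean) * \<beta>) =
      exp \<alpha> / 2 * exp (\<beta> * (\<xi> - mean)) + exp (- \<alpha>) / 2 * exp (- \<beta> * (\<xi> - mean))" for \<xi>
    by (simp add: cosh_field_def exp_add[symmetric] algebra_simps add_divide_distrib)
  then have "ennreal (cosh (\<alpha> + (\<xi> - mean) * \<beta>)) =
      ennreal (exp \<alpha> / 2) * ennreal (exp (\<beta> * (\<xi> - mean))) +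
      ennreal (exp (- \<alpha>) / 2) * ennreal (exp (- \<beta> * (\<xi> - mean)))" for \<xi>
    by (simp only: ennreal_plus[symmetric] ennreal_mult[symmetric] exp_ge_zero mult_nonneg_nonneg
        divide_nonneg_nonneg zero_le_numeral)
  then have "(\<integral>\<^sup>+ \<xi>. ennreal (cosh (\<alpha> + (\<xi> - mean) * \<beta>)) \<partial>N) =
      ennreal (exp \<alpha> / 2) * (\<integral>\<^sup>+ \<xi>. ennreal (exp (\<beta> * (\<xi> - mean))) \<partial>N) +
      ennreal (exp (- \<alpha>) / 2) * (\<integral>\<^sup>+ \<xi>. ennreal (exp (- \<beta> * (\<xi> - mean))) \<partial>N)"
    by (simp only:) (subst nn_integral_add; simp add: nn_integral_cmult)
  also have "\<dots> \<le> ennreal (exp \<alpha> / 2) * ennreal (exp (\<beta>\<^sup>2 / 8)) +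
      ennreal (exp (- \<alpha>) / 2) * ennreal (exp ((- \<beta>)\<^sup>2 / 8))"
    by (intro add_mono mult_left_mono exp_moment) auto
  also have "\<dots> = ennreal (cosh \<alpha> * exp (\<beta>\<^sup>2 / 8))"
    by (simp add: ennreal_mult[symmetric] ennreal_plus[symmetric] cosh_field_def algebra_simps add_divide_distrib
        del: ennreal_plus)
  finally show ?thesis .
qed

text \<open>Both collinear configurations satisfy the same bound, so the weights
  \<open>1 - t\<close> and \<open>t\<close> disappear. The problem is thereby reduced to the real
  line and no dimension enters the constant.\<close>

lemma cosh_norm_moment:
  fixes s x :: "'a::euclidean_space"
  shows "(\<integral>\<^sup>+ \<xi>. ennreal (cosh (norm (s + (\<xi> - mean) *\<^sub>R x))) \<partial>N)
    \<le> ennreal (cosh (norm s)) * ennreal (exp ((norm x)\<^sup>2 / 8))"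
proof -
  obtain t where t: "0 \<le> t" "t \<le> 1"
    "\<And>\<xi>. cosh (norm (s + \<xi> *\<^sub>R x)) \<le>
       (1 - t) * cosh (norm s - \<xi> * norm x) + t * cosh (norm s + \<xi> * norm x)"
    using cosh_norm_add_le[of s x] by blast
  have "(\<integral>\<^sup>+ \<xi>. ennreal (cosh (norm (s + (\<xi> - mean) *\<^sub>R x))) \<partial>N) \<le>
      (\<integral>\<^sup>+ \<xi>. ennreal (1 - t) * ennreal (cosh (norm s + (\<xi> - mean) * (- norm x))) +
        ennreal t * ennreal (cosh (norm s + (\<xi> - mean) * norm x)) \<partial>N)"
  proof (rule nn_integral_mono)
    fix \<xi>
    have "ennreal (cosh (norm (s + (\<xi> - mean) *\<^sub>R x))) \<le>
      ennreal ((1 - t) * cosh (norm s - (\<xi> - mean) * norm x) + t * cosh (norm s + (\<xi> - mean) * norm x))"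
      by (rule ennreal_leI[OF t(3)])
    also have "\<dots> = ennreal (1 - t) * ennreal (cosh (norm s + (\<xi> - mean) * (- norm x))) +
        ennreal t * ennreal (cosh (norm s + (\<xi> - mean) * norm x))"
      using t(1,2) by (simp add: ennreal_plus ennreal_mult)
    finally show "ennreal (cosh (norm (s + (\<xi> - mean) *\<^sub>R x))) \<le>
      ennreal (1 - t) * ennreal (cosh (norm s + (\<xi> - mean) * (- norm x))) +
        ennreal t * ennreal (cosh (norm s + (\<xi> - mean) * norm x))" .
  qed
  also have "\<dots> = ennreal (1 - t) * (\<integral>\<^sup>+ \<xi>. ennreal (cosh (norm s + (\<xi> - mean) * (- norm x))) \<partial>N) +
      ennreal t * (\<integral>\<^sup>+ \<xi>. ennreal (cosh (norm s + (\<xi> - mean) * norm x)) \<partial>N)"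
    unfolding cosh_field_def by (subst nn_integral_add) (auto simp: nn_integral_cmult)
  also have "\<dots> \<le> ennreal (1 - t) * ennreal (cosh (norm s) * exp ((- norm x)\<^sup>2 / 8)) +
      ennreal t * ennreal (cosh (norm s) * exp ((norm x)\<^sup>2 / 8))"
    by (intro add_mono mult_left_mono cosh_moment) auto
  also have "\<dots> = ennreal (cosh (norm s)) * ennreal (exp ((norm x)\<^sup>2 / 8))"
    using t(1,2) by (simp add: ennreal_mult[symmetric] ennreal_plus[symmetric] algebra_simps del: ennreal_plus)
  finally show ?thesis .
qed

text \<open>The new coordinate is integrated out with the partial sum frozen in the role of
  \<open>s\<close>, and the exponential factors multiply.\<close>

lemma cosh_norm_sum_moment:
  fixes v :: "'i \<Rightarrow> 'a::euclidean_space"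
  assumes "finite I"
  shows "(\<integral>\<^sup>+ a. ennreal (cosh (norm (\<Sum>i\<in>I. (a i - mean) *\<^sub>R v i))) \<partial>PiM I (\<lambda>_. N))
    \<le> ennreal (exp ((\<Sum>i\<in>I. (norm (v i))\<^sup>2) / 8))"
  using assms
proof (induction I)
  case empty
  interpret product_sigma_finite "\<lambda>_ :: 'i. N" by unfold_locales
  show ?case by (simp add: PiM_empty)
next
  case (insert j I)
  interpret product_sigma_finite "\<lambda>_ :: 'i. N" by unfold_locales
  let ?s = "\<lambda>a. \<Sum>i\<in>I. (a i - mean) *\<^sub>R v i"
  have "(\<integral>\<^sup>+ a. ennreal (cosh (norm (\<Sum>i\<in>insert j I. (a i - mean) *\<^sub>R v i))) \<partial>PiM (insert j I) (\<lambda>_. N)) =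
     (\<integral>\<^sup>+ a. (\<integral>\<^sup>+ \<xi>. ennreal (cosh (norm (\<Sum>i\<in>insert j I. ((a(j := \<xi>)) i - mean) *\<^sub>R v i))) \<partial>N) \<partial>PiM I (\<lambda>_. N))"
    unfolding cosh_field_def using insert.hyps by (intro product_nn_integral_insert) measurable
  also have "\<dots> = (\<integral>\<^sup>+ a. (\<integral>\<^sup>+ \<xi>. ennreal (cosh (norm (?s a + (\<xi> - mean) *\<^sub>R v j))) \<partial>N) \<partial>PiM I (\<lambda>_. N))"
  proof (intro nn_integral_cong)
    fix a \<xi>
    have "(\<Sum>i\<in>I. ((a(j := \<xi>)) i - mean) *\<^sub>R v i) = ?s a"
      using insert.hyps by (intro sum.cong) auto
    then show "ennreal (cosh (norm (\<Sum>i\<in>insert j I. ((a(j := \<xi>)) i - mean) *\<^sub>R v i))) =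
        ennreal (cosh (norm (?s a + (\<xi> - mean) *\<^sub>R v j)))"
      using insert.hyps by (simp add: add.commute)
  qed
  also have "\<dots> \<le> (\<integral>\<^sup>+ a. ennreal (cosh (norm (?s a))) * ennreal (exp ((norm (v j))\<^sup>2 / 8)) \<partial>PiM I (\<lambda>_. N))"
    by (intro nn_integral_mono cosh_norm_moment)
  also have "\<dots> = (\<integral>\<^sup>+ a. ennreal (cosh (norm (?s a))) \<partial>PiM I (\<lambda>_. N)) * ennreal (exp ((norm (v j))\<^sup>2 / 8))"
    unfolding cosh_field_def by (rule nn_integral_multc) measurable
  also have "\<dots> \<le> ennreal (exp ((\<Sum>i\<in>I. (norm (v i))\<^sup>2) / 8)) * ennreal (exp ((norm (v j))\<^sup>2 / 8))"
    by (intro mult_right_mono insert.IH) auto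
  also have "\<dots> = ennreal (exp ((\<Sum>i\<in>insert j I. (norm (v i))\<^sup>2) / 8))"
    using insert.hyps by (simp add: ennreal_mult[symmetric] exp_add[symmetric] add_divide_distrib add.commute)
  finally show ?case .
qed

text \<open>Markov's inequality applied to cosh of \<open>c\<close> times the norm. The factor 2
  comes from the bound of \<open>cosh (c * r)\<close> below by
  \<open>exp (c * r) / 2\<close>.\<close>

lemma hoeffding_vector:
  fixes v :: "'i \<Rightarrow> 'a::euclidean_space"
  assumes I: "finite I" and S: "(\<Sum>i\<in>I. (norm (v i))\<^sup>2) \<le> S" "0 < S" and r: "0 < r"
  shows "emeasure (PiM I (\<lambda>_. N)) {a \<in> space (PiM I (\<lambda>_. N)). r \<le> norm (\<Sum>i\<in>I. (a i - mean) *\<^sub>R v i)}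
    \<le> ennreal (2 * exp (- (2 * r\<^sup>2 / S)))"
proof -
  let ?P = "PiM I (\<lambda>_. N)" and ?s = "\<lambda>a. \<Sum>i\<in>I. (a i - mean) *\<^sub>R v i"
  \<comment> \<open>Minimises \<open>c\<^sup>2 * S / 8 - c * r\<close>; the minimum is
    \<open>- (2 * r\<^sup>2 / S)\<close>.\<close>
  define c where "c = 4 * r / S"
  have c: "0 < c" using S r by (simp add: c_def)
  let ?A = "{a \<in> space ?P. r \<le> norm (?s a)}"
  have A[measurable]: "?A \<in> sets ?P" by measurable
  have "ennreal (cosh (c * r)) * emeasure ?P ?A = (\<integral>\<^sup>+ a. ennreal (cosh (c * r)) * indicator ?A a \<partial>?P)"
    by (simp add: nn_integral_cmult_indicator)
  also have "\<dots> \<le> (\<integral>\<^sup>+ a. ennreal (cosh (norm (\<Sum>i\<in>I. (a i - mean) *\<^sub>R (c *\<^sub>R v i)))) \<partial>?P)"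
  proof (rule nn_integral_mono)
    fix a
    have eq: "(\<Sum>i\<in>I. (a i - mean) *\<^sub>R (c *\<^sub>R v i)) = c *\<^sub>R ?s a"
      by (simp add: scaleR_sum_right mult.commute)
    show "ennreal (cosh (c * r)) * indicator ?A a \<le>
        ennreal (cosh (norm (\<Sum>i\<in>I. (a i - mean) *\<^sub>R (c *\<^sub>R v i))))"
      unfolding eq using c r
      by (auto simp: indicator_def cosh_real_nonneg_le_iff intro!: ennreal_leI)
  qed
  also have "\<dots> \<le> ennreal (exp ((\<Sum>i\<in>I. (norm (c *\<^sub>R v i))\<^sup>2) / 8))"
    by (rule cosh_norm_sum_moment[OF I])
  also have "\<dots> \<le> ennreal (exp (c\<^sup>2 * S / 8))"
    using S by (intro ennreal_leI) (simp add: power_mult_distrib mult_left_mono flip: sum_distrib_left)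
  finally have 1: "ennreal (cosh (c * r)) * emeasure ?P ?A \<le> ennreal (exp (c\<^sup>2 * S / 8))" .
  have "emeasure ?P ?A = ennreal (2 * exp (- (c * r))) * (ennreal (exp (c * r) / 2) * emeasure ?P ?A)"
    by (simp add: mult.assoc[symmetric] ennreal_mult[symmetric] exp_minus)
  also have "\<dots> \<le> ennreal (2 * exp (- (c * r))) * (ennreal (cosh (c * r)) * emeasure ?P ?A)"
    by (intro mult_left_mono mult_right_mono ennreal_leI) (auto simp: cosh_field_def)
  also have "\<dots> \<le> ennreal (2 * exp (- (c * r))) * ennreal (exp (c\<^sup>2 * S / 8))"
    by (intro mult_left_mono 1) auto
  also have "\<dots> = ennreal (2 * exp (c\<^sup>2 * S / 8 - c * r))"
    by (simp add: ennreal_mult[symmetric] exp_add[symmetric])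
  also have "c\<^sup>2 * S / 8 - c * r = - (2 * r\<^sup>2 / S)"
    using S by (simp add: c_def power2_eq_square field_simps)
  finally show ?thesis .
qed

end

subsection \<open>Norm and direction of a projected uniform direction\<close>

lemma emeasure_lborel_open_pos:
  assumes "open S" "x \<in> S"
  shows "0 < emeasure lborel (S :: 'a::euclidean_space set)"
proof -
  obtain e where e: "0 < e" "ball x e \<subseteq> S"
    using assms by (auto simp: open_contains_ball)
  have "0 < emeasure lborel (ball x e)"
    using content_ball_pos[OF e(1), of x] by (simp add: measure_def enn2real_positive_iff)
  also have "\<dots> \<le> emeasure lborel S"
    using assms e by (intro emeasure_mono) auto
  finally show ?thesis .
qed

lemma lborel_distr_uminus': "distr lborel borel uminus = (lborel :: 'a::euclidean_space measure)"
  using lborel_affine[of "- 1" "0 :: 'a"] by (simp add: density_1)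

text \<open>Uniqueness of Haar measure on \<open>\<real>\<^sup>n\<close>, by the usual shear of the double integral.\<close>

lemma translation_invariant_proportional:
  fixes \<mu> :: "'a::euclidean_space measure"
  assumes "sigma_finite_measure \<mu>" and sets [measurable_cong]: "sets \<mu> = sets borel"
    and inv: "\<And>x. distr \<mu> borel (\<lambda>y. x + y) = \<mu>"
    and [measurable]: "A \<in> sets borel" "B \<in> sets borel"
  shows "emeasure \<mu> A * emeasure lborel B = emeasure \<mu> B * emeasure lborel A"
proof -
  interpret \<mu>: sigma_finite_measure \<mu> by fact
  interpret pair_sigma_finite \<mu> "lborel :: 'a measure" ..
  have \<mu>_shift: "(\<integral>\<^sup>+ y. f (x + y) \<partial>\<mu>) = (\<integral>\<^sup>+ y. f y \<partial>\<mu>)" if [measurable]: "f \<in> borel_measurable borel" for f :: "'a \<Rightarrow> ennreal" and x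
    by (subst (2) inv[of x, symmetric]) (simp add: nn_integral_distr)
  have l_shift: "(\<integral>\<^sup>+ y. f (x + y) \<partial>lborel) = (\<integral>\<^sup>+ y. f y \<partial>lborel)" if [measurable]: "f \<in> borel_measurable borel" for f :: "'a \<Rightarrow> ennreal" and x
    by (subst (2) lborel_distr_plus[of x, symmetric]) (simp add: nn_integral_distr)
  have l_neg: "(\<integral>\<^sup>+ y. f (- y) \<partial>lborel) = (\<integral>\<^sup>+ y. f y \<partial>lborel)" if [measurable]: "f \<in> borel_measurable borel" for f :: "'a \<Rightarrow> ennreal"
    by (subst (2) lborel_distr_uminus'[symmetric]) (simp add: nn_integral_distr)
  let ?a = "indicator A :: 'a \<Rightarrow> ennreal" and ?b = "indicator B :: 'a \<Rightarrow> ennreal"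
  have "emeasure \<mu> A * emeasure lborel B = (\<integral>\<^sup>+ x. ?a x * (\<integral>\<^sup>+ y. ?b y \<partial>lborel) \<partial>\<mu>)"
    by (subst nn_integral_multc) (auto simp: sets)
  also have "\<dots> = (\<integral>\<^sup>+ x. ?a x * (\<integral>\<^sup>+ y. ?b (x + y) \<partial>lborel) \<partial>\<mu>)"
    by (subst l_shift) auto
  also have "\<dots> = (\<integral>\<^sup>+ x. (\<integral>\<^sup>+ y. ?a x * ?b (x + y) \<partial>lborel) \<partial>\<mu>)"
    by (subst nn_integral_cmult) auto
  also have "\<dots> = (\<integral>\<^sup>+ y. (\<integral>\<^sup>+ x. ?a x * ?b (x + y) \<partial>\<mu>) \<partial>lborel)"
    by (rule Fubini'[symmetric]) measurable
  also have "\<dots> = (\<integral>\<^sup>+ y. (\<integral>\<^sup>+ x. ?a (x - y) * ?b x \<partial>\<mu>) \<partial>lborel)"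
  proof (rule nn_integral_cong)
    fix y
    show "(\<integral>\<^sup>+ x. ?a x * ?b (x + y) \<partial>\<mu>) = (\<integral>\<^sup>+ x. ?a (x - y) * ?b x \<partial>\<mu>)"
      using \<mu>_shift[of "\<lambda>x. ?a (x - y) * ?b x" y] by (simp add: add.commute)
  qed
  also have "\<dots> = (\<integral>\<^sup>+ x. (\<integral>\<^sup>+ y. ?a (x - y) * ?b x \<partial>lborel) \<partial>\<mu>)"
    by (rule Fubini') measurable
  also have "\<dots> = (\<integral>\<^sup>+ x. (\<integral>\<^sup>+ y. ?a y \<partial>lborel) * ?b x \<partial>\<mu>)"
  proof (rule nn_integral_cong)
    fix x
    have "(\<integral>\<^sup>+ y. ?a (x - y) \<partial>lborel) = (\<integral>\<^sup>+ y. ?a (x + y) \<partial>lborel)"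
      using l_neg[of "\<lambda>y. ?a (x + y)"] by simp
    then show "(\<integral>\<^sup>+ y. ?a (x - y) * ?b x \<partial>lborel) = (\<integral>\<^sup>+ y. ?a y \<partial>lborel) * ?b x"
      using l_shift[of ?a x] by (simp add: nn_integral_multc)
  qed
  also have "\<dots> = emeasure \<mu> B * emeasure lborel A"
    by (subst nn_integral_cmult) (auto simp: mult.commute sets)
  finally show ?thesis .
qed

text \<open>As \<open>x + T y = T (S x + y)\<close>, the image of Lebesgue measure under
  \<open>T\<close> is translation invariant and therefore proportional to it. The unit ball fixes
  the factor, whose value later cancels: positivity and finiteness are what the cancellation
  requires.\<close>

lemma emeasure_lborel_linear_vimage:
  fixes T S :: "'a::euclidean_space \<Rightarrow> 'a"
  assumes T: "linear T" and S: "linear S" and TS: "\<And>x. T (S x) = x" and ST: "\<And>x. S (T x) = x"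
  obtains c where "0 < c" "c < \<top>"
    "\<And>A. A \<in> sets borel \<Longrightarrow> emeasure lborel (T -` A) = c * emeasure lborel A"
proof -
  have T_cont: "continuous_on UNIV T" using T by (simp add: linear_continuous_on linear_linear)
  then have T_meas[measurable]: "T \<in> borel_measurable borel" by (rule borel_measurable_continuous_onI)
  define \<mu> where "\<mu> = distr lborel borel T"
  have \<mu>: "emeasure \<mu> A = emeasure lborel (T -` A)" if "A \<in> sets borel" for A
    unfolding \<mu>_def using that by (subst emeasure_distr) auto
  have vimage: "T -` A = S ` A" for A using TS ST by (auto simp: image_iff) metis
  have fin: "emeasure \<mu> (ball 0 r) < \<top>" for r
  proof -
    have "bounded (S ` ball 0 r)" using S by (simp add: bounded_linear_image linear_linear)
    from emeasure_bounded_finite[OF this] show ?thesis by (simp add: \<mu> vimage)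
  qed
  have "sigma_finite_measure \<mu>"
  proof
    let ?C = "range (\<lambda>n. ball (0 :: 'a) (real n))"
    have "\<Union> ?C = UNIV"
    proof (safe; simp)
      fix x :: 'a show "\<exists>n. norm x < real n" by (rule reals_Archimedean2)
    qed
    moreover have "\<forall>a\<in>?C. emeasure \<mu> a \<noteq> \<infinity>" using fin by (auto simp: less_top)
    ultimately show "\<exists>C. countable C \<and> C \<subseteq> sets \<mu> \<and> \<Union> C = space \<mu> \<and> (\<forall>a\<in>C. emeasure \<mu> a \<noteq> \<infinity>)"
      by (intro exI[of _ ?C]) (auto simp: \<mu>_def)
  qed
  moreover have "sets \<mu> = sets borel" by (simp add: \<mu>_def)
  moreover have "distr \<mu> borel (\<lambda>y. x + y) = \<mu>" for x
  proof -
    have "distr \<mu> borel (\<lambda>y. x + y) = distr lborel borel (\<lambda>y. x + T y)"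
      unfolding \<mu>_def by (subst distr_distr) (auto simp: comp_def)
    also have "\<dots> = distr lborel borel (\<lambda>y. T (S x + y))"
      by (simp add: linear_add[OF T] TS)
    also have "\<dots> = distr (distr lborel borel (\<lambda>y. S x + y)) borel T"
      by (subst distr_distr) (auto simp: comp_def)
    finally show ?thesis by (simp add: lborel_distr_plus \<mu>_def)
  qed
  ultimately have proportional: "emeasure \<mu> A * emeasure lborel B = emeasure \<mu> B * emeasure lborel A"
    if "A \<in> sets borel" "B \<in> sets borel" for A B
    using that by (rule translation_invariant_proportional)
  let ?B = "ball 0 1 :: 'a set"
  have B: "0 < emeasure lborel ?B" "emeasure lborel ?B < \<top>"
    using emeasure_lborel_ball_finite[of "0 :: 'a" 1] emeasure_lborel_open_pos[of ?B 0] by auto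
  have "0 < emeasure \<mu> ?B"
  proof -
    have "open (T -` ?B)" using T_cont by (intro open_vimage) auto
    moreover have "0 \<in> T -` ?B" using linear_0[OF T] by simp
    ultimately show ?thesis by (subst \<mu>) (auto intro!: emeasure_lborel_open_pos)
  qed
  show thesis
  proof (rule that)
    show "0 < emeasure \<mu> ?B / emeasure lborel ?B"
      using \<open>0 < emeasure \<mu> ?B\<close> B by (simp add: ennreal_zero_less_divide)
    show "emeasure \<mu> ?B / emeasure lborel ?B < \<top>"
      using fin[of 1] B by (auto simp: less_top[symmetric] ennreal_divide_eq_top_iff)
    show "emeasure lborel (T -` A) = emeasure \<mu> ?B / emeasure lborel ?B * emeasure lborel A"
      if "A \<in> sets borel" for A
    proof -
      have "emeasure lborel (T -` A) = emeasure \<mu> A * emeasure lborel ?B / emeasure lborel ?B"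
        using B that by (simp add: \<mu> ennreal_mult_divide_eq)
      also have "\<dots> = emeasure \<mu> ?B * emeasure lborel A / emeasure lborel ?B"
        using proportional[OF that, of ?B] by simp
      finally show ?thesis by (simp add: ennreal_times_divide mult.commute)
    qed
  qed
qed

declare transpose_matrix_vector [simp del] \<comment> \<open>rewrites \<open>transpose U *v x\<close> to \<open>x v* U\<close>\<close>

section \<open>The uniform measure on the sphere\<close>

lemma emeasure_uniform_sphere:
  assumes "A \<in> sets borel"
  shows "emeasure uniform_sphere (A :: 'a::euclidean_space set) =
    emeasure lborel {x. norm x < 1 \<and> x /\<^sub>R norm x \<in> A} / emeasure lborel (ball (0 :: 'a) 1)"
proof -
  have fm: "(\<lambda>x :: 'a. x /\<^sub>R norm x) \<in> borel_measurable borel" by measurable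
  note [measurable] = fm assms
  have "emeasure uniform_sphere A =
      emeasure (uniform_measure lborel (ball 0 1)) ((\<lambda>x. x /\<^sub>R norm x) -` A)"
    unfolding uniform_sphere_def by (subst emeasure_distr) auto
  also have "\<dots> = emeasure lborel (ball 0 1 \<inter> (\<lambda>x. x /\<^sub>R norm x) -` A) / emeasure lborel (ball (0 :: 'a) 1)"
    by (rule emeasure_uniform_measure) (use measurable_sets[OF fm assms] in auto)
  also have "ball 0 1 \<inter> (\<lambda>x. x /\<^sub>R norm x) -` A = {x. norm x < 1 \<and> x /\<^sub>R norm x \<in> A}" by auto
  finally show ?thesis .
qed

lemma prob_space_uniform_sphere: "prob_space (uniform_sphere :: 'a::euclidean_space measure)"
  unfolding uniform_sphere_def
proof (rule prob_space.prob_space_distr)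
  show "prob_space (uniform_measure lborel (ball (0 :: 'a) 1))"
    using emeasure_lborel_open_pos[of "ball (0 :: 'a) 1" 0] emeasure_lborel_ball_finite[of "0 :: 'a" 1]
    by (intro prob_space_uniform_measure) auto
qed measurable

lemma sets_uniform_sphere [simp, measurable_cong]: "sets uniform_sphere = sets borel"
  and space_uniform_sphere [simp]: "space uniform_sphere = UNIV"
  by (auto simp: uniform_sphere_def)

text \<open>An inequality also covers the centre of the ball, which normalisation maps to 0.\<close>

lemma AE_uniform_sphere_norm: "AE \<theta> in uniform_sphere. norm (\<theta> :: 'a::euclidean_space) \<le> 1"
proof -
  have "norm (x /\<^sub>R norm x) \<le> 1" for x :: "'a"
    by (cases "x = 0") auto
  then show ?thesis
    unfolding uniform_sphere_def by (subst AE_distr_iff) (auto simp del: norm_scaleR)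
qed

section \<open>Semi-orthogonal matrices and the independence of norm and direction\<close>

locale semi_orthogonal =
  fixes U :: "real^'k^'d"
  assumes semi_orthogonal: "transpose U ** U = mat 1"
begin

abbreviation "Ut x \<equiv> transpose U *v x"

lemma inner_U: "(U *v a) \<bullet> b = a \<bullet> Ut b"
  by (metis dot_lmul_matrix transpose_matrix_vector transpose_transpose)

lemma Ut_U [simp]: "Ut (U *v a) = a"
  by (simp add: matrix_vector_mul_assoc semi_orthogonal)

lemma norm_U [simp]: "norm (U *v a) = norm a"
  by (simp add: norm_eq_sqrt_inner inner_U)

lemma column_span_eq_range: "column_span U = range ((*v) U)"
proof
  have "subspace (range ((*v) U))"
    by (rule linear_subspace_image[OF matrix_vector_mul_linear subspace_UNIV])
  moreover have "columns U \<subseteq> range ((*v) U)"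
    using columns_image_basis[of U] by auto
  ultimately show "column_span U \<subseteq> range ((*v) U)"
    unfolding column_span_def by (rule span_minimal[rotated])
  show "range ((*v) U) \<subseteq> column_span U"
    unfolding column_span_def using matrix_vector_mult_in_columnspace[of U] by auto
qed

lemma subspace_column_span: "subspace (column_span U)"
  by (simp add: column_span_def)

lemma U_in_column_span: "U *v a \<in> column_span U"
  by (simp add: column_span_eq_range)

lemma U_Ut: "x \<in> column_span U \<Longrightarrow> U *v Ut x = x"
  by (auto simp: column_span_eq_range)

lemma norm_decomp: "(norm x)\<^sup>2 = (norm (Ut x))\<^sup>2 + (norm (x - U *v Ut x))\<^sup>2"
proof -
  have "(norm (x - U *v Ut x))\<^sup>2 = x \<bullet> x - 2 * ((U *v Ut x) \<bullet> x) + (U *v Ut x) \<bullet> (U *v Ut x)"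
    unfolding power2_norm_eq_inner by (simp add: inner_diff_left inner_diff_right inner_commute)
  also have "\<dots> = x \<bullet> x - Ut x \<bullet> Ut x" by (simp add: inner_U)
  finally show ?thesis by (simp add: power2_norm_eq_inner)
qed

lemma norm_Ut_le: "norm (Ut x) \<le> norm x"
proof (rule power2_le_imp_le)
  show "(norm (Ut x))\<^sup>2 \<le> (norm x)\<^sup>2"
    using norm_decomp[of x] zero_le_power2[of "norm (x - U *v Ut x)"] by linarith
qed simp

lemma reduced_direction_scale: "0 < c \<Longrightarrow> reduced_direction U (c *\<^sub>R x) = reduced_direction U x"
  by (simp add: reduced_direction_def matrix_vector_mult_scaleR)

lemma norm_reduced_direction: "norm (reduced_direction U x) = (if Ut x = 0 then 0 else 1)"
  by (simp add: reduced_direction_def)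

lemma Ut_eq_reduced_direction: "Ut x = norm (Ut x) *\<^sub>R reduced_direction U x"
  by (cases "Ut x = 0") (simp_all add: reduced_direction_def)

lemma measurable_Ut [measurable]: "(\<lambda>x. Ut x) \<in> borel_measurable borel"
  by (intro borel_measurable_continuous_onI continuous_intros matrix_vector_mult_linear_continuous_on)

lemma measurable_U [measurable]: "(\<lambda>x. U *v x) \<in> borel_measurable borel"
  by (intro borel_measurable_continuous_onI matrix_vector_mult_linear_continuous_on)

lemma measurable_reduced_direction [measurable]: "reduced_direction U \<in> borel_measurable borel"
  unfolding reduced_direction_def[abs_def] by measurable

text \<open>By Pythagoras, the norm of \<open>x\<close> and the norm of the projection of the
  normalised \<open>x\<close> are both functions of this pair. Factorising the direction against the
  pair is therefore enough.\<close>

definition "radii x = (norm (Ut x), norm (x - U *v Ut x))"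

lemma measurable_radii [measurable]: "radii \<in> borel_measurable borel"
  unfolding radii_def[abs_def] borel_prod[symmetric] by measurable

lemma measurable_fst_radii [measurable]: "(\<lambda>x. fst (radii x)) \<in> borel_measurable borel"
  and measurable_snd_radii [measurable]: "(\<lambda>x. snd (radii x)) \<in> borel_measurable borel"
  unfolding radii_def by simp_all

text \<open>Scaling the column span and its orthogonal complement separately preserves the reduced
  direction and scales Lebesgue measure by a constant.\<close>

lemma emeasure_box_scale:
  assumes ab: "0 < a" "0 < b"
  obtains c where "0 < c" "c < \<top>"
    "\<And>H. H \<in> sets borel \<Longrightarrow> emeasure lborel {x. reduced_direction U x \<in> H \<and> fst (radii x) < 1 \<and> snd (radii x) < 1}
      = c * emeasure lborel {x. reduced_direction U x \<in> H \<and> fst (radii x) < a \<and> snd (radii x) < b}"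
proof -
  define T where "T s t x = s *\<^sub>R (U *v Ut x) + t *\<^sub>R (x - U *v Ut x)" for s t x
  have lin: "linear (T s t)" for s t
    unfolding T_def
    by (rule linearI) (simp_all add: matrix_vector_right_distrib matrix_vector_mult_scaleR algebra_simps)
  have Ut_T: "Ut (T s t x) = s *\<^sub>R Ut x" for s t x
    by (simp add: T_def matrix_vector_right_distrib matrix_vector_mult_scaleR matrix_vector_mult_diff_distrib)
  have comp: "T s t x - U *v Ut (T s t x) = t *\<^sub>R (x - U *v Ut x)" for s t x
    by (simp only: Ut_T) (simp add: T_def matrix_vector_mult_scaleR)
  have inv: "T s t (T (1 / s) (1 / t) x) = x" if "s \<noteq> 0" "t \<noteq> 0" for s t x
  proof -
    have "T s t (T (1 / s) (1 / t) x) = s *\<^sub>R (U *v ((1 / s) *\<^sub>R Ut x)) + t *\<^sub>R ((1 / t) *\<^sub>R (x - U *v Ut x))"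
      by (subst T_def) (simp only: comp, simp only: Ut_T)
    also have "\<dots> = x" using that by (simp add: matrix_vector_mult_scaleR)
    finally show ?thesis .
  qed
  have inv1: "T a b (T (1 / a) (1 / b) x) = x" for x
    using inv[of a b x] ab by simp
  have inv2: "T (1 / a) (1 / b) (T a b x) = x" for x
    using inv[of "1 / a" "1 / b" x] ab by simp
  obtain c where c: "0 < c" "c < \<top>"
    "\<And>A. A \<in> sets borel \<Longrightarrow> emeasure lborel (T a b -` A) = c * emeasure lborel A"
    by (rule emeasure_lborel_linear_vimage[OF lin[of a b] lin[of "1 / a" "1 / b"] inv1 inv2]) blast
  show thesis
  proof (rule that[OF c(1,2)])
    fix H :: "(real^'k) set" assume [measurable]: "H \<in> sets borel"
    let ?A = "\<lambda>a b. {x. reduced_direction U x \<in> H \<and> fst (radii x) < a \<and> snd (radii x) < b}"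
    have "x \<in> T a b -` ?A a b \<longleftrightarrow> x \<in> ?A 1 1" for x
    proof -
      have "reduced_direction U (T a b x) = reduced_direction U x"
        using ab by (simp add: reduced_direction_def Ut_T)
      moreover have "radii (T a b x) = (a * fst (radii x), b * snd (radii x))"
        unfolding radii_def comp unfolding Ut_T using ab by simp
      ultimately show ?thesis using ab by simp
    qed
    then have eq: "T a b -` ?A a b = ?A 1 1" by blast
    have "?A a b \<in> sets borel" by measurable
    from c(3)[OF this] show "emeasure lborel (?A 1 1) = c * emeasure lborel (?A a b)"
      unfolding eq .
  qed
qed

lemma emeasure_radii_box_pos:
  assumes "0 < a" "0 < b"
  shows "0 < emeasure lborel {x. fst (radii x) < a \<and> snd (radii x) < b}" (is "0 < emeasure lborel ?A")
proof -
  have "open {x. norm (Ut x) < a \<and> norm (x - U *v Ut x) < b}"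
    by (intro open_Collect_conj open_Collect_less continuous_intros matrix_vector_mult_linear_continuous_on
        continuous_on_compose2[OF matrix_vector_mult_linear_continuous_on]) auto
  then have "open ?A" by (simp add: radii_def)
  then show ?thesis by (rule emeasure_lborel_open_pos[of _ 0]) (use assms in \<open>simp add: radii_def\<close>)
qed

lemma emeasure_radii_box_finite: "emeasure lborel {x. fst (radii x) < a \<and> snd (radii x) < b} < \<top>"
proof -
  have "norm x \<le> \<bar>a\<bar> + \<bar>b\<bar>" if "norm (Ut x) < a" "norm (x - U *v Ut x) < b" for x
  proof -
    have "norm x \<le> norm (U *v Ut x) + norm (x - U *v Ut x)"
      using norm_triangle_ineq[of "U *v Ut x" "x - U *v Ut x"] by simp
    then show ?thesis using that by simp
  qed
  then have "bounded {x. fst (radii x) < a \<and> snd (radii x) < b}"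
    by (auto simp: bounded_iff radii_def)
  from emeasure_bounded_finite[OF this] show ?thesis by simp
qed

text \<open>Scaling shows that the directions in \<open>H\<close> take up the same share
  \<open>h\<close> of every box of radii. Quadrants form an intersection-stable generator of the
  Borel sets of the plane, so the share is \<open>h\<close> for every \<open>G\<close>.\<close>

lemma emeasure_direction_radii:
  assumes H [measurable]: "H \<in> sets borel"
  obtains h where "\<And>G. G \<in> sets borel \<Longrightarrow>
    emeasure lborel {x. reduced_direction U x \<in> H \<and> radii x \<in> G} = h * emeasure lborel {x. radii x \<in> G}"
proof -
  let ?A = "\<lambda>H a b. {x. reduced_direction U x \<in> H \<and> fst (radii x) < a \<and> snd (radii x) < b}"
  have A[measurable]: "?A H a b \<in> sets borel" if [measurable]: "H \<in> sets borel" for H a b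
    by measurable
  define e where "e = emeasure lborel (?A UNIV 1 1)"
  have e: "0 < e" "e < \<top>"
    using emeasure_radii_box_pos[of 1 1] emeasure_radii_box_finite[of 1 1] by (simp_all add: e_def)
  define h where "h = emeasure lborel (?A H 1 1) / e"
  have "emeasure lborel (?A H 1 1) \<le> e"
    unfolding e_def by (intro emeasure_mono) auto
  with e have h_fin: "h < \<top>"
    by (auto simp: h_def less_top[symmetric] ennreal_divide_eq_top_iff top_unique)
  have he: "h * e = emeasure lborel (?A H 1 1)"
    using e by (simp add: h_def ennreal_divide_times)
  \<comment> \<open>The scaling factor \<open>c\<close> belongs to \<open>a\<close> and
    \<open>b\<close> but serves both \<open>H\<close> and \<open>UNIV\<close>, so it cancels. If a
    side is not positive both boxes are empty, because radii are nonnegative.\<close>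
  have box: "emeasure lborel (?A H a b) = h * emeasure lborel (?A UNIV a b)" for a b
  proof (cases "0 < a \<and> 0 < b")
    case True
    then have "0 < a" "0 < b" by auto
    then obtain c where c: "0 < c" "c < \<top>"
      "\<And>H. H \<in> sets borel \<Longrightarrow> emeasure lborel (?A H 1 1) = c * emeasure lborel (?A H a b)"
      by (rule emeasure_box_scale) blast
    have "h * (c * emeasure lborel (?A UNIV a b)) = emeasure lborel (?A H 1 1)"
      using c(3)[of UNIV] he by (simp add: e_def)
    then have "c * (h * emeasure lborel (?A UNIV a b)) = c * emeasure lborel (?A H a b)"
      using c(3)[OF H] by (simp add: mult_ac)
    then show ?thesis using c(1,2) by (auto simp: ennreal_mult_cancel_left)
  next
    case False
    have "\<not> (fst (radii x) < a \<and> snd (radii x) < b)" for x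
    proof -
      have "0 \<le> fst (radii x)" "0 \<le> snd (radii x)" by (simp_all add: radii_def)
      then show ?thesis using False by linarith
    qed
    then have "?A H a b = {}" "?A UNIV a b = {}" by blast+
    then show ?thesis by (simp only: emeasure_empty mult_zero_right)
  qed
  define M1 where "M1 = distr (density lborel (indicator (reduced_direction U -` H))) borel radii"
  define M2 where "M2 = density (distr lborel borel radii) (\<lambda>_. h)"
  have M1: "emeasure M1 G = emeasure lborel {x. reduced_direction U x \<in> H \<and> radii x \<in> G}"
    if [measurable]: "G \<in> sets borel" for G
  proof -
    have [measurable]: "reduced_direction U -` H \<in> sets borel"
      using measurable_sets[OF measurable_reduced_direction H] by simp
    have "emeasure M1 G = (\<integral>\<^sup>+ x. indicator (reduced_direction U -` H) x * indicator (radii -` G) x \<partial>lborel)"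
      unfolding M1_def
      by (subst emeasure_distr, simp, simp, subst emeasure_density)
        (use measurable_sets[OF measurable_radii that] in auto)
    also have "\<dots> = (\<integral>\<^sup>+ x. indicator {x. reduced_direction U x \<in> H \<and> radii x \<in> G} x \<partial>lborel)"
      by (intro nn_integral_cong) (auto simp: indicator_def)
    also have "\<dots> = emeasure lborel {x. reduced_direction U x \<in> H \<and> radii x \<in> G}"
      by (rule nn_integral_indicator) measurable
    finally show ?thesis .
  qed
  have M2: "emeasure M2 G = h * emeasure lborel {x. radii x \<in> G}" if [measurable]: "G \<in> sets borel" for G
  proof -
    have "emeasure M2 G = (\<integral>\<^sup>+ z. h * indicator G z \<partial>distr lborel borel radii)"
      unfolding M2_def by (rule emeasure_density) auto
    also have "\<dots> = h * emeasure (distr lborel borel radii) G"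
      by (subst nn_integral_cmult) auto
    also have "emeasure (distr lborel borel radii) G = emeasure lborel {x. radii x \<in> G}"
      by (subst emeasure_distr) (auto simp: vimage_def)
    finally show ?thesis .
  qed
  \<comment> \<open>\<open>eucl_less\<close> is the componentwise strict order, for which the lower
    quadrants are known to generate the Borel sets.\<close>
  have less: "{z. eucl_less z ab} = {z. fst z < fst ab \<and> snd z < snd ab}" for ab :: "real \<times> real"
    by (auto simp: eucl_less_def Basis_prod_def inner_prod_def)
  have "M1 = M2"
  proof (rule measure_eqI_generator_eq[where \<Omega> = UNIV and E = "range (\<lambda>ab :: real \<times> real. {z. eucl_less z ab})"
        and A = "\<lambda>i. {z. eucl_less z (real i, real i)}"])
    show "Int_stable (range (\<lambda>ab :: real \<times> real. {z. eucl_less z ab}))"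
    proof (rule Int_stableI, safe)
      fix ab cd :: "real \<times> real"
      have "{z. eucl_less z ab} \<inter> {z. eucl_less z cd} = {z. eucl_less z (min (fst ab) (fst cd), min (snd ab) (snd cd))}"
        by (auto simp: less)
      then show "{z. eucl_less z ab} \<inter> {z. eucl_less z cd} \<in> range (\<lambda>ab. {z. eucl_less z ab})" by blast
    qed
    have b: "{z. eucl_less z ab} \<in> sets borel" for ab :: "real \<times> real"
      by (subst borel_eq_lessThan) auto
    fix X assume "X \<in> range (\<lambda>ab :: real \<times> real. {z. eucl_less z ab})"
    then obtain ab where X: "X = {z. eucl_less z ab}" by blast
    show "emeasure M1 X = emeasure M2 X"
      unfolding X M1[OF b] M2[OF b] using box[of "fst ab" "snd ab"] by (simp add: less)
  next
    have b: "{z. eucl_less z ab} \<in> sets borel" for ab :: "real \<times> real"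
      by (subst borel_eq_lessThan) auto
    fix i
    show "emeasure M1 {z. eucl_less z (real i, real i)} \<noteq> \<infinity>"
    proof -
      have "emeasure M1 {z. eucl_less z (real i, real i)} \<le> emeasure lborel {x. fst (radii x) < real i \<and> snd (radii x) < real i}"
        unfolding M1[OF b] by (intro emeasure_mono) (auto simp: less)
      also have "\<dots> < \<top>" by (rule emeasure_radii_box_finite)
      finally show ?thesis by simp
    qed
  next
    show "(\<Union>i. {z. eucl_less z (real i, real i)}) = UNIV"
    proof safe
      fix z :: "real \<times> real"
      obtain i where "max (fst z) (snd z) < real i" using reals_Archimedean2 by blast
      then show "z \<in> (\<Union>i. {z. eucl_less z (real i, real i)})" by (auto simp: less)
    qed simp
  qed (auto simp: M1_def M2_def borel_eq_lessThan[where 'a = "real \<times> real"])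
  then show thesis using M1 M2 by (intro that[of h]) simp
qed

text \<open>In the cone measure, an event about the projected norm becomes an event about the radii
  of a point of the ball, while the reduced direction is unchanged by normalising. The product
  formula for Lebesgue measure then carries over.\<close>

lemma uniform_sphere_indep:
  assumes [measurable]: "C \<in> sets borel" "H \<in> sets borel"
  shows "emeasure uniform_sphere {\<theta>. norm (Ut \<theta>) \<in> C \<and> reduced_direction U \<theta> \<in> H} =
    emeasure uniform_sphere {\<theta>. norm (Ut \<theta>) \<in> C} * emeasure uniform_sphere {\<theta>. reduced_direction U \<theta> \<in> H}"
proof -
  let ?b = "emeasure lborel (ball (0 :: real^'d) 1)"
  obtain h where h: "\<And>G. G \<in> sets borel \<Longrightarrow>
    emeasure lborel {x. reduced_direction U x \<in> H \<and> radii x \<in> G} = h * emeasure lborel {x. radii x \<in> G}"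
    by (rule emeasure_direction_radii[OF assms(2)]) blast
  \<comment> \<open>The first condition is the unit ball; the quotient is the norm of the projection
    of the normalised point.\<close>
  define G where "G C = {z :: real \<times> real. (fst z)\<^sup>2 + (snd z)\<^sup>2 < 1 \<and> fst z / sqrt ((fst z)\<^sup>2 + (snd z)\<^sup>2) \<in> C}" for C
  have G[measurable]: "G C \<in> sets borel" if [measurable]: "C \<in> sets borel" for C
  proof -
    have "{z \<in> space (borel \<Otimes>\<^sub>M borel). (fst z)\<^sup>2 + (snd z)\<^sup>2 < 1 \<and>
        fst z / sqrt ((fst z)\<^sup>2 + (snd z)\<^sup>2) \<in> C} \<in> sets (borel \<Otimes>\<^sub>M borel)"
      by measurable
    then show ?thesis unfolding borel_prod G_def by simp
  qed
  have norm: "norm x = sqrt ((norm (Ut x))\<^sup>2 + (norm (x - U *v Ut x))\<^sup>2)" for x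
    using norm_decomp[of x] by (metis norm_ge_zero real_sqrt_unique)
  have norm1: "norm x < 1 \<longleftrightarrow> (norm (Ut x))\<^sup>2 + (norm (x - U *v Ut x))\<^sup>2 < 1" for x
    by (subst norm) simp
  have G_iff: "radii x \<in> G C \<longleftrightarrow> norm x < 1 \<and> norm (Ut (x /\<^sub>R norm x)) \<in> C" for x C
  proof -
    have "norm (Ut (x /\<^sub>R norm x)) = norm (Ut x) / norm x"
      by (simp add: matrix_vector_mult_scaleR divide_inverse_commute)
    then show ?thesis unfolding norm1 by (simp add: G_def radii_def norm[symmetric])
  qed
  have dir: "reduced_direction U (x /\<^sub>R norm x) = reduced_direction U x" for x
    by (cases "x = 0") (simp_all add: reduced_direction_scale)
  have 1: "emeasure uniform_sphere {\<theta>. norm (Ut \<theta>) \<in> C \<and> reduced_direction U \<theta> \<in> H} =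
      h * emeasure lborel {x. radii x \<in> G C} / ?b" if [measurable]: "C \<in> sets borel" for C
  proof -
    have "{x. norm x < 1 \<and> x /\<^sub>R norm x \<in> {\<theta>. norm (Ut \<theta>) \<in> C \<and> reduced_direction U \<theta> \<in> H}} =
        {x. reduced_direction U x \<in> H \<and> radii x \<in> G C}"
      by (auto simp: dir G_iff)
    moreover have "{\<theta>. norm (Ut \<theta>) \<in> C \<and> reduced_direction U \<theta> \<in> H} \<in> sets borel" by measurable
    ultimately show ?thesis using h[OF G[OF that]] by (simp only: emeasure_uniform_sphere)
  qed
  have 2: "emeasure uniform_sphere {\<theta>. norm (Ut \<theta>) \<in> C} = emeasure lborel {x. radii x \<in> G C} / ?b"
    if [measurable]: "C \<in> sets borel" for C
    by (subst emeasure_uniform_sphere, measurable) (simp add: G_iff)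
  interpret prob_space "uniform_sphere :: (real^'d) measure" by (rule prob_space_uniform_sphere)
  \<comment> \<open>Taking all norms identifies \<open>h\<close> as the probability that the reduced
    direction lies in \<open>H\<close>.\<close>
  have "emeasure lborel {x. radii x \<in> G UNIV} / ?b = 1"
    using 2[of UNIV] emeasure_space_1 by simp
  then have "emeasure uniform_sphere {\<theta>. reduced_direction U \<theta> \<in> H} = h"
    using 1[of UNIV] by (simp add: ennreal_times_divide[symmetric])
  then show ?thesis
    using 1[of C] 2[of C] by (simp add: ennreal_times_divide[symmetric] mult.commute)
qed

end

subsection \<open>Conditioning on the directions\<close>

text \<open>A family of independent pairs is rearranged into a pair of independent families, so that
  Fubini can fix all directions while the radii vary. Equality is checked on product sets by
  integrating their sections.\<close>

lemma distr_PiM_pair: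
  assumes N: "prob_space N" and Q: "prob_space Q" and I: "finite I"
  shows "distr (PiM I (\<lambda>_. N) \<Otimes>\<^sub>M PiM I (\<lambda>_. Q)) (PiM I (\<lambda>_. N \<Otimes>\<^sub>M Q)) (\<lambda>(a, b). \<lambda>i\<in>I. (a i, b i))
    = PiM I (\<lambda>_. N \<Otimes>\<^sub>M Q)"
proof -
  interpret N: prob_space N by (rule N)
  interpret Q: prob_space Q by (rule Q)
  interpret NQ: pair_prob_space N Q ..
  interpret PN: product_sigma_finite "\<lambda>_. N" ..
  interpret PQ: product_sigma_finite "\<lambda>_. Q" ..
  interpret PNQ: product_sigma_finite "\<lambda>_. N \<Otimes>\<^sub>M Q" ..
  interpret iN: prob_space "PiM I (\<lambda>_. N)" by (rule prob_space_PiM) (rule N)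
  interpret iQ: prob_space "PiM I (\<lambda>_. Q)" by (rule prob_space_PiM) (rule Q)
  interpret iNQ: pair_prob_space "PiM I (\<lambda>_. N)" "PiM I (\<lambda>_. Q)" ..
  let ?Z = "\<lambda>(a, b). \<lambda>i\<in>I. (a i, b i)"
  have Z[measurable]: "?Z \<in> PiM I (\<lambda>_. N) \<Otimes>\<^sub>M PiM I (\<lambda>_. Q) \<rightarrow>\<^sub>M PiM I (\<lambda>_. N \<Otimes>\<^sub>M Q)"
    by (rule measurable_split_conv[THEN iffD2]) measurable
  show ?thesis
  proof (rule PNQ.PiM_eqI[OF I])
    fix A assume A: "\<And>i. i \<in> I \<Longrightarrow> A i \<in> sets (N \<Otimes>\<^sub>M Q)"
    have PA: "Pi\<^sub>E I A \<in> sets (PiM I (\<lambda>_. N \<Otimes>\<^sub>M Q))" by (intro sets_PiM_I_finite I A)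
    have sect: "Pair (a i) -` A i \<in> sets Q" if "i \<in> I" for a i
      using A[OF that] by (rule sets_Pair1)
    let ?B = "?Z -` Pi\<^sub>E I A \<inter> space (PiM I (\<lambda>_. N) \<Otimes>\<^sub>M PiM I (\<lambda>_. Q))"
    have B: "?B \<in> sets (PiM I (\<lambda>_. N) \<Otimes>\<^sub>M PiM I (\<lambda>_. Q))"
      by (rule measurable_sets[OF Z PA])
    have "emeasure (distr (PiM I (\<lambda>_. N) \<Otimes>\<^sub>M PiM I (\<lambda>_. Q)) (PiM I (\<lambda>_. N \<Otimes>\<^sub>M Q)) ?Z) (Pi\<^sub>E I A)
        = (\<integral>\<^sup>+ a. emeasure (PiM I (\<lambda>_. Q)) (Pair a -` ?B) \<partial>PiM I (\<lambda>_. N))"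
      by (subst emeasure_distr[OF Z PA], subst iQ.emeasure_pair_measure_alt[OF B]) simp
    also have "\<dots> = (\<integral>\<^sup>+ a. (\<Prod>i\<in>I. emeasure Q (Pair (a i) -` A i)) \<partial>PiM I (\<lambda>_. N))"
    proof (rule nn_integral_cong)
      fix a assume a: "a \<in> space (PiM I (\<lambda>_. N))"
      have "Pair a -` ?B = Pi\<^sub>E I (\<lambda>i. Pair (a i) -` A i)"
      proof (rule set_eqI)
        fix b
        have "b \<in> space (PiM I (\<lambda>_. Q))" if "b \<in> Pi\<^sub>E I (\<lambda>i. Pair (a i) -` A i)"
          using that sect[THEN sets.sets_into_space] by (auto simp: space_PiM PiE_iff) blast
        then show "b \<in> Pair a -` ?B \<longleftrightarrow> b \<in> Pi\<^sub>E I (\<lambda>i. Pair (a i) -` A i)"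
          using a by (auto simp: space_pair_measure PiE_iff space_PiM)
      qed
      then show "emeasure (PiM I (\<lambda>_. Q)) (Pair a -` ?B) = (\<Prod>i\<in>I. emeasure Q (Pair (a i) -` A i))"
        using sect by (simp add: PQ.emeasure_PiM[OF I])
    qed
    also have "\<dots> = (\<Prod>i\<in>I. \<integral>\<^sup>+ a. emeasure Q (Pair a -` A i) \<partial>N)"
      by (intro PN.product_nn_integral_prod I Q.measurable_emeasure_Pair A)
    also have "\<dots> = (\<Prod>i\<in>I. emeasure (N \<Otimes>\<^sub>M Q) (A i))"
      by (intro prod.cong refl Q.emeasure_pair_measure_alt[symmetric] A)
    finally show "emeasure (distr (PiM I (\<lambda>_. N) \<Otimes>\<^sub>M PiM I (\<lambda>_. Q)) (PiM I (\<lambda>_. N \<Otimes>\<^sub>M Q)) ?Z) (Pi\<^sub>E I A)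
      = (\<Prod>i\<in>I. emeasure (N \<Otimes>\<^sub>M Q) (A i))" .
  qed simp
qed

text \<open>Each \<open>v b i\<close> may depend on the whole family \<open>b\<close>. For fixed
  \<open>b\<close> the unconditional inequality applies, and its bound does not involve
  \<open>b\<close>, so it survives integration over \<open>b\<close>.\<close>

lemma hoeffding_vector_conditional:
  fixes v :: "('i \<Rightarrow> 'b) \<Rightarrow> 'i \<Rightarrow> 'a::euclidean_space"
  assumes N: "unit_interval_distribution N" and Q: "prob_space Q" and I: "finite I"
    and v [measurable]: "\<And>i. i \<in> I \<Longrightarrow> (\<lambda>b. v b i) \<in> borel_measurable (PiM I (\<lambda>_. Q))"
    and v_sum: "\<And>b. (\<Sum>i\<in>I. v b i) = 0"
    and S: "\<And>b. (\<Sum>i\<in>I. (norm (v b i))\<^sup>2) \<le> S" "0 < S" and r: "0 < r"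
  shows "emeasure (PiM I (\<lambda>_. N \<Otimes>\<^sub>M Q))
      {w \<in> space (PiM I (\<lambda>_. N \<Otimes>\<^sub>M Q)). r \<le> norm (\<Sum>i\<in>I. fst (w i) *\<^sub>R v (\<lambda>i\<in>I. snd (w i)) i)}
    \<le> ennreal (2 * exp (- (2 * r\<^sup>2 / S)))"
    (is "emeasure ?P ?A \<le> ?e")
proof -
  interpret N: unit_interval_distribution N by (rule N)
  interpret Q: prob_space Q by (rule Q)
  interpret iN: prob_space "PiM I (\<lambda>_. N)" by (rule prob_space_PiM) (rule N.prob_space_axioms)
  interpret iQ: prob_space "PiM I (\<lambda>_. Q)" by (rule prob_space_PiM) (rule Q)
  interpret iNQ: pair_prob_space "PiM I (\<lambda>_. N)" "PiM I (\<lambda>_. Q)" ..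
  let ?Z = "\<lambda>(a, b). \<lambda>i\<in>I. (a i, b i)"
  have Z: "?Z \<in> PiM I (\<lambda>_. N) \<Otimes>\<^sub>M PiM I (\<lambda>_. Q) \<rightarrow>\<^sub>M PiM I (\<lambda>_. N \<Otimes>\<^sub>M Q)"
    by (rule measurable_split_conv[THEN iffD2]) measurable
  have "(\<lambda>w. \<lambda>i\<in>I. snd (w i)) \<in> PiM I (\<lambda>_. N \<Otimes>\<^sub>M Q) \<rightarrow>\<^sub>M PiM I (\<lambda>_. Q)" by measurable
  then have [measurable]: "(\<lambda>w. v (\<lambda>i\<in>I. snd (w i)) i) \<in> borel_measurable ?P" if "i \<in> I" for i
    using v[OF that] by (rule measurable_compose)
  have [measurable]: "(\<lambda>w. fst (w i)) \<in> borel_measurable ?P" if "i \<in> I" for i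
    using that by measurable
  have A: "?A \<in> sets ?P" by measurable
  let ?B = "?Z -` ?A \<inter> space (PiM I (\<lambda>_. N) \<Otimes>\<^sub>M PiM I (\<lambda>_. Q))"
  have B: "?B \<in> sets (PiM I (\<lambda>_. N) \<Otimes>\<^sub>M PiM I (\<lambda>_. Q))"
    by (rule measurable_sets[OF Z A])
  have "emeasure ?P ?A = emeasure (PiM I (\<lambda>_. N) \<Otimes>\<^sub>M PiM I (\<lambda>_. Q)) ?B"
    by (subst distr_PiM_pair[OF N.prob_space_axioms Q I, symmetric], subst emeasure_distr[OF Z A]) simp
  also have "\<dots> = (\<integral>\<^sup>+ b. emeasure (PiM I (\<lambda>_. N)) ((\<lambda>a. (a, b)) -` ?B) \<partial>PiM I (\<lambda>_. Q))"
    by (rule iNQ.emeasure_pair_measure_alt2[OF B])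
  also have "\<dots> \<le> (\<integral>\<^sup>+ b. ?e \<partial>PiM I (\<lambda>_. Q))"
  proof (rule nn_integral_mono)
    fix b assume b: "b \<in> space (PiM I (\<lambda>_. Q))"
    have restr: "(\<lambda>i\<in>I. snd ((\<lambda>i\<in>I. (a i, b i)) i)) = b" for a
      using b by (auto simp: space_PiM PiE_iff extensional_def restrict_def)
    have Z_sum: "(\<Sum>i\<in>I. fst ((\<lambda>i\<in>I. (a i, b i)) i) *\<^sub>R v (\<lambda>i\<in>I. snd ((\<lambda>i\<in>I. (a i, b i)) i)) i) =
        (\<Sum>i\<in>I. a i *\<^sub>R v b i)" for a
      by (subst restr) (intro sum.cong, simp_all)
    \<comment> \<open>The only place where \<open>v_sum\<close> enters: subtracting the mean from
      every coefficient leaves the sum unchanged.\<close>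
    have mean: "(\<Sum>i\<in>I. (a i - N.mean) *\<^sub>R v b i) = (\<Sum>i\<in>I. a i *\<^sub>R v b i)" for a
      using v_sum[of b] by (simp add: scaleR_diff_left sum_subtractf flip: scaleR_sum_right)
    have "(\<lambda>a. (a, b)) -` ?B \<subseteq> {a \<in> space (PiM I (\<lambda>_. N)). r \<le> norm (\<Sum>i\<in>I. (a i - N.mean) *\<^sub>R v b i)}"
      unfolding mean
      by (rule subsetI) (simp only: vimage_def Int_iff mem_Collect_eq case_prod_conv Z_sum
          space_pair_measure mem_Sigma_iff)
    then have "emeasure (PiM I (\<lambda>_. N)) ((\<lambda>a. (a, b)) -` ?B) \<le>
        emeasure (PiM I (\<lambda>_. N)) {a \<in> space (PiM I (\<lambda>_. N)). r \<le> norm (\<Sum>i\<in>I. (a i - N.mean) *\<^sub>R v b i)}"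
      by (rule emeasure_mono) measurable
    also have "\<dots> \<le> ?e"
      by (rule N.hoeffding_vector[OF I S r])
    finally show "emeasure (PiM I (\<lambda>_. N)) ((\<lambda>a. (a, b)) -` ?B) \<le> ?e" .
  qed
  also have "\<dots> = ?e" by (simp add: iQ.emeasure_space_1)
  finally show ?thesis .
qed

context semi_orthogonal begin

lemma distr_radius_direction:
  "distr uniform_sphere (borel \<Otimes>\<^sub>M borel) (\<lambda>\<theta>. (norm (Ut \<theta>) powr p, reduced_direction U \<theta>)) =
   distr uniform_sphere borel (\<lambda>\<theta>. norm (Ut \<theta>) powr p) \<Otimes>\<^sub>M distr uniform_sphere borel (reduced_direction U)"
    (is "?D = ?N \<Otimes>\<^sub>M ?Q")
proof (rule pair_measure_eqI[symmetric])
  interpret prob_space "uniform_sphere :: (real^'d) measure" by (rule prob_space_uniform_sphere)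
  show "sigma_finite_measure ?N" "sigma_finite_measure ?Q"
    by (intro prob_space_imp_sigma_finite prob_space_distr; measurable)+
  show "sets (?N \<Otimes>\<^sub>M ?Q) = sets ?D" by (simp cong: sets_pair_measure_cong)
  fix A B assume "A \<in> sets ?N" "B \<in> sets ?Q"
  then have [measurable]: "A \<in> sets borel" "B \<in> sets borel" by simp_all
  define C where "C = (\<lambda>c :: real. c powr p) -` A"
  have C: "C \<in> sets borel"
    unfolding C_def using measurable_sets[of "\<lambda>c :: real. c powr p" borel borel A] by simp
  have "emeasure ?D (A \<times> B) = emeasure uniform_sphere {\<theta>. norm (Ut \<theta>) \<in> C \<and> reduced_direction U \<theta> \<in> B}"
    by (subst emeasure_distr) (auto simp: C_def intro!: arg_cong[where f = "emeasure _"])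
  moreover have "emeasure ?N A = emeasure uniform_sphere {\<theta>. norm (Ut \<theta>) \<in> C}"
    by (subst emeasure_distr) (auto simp: C_def intro!: arg_cong[where f = "emeasure _"])
  moreover have "emeasure ?Q B = emeasure uniform_sphere {\<theta>. reduced_direction U \<theta> \<in> B}"
    by (subst emeasure_distr) (auto intro!: arg_cong[where f = "emeasure _"])
  ultimately show "emeasure ?N A * emeasure ?Q B = emeasure ?D (A \<times> B)"
    using uniform_sphere_indep[OF C \<open>B \<in> sets borel\<close>] by simp
qed

lemma unit_interval_distribution_radius:
  assumes "0 \<le> p"
  shows "unit_interval_distribution (distr (uniform_sphere :: (real^'d) measure) borel (\<lambda>\<theta>. norm (Ut \<theta>) powr p))"
proof (intro unit_interval_distribution.intro unit_interval_distribution_axioms.intro)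
  interpret prob_space "uniform_sphere :: (real^'d) measure" by (rule prob_space_uniform_sphere)
  show "prob_space (distr uniform_sphere borel (\<lambda>\<theta>. norm (Ut \<theta>) powr p))"
    by (rule prob_space_distr) measurable
  have "AE \<theta> in uniform_sphere. norm (Ut \<theta>) powr p \<in> {0..1}"
    using AE_uniform_sphere_norm
  proof eventually_elim
    case (elim \<theta>)
    then show ?case using norm_Ut_le[of \<theta>] assms by (auto intro!: powr_le1)
  qed
  then show "AE \<xi> in distr uniform_sphere borel (\<lambda>\<theta>. norm (Ut \<theta>) powr p). \<xi> \<in> {0..1}"
    by (subst AE_distr_iff) auto
qed simp

text \<open>Transfers the conditional inequality to an arbitrary i.i.d. sequence through the joint
  law of radii and directions. The product space sees restrictions to \<open>I\<close>, and
  \<open>v_cong\<close> makes \<open>v\<close> blind to the values outside \<open>I\<close>.\<close>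

lemma radius_tail_bound:
  fixes v :: "(nat \<Rightarrow> real^'k) \<Rightarrow> nat \<Rightarrow> 'a::euclidean_space"
  assumes M: "prob_space M" and indep: "prob_space.indep_vars M (\<lambda>_. borel) \<Theta> UNIV"
    and law: "\<And>l. distr M borel (\<Theta> l) = (uniform_sphere :: (real^'d) measure)"
    and p: "0 \<le> p" and I: "finite I" "I \<noteq> {}"
    and v [measurable]: "\<And>i. i \<in> I \<Longrightarrow> (\<lambda>b. v b i) \<in> borel_measurable (PiM I (\<lambda>_. borel))"
    and v_cong: "\<And>b b' i. i \<in> I \<Longrightarrow> (\<And>j. j \<in> I \<Longrightarrow> b j = b' j) \<Longrightarrow> v b i = v b' i"
    and v_sum: "\<And>b. (\<Sum>i\<in>I. v b i) = 0"
    and S: "\<And>b. (\<Sum>i\<in>I. (norm (v b i))\<^sup>2) \<le> S" "0 < S" and r: "0 < r"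
  shows "measure M {\<omega> \<in> space M. r \<le> norm (\<Sum>i\<in>I. (norm (Ut (\<Theta> i \<omega>)) powr p) *\<^sub>R
      v (\<lambda>i. reduced_direction U (\<Theta> i \<omega>)) i)} \<le> 2 * exp (- (2 * r\<^sup>2 / S))"
proof -
  interpret prob_space M by (rule M)
  interpret sphere: prob_space "uniform_sphere :: (real^'d) measure" by (rule prob_space_uniform_sphere)
  define N where "N = distr (uniform_sphere :: (real^'d) measure) borel (\<lambda>\<theta>. norm (Ut \<theta>) powr p)"
  define Q where "Q = distr (uniform_sphere :: (real^'d) measure) borel (reduced_direction U)"
  define f where "f \<theta> = (norm (Ut \<theta>) powr p, reduced_direction U \<theta>)" for \<theta>
  have f[measurable]: "f \<in> borel \<rightarrow>\<^sub>M borel \<Otimes>\<^sub>M borel" unfolding f_def[abs_def] by measurable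
  have \<Theta>[measurable]: "\<Theta> i \<in> M \<rightarrow>\<^sub>M borel" for i
    using indep by (auto simp: indep_vars_def)
  have NQ_sets: "sets (N \<Otimes>\<^sub>M Q) = sets (borel \<Otimes>\<^sub>M borel)"
    unfolding N_def Q_def by (intro sets_pair_measure_cong) simp_all
  have law_f: "distr M (borel \<Otimes>\<^sub>M borel) (\<lambda>\<omega>. f (\<Theta> i \<omega>)) = N \<Otimes>\<^sub>M Q" for i
  proof -
    have "distr M (borel \<Otimes>\<^sub>M borel) (\<lambda>\<omega>. f (\<Theta> i \<omega>)) = distr (distr M borel (\<Theta> i)) (borel \<Otimes>\<^sub>M borel) f"
      by (subst distr_distr) (auto simp: comp_def)
    then show ?thesis unfolding law N_def Q_def f_def[abs_def] distr_radius_direction .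
  qed
  have "indep_vars (\<lambda>_. borel \<Otimes>\<^sub>M borel) (\<lambda>i \<omega>. f (\<Theta> i \<omega>)) I"
    by (rule indep_vars_compose2[OF indep_vars_subset[OF indep]]) simp_all
  then have joint: "distr M (PiM I (\<lambda>_. borel \<Otimes>\<^sub>M borel)) (\<lambda>\<omega>. \<lambda>i\<in>I. f (\<Theta> i \<omega>)) = PiM I (\<lambda>_. N \<Otimes>\<^sub>M Q)"
    using I by (subst (asm) indep_vars_iff_distr_eq_PiM) (auto simp: law_f)
  let ?P = "PiM I (\<lambda>_. N \<Otimes>\<^sub>M Q)"
  let ?A = "{w \<in> space ?P. r \<le> norm (\<Sum>i\<in>I. fst (w i) *\<^sub>R v (\<lambda>i\<in>I. snd (w i)) i)}"
  have P_sets[measurable_cong]: "sets ?P = sets (PiM I (\<lambda>_. borel \<Otimes>\<^sub>M borel))"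
    by (intro sets_PiM_cong NQ_sets refl)
  have "(\<lambda>w. \<lambda>i\<in>I. snd (w i)) \<in> PiM I (\<lambda>_. borel \<Otimes>\<^sub>M borel) \<rightarrow>\<^sub>M PiM I (\<lambda>_. borel)" by measurable
  then have v_meas[measurable]: "(\<lambda>w. v (\<lambda>i\<in>I. snd (w i)) i) \<in> borel_measurable (PiM I (\<lambda>_. borel \<Otimes>\<^sub>M borel))"
    if "i \<in> I" for i
    using v[OF that] by (rule measurable_compose)
  have [measurable]: "(\<lambda>w. fst (w i)) \<in> borel_measurable (PiM I (\<lambda>_. borel \<Otimes>\<^sub>M borel))" if "i \<in> I" for i
    using that by measurable
  have A: "?A \<in> sets (PiM I (\<lambda>_. borel \<Otimes>\<^sub>M borel))"
    unfolding sets_eq_imp_space_eq[OF P_sets] by measurable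
  have X: "(\<lambda>\<omega>. \<lambda>i\<in>I. f (\<Theta> i \<omega>)) \<in> M \<rightarrow>\<^sub>M PiM I (\<lambda>_. borel \<Otimes>\<^sub>M borel)" by measurable
  have "{\<omega> \<in> space M. r \<le> norm (\<Sum>i\<in>I. (norm (Ut (\<Theta> i \<omega>)) powr p) *\<^sub>R
      v (\<lambda>i. reduced_direction U (\<Theta> i \<omega>)) i)} = (\<lambda>\<omega>. \<lambda>i\<in>I. f (\<Theta> i \<omega>)) -` ?A \<inter> space M" (is "?E = _")
  proof (rule set_eqI)
    fix \<omega>
    have "v (\<lambda>i\<in>I. snd ((\<lambda>i\<in>I. f (\<Theta> i \<omega>)) i)) i = v (\<lambda>i. reduced_direction U (\<Theta> i \<omega>)) i" if "i \<in> I" for i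
      using that by (rule v_cong) (simp add: f_def)
    then have eq: "(\<Sum>i\<in>I. fst ((\<lambda>i\<in>I. f (\<Theta> i \<omega>)) i) *\<^sub>R v (\<lambda>i\<in>I. snd ((\<lambda>i\<in>I. f (\<Theta> i \<omega>)) i)) i) =
        (\<Sum>i\<in>I. (norm (Ut (\<Theta> i \<omega>)) powr p) *\<^sub>R v (\<lambda>i. reduced_direction U (\<Theta> i \<omega>)) i)"
      by (intro sum.cong refl arg_cong2[where f = scaleR]) (simp_all add: f_def)
    have "(\<lambda>i\<in>I. f (\<Theta> i \<omega>)) \<in> space ?P" if "\<omega> \<in> space M"
      using measurable_space[OF X that] sets_eq_imp_space_eq[OF P_sets] by simp
    then show "\<omega> \<in> ?E \<longleftrightarrow> \<omega> \<in> (\<lambda>\<omega>. \<lambda>i\<in>I. f (\<Theta> i \<omega>)) -` ?A \<inter> space M"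
      by (simp only: vimage_def Int_iff mem_Collect_eq eq) blast
  qed
  then have "emeasure M ?E = emeasure ?P ?A"
    by (simp only: emeasure_distr[OF X A, unfolded joint])
  also have "\<dots> \<le> ennreal (2 * exp (- (2 * r\<^sup>2 / S)))"
  proof (rule hoeffding_vector_conditional[OF _ _ I(1) _ v_sum S r])
    show "unit_interval_distribution N"
      unfolding N_def by (rule unit_interval_distribution_radius[OF p])
    show "prob_space Q" unfolding Q_def by (rule sphere.prob_space_distr) measurable
    have "sets (PiM I (\<lambda>_. Q)) = sets (PiM I (\<lambda>_. borel))"
      by (intro sets_PiM_cong) (simp_all add: Q_def)
    then show "(\<lambda>b. v b i) \<in> borel_measurable (PiM I (\<lambda>_. Q))" if "i \<in> I" for i
      using v[OF that] by (subst measurable_cong_sets[OF _ refl])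
  qed
  finally show ?thesis by (simp add: emeasure_eq_measure)
qed

end

subsection \<open>Moving one support point\<close>

text \<open>Away from 0 the power is differentiable; at 0 it still has a one-sided derivative. For
  \<open>p = 1\<close> that derivative is 1, whereas \<open>0 powr 0 = 0\<close>, which explains the
  case distinction in the bound.\<close>

lemma powr_abs_right_derivative:
  fixes s p :: real
  assumes p: "1 \<le> p"
  obtains d where "((\<lambda>h. (\<bar>s + h\<bar> powr p - \<bar>s\<bar> powr p) / h) \<longlongrightarrow> d) (at_right 0)"
    "\<bar>d\<bar> \<le> p * (if p = 1 then 1 else \<bar>s\<bar> powr (p - 1))"
proof (cases "s = 0")
  case True
  \<comment> \<open>At \<open>s = 0\<close> the quotient is \<open>h powr (p - 1)\<close>, which
    tends to 1 for \<open>p = 1\<close> and to 0 for larger \<open>p\<close>.\<close>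
  have ev: "\<forall>\<^sub>F h in at_right 0. (\<bar>s + h\<bar> powr p - \<bar>s\<bar> powr p) / h = h powr (p - 1)"
    by (rule eventually_at_right_less[THEN eventually_mono])
      (use True p in \<open>simp add: powr_diff\<close>)
  show thesis
  proof (cases "p = 1")
    case p1: True
    have "\<forall>\<^sub>F h in at_right 0. (\<bar>s + h\<bar> powr p - \<bar>s\<bar> powr p) / h = 1"
      by (rule eventually_at_right_less[THEN eventually_mono]) (use True p1 in simp)
    then show thesis by (intro that[of 1] tendsto_eventually) (use p1 in auto)
  next
    case False
    then have "((\<lambda>h. h powr (p - 1)) \<longlongrightarrow> 0 powr (p - 1)) (at_right (0::real))"
      using p by (intro tendsto_powr' tendsto_intros)
        (auto intro!: eventually_at_right_less[THEN eventually_mono])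
    then show thesis using p
      by (intro that[of 0]) (simp_all add: tendsto_cong[OF ev])
  qed
next
  case False
  \<comment> \<open>The sign of \<open>s + h\<close> is constant near 0, so the absolute value can
    be replaced by a linear function.\<close>
  define \<sigma> where "\<sigma> = sgn s"
  have \<sigma>: "\<bar>\<sigma>\<bar> = 1" "\<sigma> * s = \<bar>s\<bar>" using False by (auto simp: \<sigma>_def sgn_real_def)
  define d where "d = p * \<bar>s\<bar> powr (p - 1) * \<sigma>"
  have "((\<lambda>h. (\<sigma> * (s + h)) powr p) has_real_derivative d) (at 0)"
    using False by (auto intro!: derivative_eq_intros simp: \<sigma> d_def)
  then have "((\<lambda>h. ((\<sigma> * (s + h)) powr p - \<bar>s\<bar> powr p) / h) \<longlongrightarrow> d) (at_right 0)"
    by (auto simp: DERIV_def \<sigma> intro: filterlim_mono[OF _ order_refl at_le])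
  moreover have "\<forall>\<^sub>F h in at_right 0. ((\<sigma> * (s + h)) powr p - \<bar>s\<bar> powr p) / h =
      (\<bar>s + h\<bar> powr p - \<bar>s\<bar> powr p) / h"
    unfolding eventually_at_right_field
  proof (intro exI[of _ "\<bar>s\<bar>"] conjI allI impI)
    fix h assume "0 < h" "h < \<bar>s\<bar>"
    then have "\<bar>s + h\<bar> = \<sigma> * (s + h)" by (auto simp: \<sigma>_def sgn_real_def)
    then show "((\<sigma> * (s + h)) powr p - \<bar>s\<bar> powr p) / h = (\<bar>s + h\<bar> powr p - \<bar>s\<bar> powr p) / h" by simp
  qed (use False in simp)
  ultimately have "((\<lambda>h. (\<bar>s + h\<bar> powr p - \<bar>s\<bar> powr p) / h) \<longlongrightarrow> d) (at_right 0)"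
    by (rule Lim_transform_eventually)
  then show thesis
    by (rule that) (use p \<sigma> False in \<open>simp add: d_def abs_mult\<close>)
qed

context discrete_marginals begin

lemma OT_tendsto:
  assumes "\<And>i j. i < n \<Longrightarrow> j < m \<Longrightarrow> ((\<lambda>z. C z i j) \<longlongrightarrow> C' i j) F"
  shows "((\<lambda>z. OT (C z)) \<longlongrightarrow> OT C') F"
proof (rule Lim_null[THEN iffD2], rule tendsto_rabs_zero_cancel, rule tendsto_sandwich)
  let ?e = "\<lambda>z. \<Sum>i<n. \<Sum>j<m. \<bar>C z i j - C' i j\<bar>"
  show "\<forall>\<^sub>F z in F. 0 \<le> \<bar>OT (C z) - OT C'\<bar>" by simp
  show "\<forall>\<^sub>F z in F. \<bar>OT (C z) - OT C'\<bar> \<le> ?e z"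
  proof (intro always_eventually allI OT_lipschitz)
    fix z i j assume ij: "i < n" "j < m"
    have "\<bar>C z i j - C' i j\<bar> \<le> (\<Sum>j<m. \<bar>C z i j - C' i j\<bar>)"
      using ij by (intro member_le_sum) auto
    also have "\<dots> \<le> ?e z"
      using ij by (intro member_le_sum[of i "{..<n}" "\<lambda>i. \<Sum>j<m. \<bar>C z i j - C' i j\<bar>"]) (auto intro: sum_nonneg)
    finally show "\<bar>C z i j - C' i j\<bar> \<le> ?e z" .
  qed
  have "(?e \<longlongrightarrow> (\<Sum>i<n. \<Sum>j<m. \<bar>C' i j - C' i j\<bar>)) F"
    by (intro tendsto_intros assms) auto
  then show "(?e \<longlongrightarrow> 0) F" by simp
qed simp

lemma OT_continuous_on:
  assumes "\<And>i j. i < n \<Longrightarrow> j < m \<Longrightarrow> continuous_on A (\<lambda>z. C z i j)"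
  shows "continuous_on A (\<lambda>z. OT (C z))"
  using assms unfolding continuous_on_def by (auto intro!: OT_tendsto)

end

text \<open>The transport cost as a function of the displacement \<open>h\<close> of the \<open>i\<close>-th source point after
  projection onto the direction \<open>t\<close>; \<open>X\<close> and \<open>Y\<close> are the reduced support points.\<close>

locale moving_point = discrete_marginals n m q1 q2
  for n m :: nat and q1 q2 :: "nat \<Rightarrow> real" +
  fixes X Y :: "nat \<Rightarrow> 'a::euclidean_space" and p :: real and i :: nat
  assumes p_ge_1: "1 \<le> p" and i_less: "i < n"
begin

definition shift_cost :: "'a \<Rightarrow> real \<Rightarrow> real" where
  "shift_cost t h = OT (\<lambda>i' j. if i' = i then \<bar>(X i - Y j) \<bullet> t + h\<bar> powr p
     else \<bar>(X i' - Y j) \<bullet> t\<bar> powr p)"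

text \<open>The right derivative at \<open>0\<close>, taken along a sequence so that it is evidently measurable in \<open>t\<close>. As
  \<open>shift_cost (- t) h = shift_cost t (- h)\<close>, the left derivative is \<open>- slope (- t)\<close>.\<close>

definition slope :: "'a \<Rightarrow> real" where
  "slope t = lim (\<lambda>k. (shift_cost t (1 / Suc k) - shift_cost t 0) / (1 / Suc k))"

text \<open>The one-sided derivatives at 0 are \<open>slope t\<close> from the right and
  \<open>- slope (- t)\<close> from the left; \<open>kink\<close> is half their difference and
  \<open>drift\<close> their average.\<close>

definition kink :: "'a \<Rightarrow> real" where "kink t = (slope t + slope (- t)) / 2"

definition drift :: "'a \<Rightarrow> real" where "drift t = (slope t - slope (- t)) / 2"

lemma shift_cost_uminus: "shift_cost (- t) h = shift_cost t (- h)"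
proof -
  have "\<bar>(X i - Y j) \<bullet> - t + h\<bar> = \<bar>(X i - Y j) \<bullet> t + - h\<bar>" for j
    by (simp add: abs_minus_commute)
  then show ?thesis unfolding shift_cost_def by (simp cong: if_cong)
qed

lemma kink_uminus: "kink (- t) = kink t"
  by (simp add: kink_def)

text \<open>The bound \<open>B\<close> is left free: a crude sum over all \<open>j\<close> suffices
  for the existence of the limit, and a maximum gives the quantitative bound.\<close>

lemma shift_cost_right_derivative:
  assumes B: "\<And>j. j < m \<Longrightarrow> p * (if p = 1 then 1 else \<bar>(X i - Y j) \<bullet> t\<bar> powr (p - 1)) \<le> B"
  shows "((\<lambda>h. (shift_cost t h - shift_cost t 0) / h) \<longlongrightarrow> slope t) (at_right 0)"
    and "\<bar>slope t\<bar> \<le> q1 i * B"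
proof -
  let ?P = "\<lambda>j d. ((\<lambda>h. (\<bar>(X i - Y j) \<bullet> t + h\<bar> powr p - \<bar>(X i - Y j) \<bullet> t\<bar> powr p) / h) \<longlongrightarrow> d) (at_right 0) \<and>
    \<bar>d\<bar> \<le> p * (if p = 1 then 1 else \<bar>(X i - Y j) \<bullet> t\<bar> powr (p - 1))"
  have "\<forall>j. \<exists>d. ?P j d"
  proof
    fix j
    show "\<exists>d. ?P j d"
      by (rule powr_abs_right_derivative[OF p_ge_1, of "(X i - Y j) \<bullet> t"]) blast
  qed
  from choice[OF this] obtain d where d: "\<forall>j. ?P j (d j)" ..
  obtain \<alpha> where \<alpha>: "((\<lambda>h. (shift_cost t h - shift_cost t 0) / h) \<longlongrightarrow> \<alpha>) (at_right 0)" "\<bar>\<alpha>\<bar> \<le> q1 i * B"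
    unfolding shift_cost_def
  proof (rule OT_row_right_derivative[OF i_less, where c = "\<lambda>h j. \<bar>(X i - Y j) \<bullet> t + h\<bar> powr p"
        and C = "\<lambda>i' j. \<bar>(X i' - Y j) \<bullet> t\<bar> powr p" and d = d and B = B])
    show "((\<lambda>h. (\<bar>(X i - Y j) \<bullet> t + h\<bar> powr p - \<bar>(X i - Y j) \<bullet> t + 0\<bar> powr p) / h) \<longlongrightarrow> d j) (at_right 0)" for j
      using d[rule_format, of j] by simp
    show "\<bar>d j\<bar> \<le> B" if "j < m" for j
      using d[rule_format, THEN conjunct2] B[OF that] by (rule order_trans)
  qed blast
  \<comment> \<open>The one-sided limit exists, so the sequence in the definition of
    \<open>slope\<close> converges to it.\<close>
  have "filterlim (\<lambda>k. 1 / real (Suc k)) (at_right 0) sequentially"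
    using LIMSEQ_inverse_real_of_nat
    by (intro tendsto_imp_filterlim_at_right always_eventually) (auto simp: inverse_eq_divide)
  from filterlim_compose[OF \<alpha>(1) this] have "slope t = \<alpha>"
    unfolding slope_def by (rule limI)
  with \<alpha> show "((\<lambda>h. (shift_cost t h - shift_cost t 0) / h) \<longlongrightarrow> slope t) (at_right 0)" "\<bar>slope t\<bar> \<le> q1 i * B"
    by simp_all
qed

lemma abs_drift_le:
  assumes B: "\<And>j. j < m \<Longrightarrow> p * (if p = 1 then 1 else \<bar>(X i - Y j) \<bullet> t\<bar> powr (p - 1)) \<le> B"
  shows "\<bar>drift t\<bar> \<le> q1 i * B"
proof -
  have "\<bar>slope t\<bar> \<le> q1 i * B" "\<bar>slope (- t)\<bar> \<le> q1 i * B"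
    by (rule shift_cost_right_derivative(2), simp only: inner_minus_right abs_minus_cancel B)+
  then show ?thesis by (simp add: drift_def)
qed

text \<open>Subtracting the kink moves both one-sided derivatives to their average. This is the
  hypothesis on the profiles in \<open>gradient_on_ridge_sum\<close>.\<close>

lemma shift_cost_derivative:
  "((\<lambda>h. shift_cost t h - kink t * \<bar>h\<bar>) has_real_derivative drift t) (at 0)"
proof -
  define B where "B = (\<Sum>j<m. p * (if p = 1 then 1 else \<bar>(X i - Y j) \<bullet> t\<bar> powr (p - 1)))"
  have B: "p * (if p = 1 then 1 else \<bar>(X i - Y j) \<bullet> t\<bar> powr (p - 1)) \<le> B" if "j < m" for j
    unfolding B_def using that p_ge_1 by (intro member_le_sum) auto
  have R: "((\<lambda>h. (shift_cost t h - shift_cost t 0) / h) \<longlongrightarrow> slope t) (at_right 0)"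
    by (rule shift_cost_right_derivative(1)) (rule B)
  have L: "((\<lambda>h. (shift_cost t (- h) - shift_cost t 0) / h) \<longlongrightarrow> slope (- t)) (at_right 0)"
  proof -
    have "((\<lambda>h. (shift_cost (- t) h - shift_cost (- t) 0) / h) \<longlongrightarrow> slope (- t)) (at_right 0)"
      by (rule shift_cost_right_derivative(1)[where B = B]) (simp only: inner_minus_right abs_minus_cancel B)
    then show ?thesis by (simp add: shift_cost_uminus)
  qed
  let ?D = "\<lambda>h. (shift_cost t h - kink t * \<bar>h\<bar> - shift_cost t 0) / h"
  have slope_kink: "slope t - kink t = drift t" "kink t - slope (- t) = drift t"
    by (simp_all add: kink_def drift_def field_simps)
  have "((\<lambda>h. (shift_cost t h - shift_cost t 0) / h - kink t) \<longlongrightarrow> drift t) (at_right 0)"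
    unfolding slope_kink(1)[symmetric] by (intro tendsto_intros R)
  moreover have "\<forall>\<^sub>F h in at_right 0. (shift_cost t h - shift_cost t 0) / h - kink t = ?D h"
    by (rule eventually_at_right_less[THEN eventually_mono]) (simp add: field_simps)
  ultimately have right: "(?D \<longlongrightarrow> drift t) (at_right 0)" by (rule Lim_transform_eventually)
  have "((\<lambda>h. kink t - (shift_cost t (- h) - shift_cost t 0) / h) \<longlongrightarrow> drift t) (at_right 0)"
    unfolding slope_kink(2)[symmetric] by (intro tendsto_intros L)
  moreover have "\<forall>\<^sub>F h in at_right 0. kink t - (shift_cost t (- h) - shift_cost t 0) / h = ?D (- h)"
    by (rule eventually_at_right_less[THEN eventually_mono]) (simp add: field_simps)
  ultimately have "((\<lambda>h. ?D (- h)) \<longlongrightarrow> drift t) (at_right 0)" by (rule Lim_transform_eventually)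
  then have left: "(?D \<longlongrightarrow> drift t) (at_left 0)"
    using filterlim_at_left_to_right[of ?D "nhds (drift t)" 0] by simp
  from filterlim_split_at[OF left right] show ?thesis by (simp add: DERIV_def)
qed

lemma shift_cost_continuous: "continuous_on UNIV (\<lambda>t. shift_cost t h)"
  unfolding shift_cost_def
proof (rule OT_continuous_on)
  have "continuous_on UNIV (\<lambda>t. \<bar>a \<bullet> t + b\<bar> powr p)" for a :: 'a and b
    using p_ge_1 by (intro continuous_on_powr' continuous_intros) auto
  from this[of _ 0] this show "continuous_on UNIV (\<lambda>t. if i' = i then \<bar>(X i - Y j) \<bullet> t + h\<bar> powr p
     else \<bar>(X i' - Y j) \<bullet> t\<bar> powr p)" for i' j
    by (cases "i' = i") simp_all
qed

lemma slope_measurable [measurable]: "slope \<in> borel_measurable borel"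
proof -
  have [measurable]: "(\<lambda>t. shift_cost t h) \<in> borel_measurable borel" for h
    by (rule borel_measurable_continuous_onI[OF shift_cost_continuous])
  show ?thesis unfolding slope_def[abs_def] by measurable
qed

lemma kink_measurable [measurable]: "kink \<in> borel_measurable borel"
  and drift_measurable [measurable]: "drift \<in> borel_measurable borel"
  unfolding kink_def[abs_def] drift_def[abs_def] by measurable

end

subsection \<open>The gradient error\<close>

text \<open>The variance is at most the second moment. Bounding each centred vector by
  \<open>2 * B\<close> would lose a factor 4.\<close>

lemma sum_norm_centered_le:
  fixes f :: "'i \<Rightarrow> 'a::real_inner" and B :: real
  assumes I: "finite I" "I \<noteq> {}" and B: "\<And>i. i \<in> I \<Longrightarrow> norm (f i) \<le> B"
  shows "(\<Sum>i\<in>I. (norm (f i - (1 / card I) *\<^sub>R (\<Sum>j\<in>I. f j)))\<^sup>2) \<le> card I * B\<^sup>2"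
proof -
  define a where "a = (1 / card I) *\<^sub>R (\<Sum>j\<in>I. f j)"
  have card: "real (card I) > 0" using I by (simp add: card_gt_0_iff)
  have sum: "(\<Sum>j\<in>I. f j) = real (card I) *\<^sub>R a" using card by (simp add: a_def)
  have "(\<Sum>i\<in>I. (norm (f i - a))\<^sup>2) = (\<Sum>i\<in>I. (norm (f i))\<^sup>2 - 2 * (f i \<bullet> a) + a \<bullet> a)"
    unfolding power2_norm_eq_inner by (intro sum.cong refl) (simp add: inner_diff_left inner_diff_right inner_commute)
  also have "\<dots> = (\<Sum>i\<in>I. (norm (f i))\<^sup>2) - 2 * ((\<Sum>i\<in>I. f i) \<bullet> a) + card I * (a \<bullet> a)"
    by (simp add: sum.distrib sum_subtractf sum_distrib_left inner_sum_left)
  also have "\<dots> = (\<Sum>i\<in>I. (norm (f i))\<^sup>2) - card I * (a \<bullet> a)"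
    unfolding sum by simp
  also have "\<dots> \<le> (\<Sum>i\<in>I. (norm (f i))\<^sup>2)" by simp
  also have "\<dots> \<le> (\<Sum>i\<in>I. B\<^sup>2)" using B by (intro sum_mono power_mono) auto
  finally show ?thesis by (simp add: a_def)
qed

lemma slice_discrete_measure: "slice \<theta> (discrete_measure n q s) = discrete_measure n q (\<lambda>i. \<theta> \<bullet> s i)"
  unfolding slice_def by (rule distr_discrete_measure) measurable

lemma (in semi_orthogonal) reduce_discrete_measure:
  "reduce U (discrete_measure n q s) = discrete_measure n q (\<lambda>i. Ut (s i))"
  unfolding reduce_def by (rule distr_discrete_measure) measurable

lemma (in discrete_marginals) wasserstein_slice_measurable:
  fixes s r :: "nat \<Rightarrow> 'a::euclidean_space"
  assumes "0 < p"
  shows "(\<lambda>\<theta>. wasserstein_pow p (slice \<theta> (discrete_measure n q1 s)) (slice \<theta> (discrete_measure m q2 r)))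
    \<in> borel_measurable borel"
proof -
  have "continuous_on UNIV (\<lambda>\<theta>. OT (\<lambda>i j. norm (\<theta> \<bullet> s i - \<theta> \<bullet> r j) powr p))"
    using assms by (intro OT_continuous_on continuous_on_powr' continuous_intros) auto
  from borel_measurable_continuous_onI[OF this] show ?thesis
    by (simp add: slice_discrete_measure wasserstein_discrete)
qed

text \<open>The support detects only atoms of positive mass, so the span conditions are restricted
  to these. Positivity of \<open>q1 i\<close> puts the differentiated point itself into the column
  span.\<close>

locale sliced_gradient = discrete_marginals n m q1 q2 + semi_orthogonal U
  for n m :: nat and q1 q2 :: "nat \<Rightarrow> real" and U :: "real^'k^'d" +
  fixes p :: real and x y :: "nat \<Rightarrow> real^'d" and i :: nat
  assumes p_ge_1: "1 \<le> p" and i_less: "i < n" and q1_i: "0 < q1 i"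
    and x_span: "\<And>i. i < n \<Longrightarrow> q1 i \<noteq> 0 \<Longrightarrow> x i \<in> column_span U"
    and y_span: "\<And>j. j < m \<Longrightarrow> q2 j \<noteq> 0 \<Longrightarrow> y j \<in> column_span U"
begin

sublocale moving_point n m q1 q2 "\<lambda>i. Ut (x i)" "\<lambda>j. Ut (y j)" p i
  by unfold_locales (use p_ge_1 i_less in auto)

abbreviation "V \<equiv> column_span U"
abbreviation "rd \<equiv> reduced_direction U"

lemma x_i_span: "x i \<in> V"
  using x_span[OF i_less] q1_i by simp

lemma shift_cost_nonneg: "0 \<le> shift_cost t h"
  unfolding shift_cost_def by (intro OT_nonneg) auto

lemma OT_moved_point:
  "OT (\<lambda>i' j. norm (t \<bullet> Ut ((x(i := z)) i') - t \<bullet> Ut (y j)) powr p) = shift_cost t ((z - x i) \<bullet> (U *v t))"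
proof -
  have "(z - x i) \<bullet> (U *v t) = t \<bullet> Ut z - t \<bullet> Ut (x i)"
    using inner_U[of t "z - x i"]
    by (simp only: inner_commute[of "z - x i"] matrix_vector_mult_diff_distrib inner_diff_right)
  then have "t \<bullet> Ut z - t \<bullet> Ut w = (Ut (x i) - Ut w) \<bullet> t + (z - x i) \<bullet> (U *v t)" for w
    by (simp add: inner_diff_right inner_commute[of _ t])
  moreover have "t \<bullet> Ut v - t \<bullet> Ut w = (Ut v - Ut w) \<bullet> t" for v w
    by (simp add: inner_diff_right inner_commute[of _ t])
  ultimately show ?thesis
    unfolding shift_cost_def by (intro arg_cong[where f = OT] ext) simp
qed

lemma reduced_wasserstein:
  "wasserstein_pow p (slice t (reduce U (discrete_measure n q1 (x(i := z)))))
     (slice t (reduce U (discrete_measure m q2 y))) = ennreal (shift_cost t ((z - x i) \<bullet> (U *v t)))"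
  unfolding reduce_discrete_measure slice_discrete_measure wasserstein_discrete OT_moved_point ..

text \<open>For \<open>w\<close> in \<open>V\<close> one has \<open>w = U *v Ut w\<close>, so
  projecting \<open>w\<close> on \<open>\<theta>\<close> is the same as projecting
  \<open>Ut w\<close> on \<open>Ut \<theta>\<close>. The norm of \<open>Ut \<theta>\<close> then
  leaves the cost with power \<open>p\<close>; if it is 0, both sides vanish.\<close>

lemma full_wasserstein:
  assumes z: "z \<in> V"
  shows "wasserstein_pow p (slice \<theta> (discrete_measure n q1 (x(i := z)))) (slice \<theta> (discrete_measure m q2 y))
    = ennreal (norm (Ut \<theta>) powr p * shift_cost (rd \<theta>) ((z - x i) \<bullet> (U *v rd \<theta>)))"
proof -
  let ?c = "norm (Ut \<theta>)"
  have inner: "\<theta> \<bullet> w = ?c * (rd \<theta> \<bullet> Ut w)" if "w \<in> V" for w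
  proof -
    have "\<theta> \<bullet> w = Ut \<theta> \<bullet> Ut w"
      using inner_U[of "Ut w" \<theta>] U_Ut[OF that] by (simp add: inner_commute)
    then show ?thesis by (subst (asm) Ut_eq_reduced_direction) simp
  qed
  have 1: "discrete_measure n q1 (\<lambda>i'. \<theta> \<bullet> (x(i := z)) i') =
      discrete_measure n q1 (\<lambda>i'. ?c * (rd \<theta> \<bullet> Ut ((x(i := z)) i')))"
    by (rule discrete_measure_cong, rule inner) (use z x_span in auto)
  have 2: "discrete_measure m q2 (\<lambda>j. \<theta> \<bullet> y j) = discrete_measure m q2 (\<lambda>j. ?c * (rd \<theta> \<bullet> Ut (y j)))"
    by (rule discrete_measure_cong, rule inner) (use y_span in auto)
  have cost: "norm (?c * a - ?c * b) powr p = ?c powr p * norm (a - b) powr p" for a b :: real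
    by (simp add: right_diff_distrib[symmetric] abs_mult powr_mult del: right_diff_distrib')
  show ?thesis
    unfolding slice_discrete_measure 1 2 wasserstein_discrete cost OT_scale[OF powr_ge_zero] OT_moved_point ..
qed

lemma slice_loss_eq:
  "z \<in> V \<Longrightarrow> slice_loss p n q1 x m q2 y i \<theta> z =
    norm (Ut \<theta>) powr p * reduced_slice_loss U p n q1 x m q2 y i (rd \<theta>) z"
  by (simp add: slice_loss_def reduced_slice_loss_def full_wasserstein reduced_wasserstein shift_cost_nonneg)

text \<open>The equivalence ensures that the identity does not compare a genuine gradient with a
  default value. If \<open>Ut \<theta> = 0\<close>, scaling by 0 says nothing about the reduced
  loss, but then the reduced direction is 0 and both losses are constant on
  \<open>V\<close>.\<close>

lemma slice_gradient:
  "(\<exists>g. has_gradient_on (slice_loss p n q1 x m q2 y i \<theta>) V (x i) g) \<longleftrightarrow>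
   (\<exists>g. has_gradient_on (reduced_slice_loss U p n q1 x m q2 y i (rd \<theta>)) V (x i) g)" (is ?iff)
  "gradient_on (slice_loss p n q1 x m q2 y i \<theta>) V (x i) =
   norm (Ut \<theta>) powr p *\<^sub>R gradient_on (reduced_slice_loss U p n q1 x m q2 y i (rd \<theta>)) V (x i)" (is ?eq)
proof -
  let ?f = "slice_loss p n q1 x m q2 y i \<theta>" and ?r = "reduced_slice_loss U p n q1 x m q2 y i (rd \<theta>)"
  let ?c = "norm (Ut \<theta>) powr p"
  have iff: "has_gradient_on ?f V (x i) g \<longleftrightarrow> has_gradient_on (\<lambda>z. ?c * ?r z) V (x i) g" for g
    by (rule has_gradient_on_cong[OF slice_loss_eq x_i_span])
  have grad: "gradient_on ?f V (x i) = gradient_on (\<lambda>z. ?c * ?r z) V (x i)"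
    by (rule gradient_on_cong[OF slice_loss_eq x_i_span])
  have const: "has_gradient_on (\<lambda>z. c) V (x i) 0" for c :: real
    using subspace_0[OF subspace_column_span] by (simp add: has_gradient_on_def)
  have "?iff \<and> ?eq"
  proof (cases "Ut \<theta> = 0")
    case True
    then have "rd \<theta> = 0" by (simp add: reduced_direction_def)
    then have "?r = (\<lambda>z. shift_cost 0 0)"
      by (simp add: reduced_slice_loss_def reduced_wasserstein shift_cost_nonneg fun_eq_iff)
    then show ?thesis
      using const[of 0] const[of "shift_cost 0 0"] True
      unfolding iff grad by (auto intro!: gradient_on_eq[OF subspace_column_span x_i_span])
  next
    case False
    then have "?c \<noteq> 0" by simp
    then show ?thesis
      unfolding iff grad
      using has_gradient_on_scale_iff[OF subspace_column_span] gradient_on_scale[OF subspace_column_span x_i_span]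
      by blast
  qed
  then show ?iff ?eq by auto
qed

lemma sw_loss_eq:
  assumes z: "z \<in> V"
  shows "sw_loss p n q1 x m q2 y i (empirical_measure L \<theta>) z =
    (\<Sum>l<L. (1 / L * norm (Ut (\<theta> l)) powr p) * shift_cost (rd (\<theta> l)) ((z - x i) \<bullet> (U *v rd (\<theta> l))))"
proof -
  have "sliced_wasserstein_pow p (discrete_measure n q1 (x(i := z))) (discrete_measure m q2 y) (empirical_measure L \<theta>) =
      (\<Sum>l<L. ennreal (1 / L) * ennreal (norm (Ut (\<theta> l)) powr p * shift_cost (rd (\<theta> l)) ((z - x i) \<bullet> (U *v rd (\<theta> l)))))"
    unfolding sliced_wasserstein_pow_def empirical_measure_def
    using p_ge_1
    by (subst nn_integral_discrete_measure[OF wasserstein_slice_measurable]) (simp_all add: full_wasserstein[OF z])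
  also have "\<dots> = (\<Sum>l<L. ennreal ((1 / L * norm (Ut (\<theta> l)) powr p) * shift_cost (rd (\<theta> l)) ((z - x i) \<bullet> (U *v rd (\<theta> l)))))"
    by (intro sum.cong refl) (simp add: ennreal_mult[symmetric] shift_cost_nonneg mult.assoc del: times_divide_eq_left)
  also have "\<dots> = ennreal (\<Sum>l<L. (1 / L * norm (Ut (\<theta> l)) powr p) * shift_cost (rd (\<theta> l)) ((z - x i) \<bullet> (U *v rd (\<theta> l))))"
    by (intro sum_ennreal mult_nonneg_nonneg shift_cost_nonneg) auto
  finally show ?thesis
    unfolding sw_loss_def by (simp add: sum_nonneg shift_cost_nonneg)
qed

lemma reduced_sw_loss_eq:
  "reduced_sw_loss U p n q1 x m q2 y i (empirical_measure L t) z =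
    (\<Sum>l<L. (1 / L) * shift_cost (t l) ((z - x i) \<bullet> (U *v t l)))"
proof -
  have "sliced_wasserstein_pow p (reduce U (discrete_measure n q1 (x(i := z)))) (reduce U (discrete_measure m q2 y)) (empirical_measure L t) =
      (\<Sum>l<L. ennreal (1 / L) * ennreal (shift_cost (t l) ((z - x i) \<bullet> (U *v t l))))"
    unfolding sliced_wasserstein_pow_def empirical_measure_def reduced_wasserstein[symmetric] reduce_discrete_measure
    using p_ge_1 by (subst nn_integral_discrete_measure) (auto intro!: wasserstein_slice_measurable)
  also have "\<dots> = (\<Sum>l<L. ennreal ((1 / L) * shift_cost (t l) ((z - x i) \<bullet> (U *v t l))))"
    by (intro sum.cong refl) (simp add: ennreal_mult[symmetric] shift_cost_nonneg del: times_divide_eq_left)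
  also have "\<dots> = ennreal (\<Sum>l<L. (1 / L) * shift_cost (t l) ((z - x i) \<bullet> (U *v t l)))"
    by (intro sum_ennreal mult_nonneg_nonneg shift_cost_nonneg) auto
  finally show ?thesis
    unfolding reduced_sw_loss_def by (simp add: sum_nonneg shift_cost_nonneg)
qed

text \<open>Direction 0 is exempt: its term is constant in the moved point, although
  \<open>kink 0\<close> may be nonzero, for instance when \<open>p = 1\<close>.\<close>

definition smooth :: "nat \<Rightarrow> (nat \<Rightarrow> real^'k) \<Rightarrow> bool" where
  "smooth L t \<longleftrightarrow> (\<forall>l. l < L \<longrightarrow> t l \<noteq> 0 \<longrightarrow> kink (t l) = 0)"

text \<open>The condition \<open>smooth\<close> does not mention \<open>w\<close>. The weights of
  the full and of the reduced loss thus lead to the same case distinction. Positivity is asked only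
  at nonzero directions, since the full weight is 0 where \<open>Ut (\<theta> l)\<close>
  vanishes.\<close>

lemma gradient_weighted_sum:
  assumes w: "\<And>l. l < L \<Longrightarrow> rd (\<theta> l) \<noteq> 0 \<Longrightarrow> 0 < w l"
    and f: "\<And>z. z \<in> V \<Longrightarrow> f z = (\<Sum>l<L. w l * shift_cost (rd (\<theta> l)) ((z - x i) \<bullet> (U *v rd (\<theta> l))))"
  shows "gradient_on f V (x i) =
    (if smooth L (\<lambda>l. rd (\<theta> l)) then \<Sum>l<L. (w l * drift (rd (\<theta> l))) *\<^sub>R (U *v rd (\<theta> l)) else 0)"
proof -
  have U_eq_0: "U *v t = 0 \<longleftrightarrow> t = 0" for t using norm_U[of t] by (metis norm_eq_zero)
  have "(\<forall>v\<in>V. (\<Sum>l<L. w l * kink (rd (\<theta> l)) * \<bar>v \<bullet> (U *v rd (\<theta> l))\<bar>) = 0) \<longleftrightarrow>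
      (\<forall>l\<in>{..<L}. U *v rd (\<theta> l) \<noteq> 0 \<longrightarrow> kink (rd (\<theta> l)) = 0)"
  proof (rule kink_sum_eq_0_iff[OF subspace_column_span])
    show "U *v rd (\<theta> l) = 0 \<or> norm (U *v rd (\<theta> l)) = 1" for l
    proof (cases "Ut (\<theta> l) = 0")
      case True
      then show ?thesis by (simp add: reduced_direction_def)
    next
      case False
      then show ?thesis by (simp only: norm_U norm_reduced_direction) simp
    qed
    show "0 < w l" if "l \<in> {..<L}" "U *v rd (\<theta> l) \<noteq> 0" for l
      using that by (intro w) (auto simp: U_eq_0)
    show "kink (rd (\<theta> l)) = kink (rd (\<theta> j))"
      if "U *v rd (\<theta> l) = U *v rd (\<theta> j) \<or> U *v rd (\<theta> l) = - (U *v rd (\<theta> j))" for l j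
    proof -
      have "rd (\<theta> l) = rd (\<theta> j) \<or> rd (\<theta> l) = - rd (\<theta> j)"
        using that
      proof
        assume "U *v rd (\<theta> l) = U *v rd (\<theta> j)"
        then have "Ut (U *v rd (\<theta> l)) = Ut (U *v rd (\<theta> j))" by simp
        then show ?thesis by simp
      next
        assume "U *v rd (\<theta> l) = - (U *v rd (\<theta> j))"
        then have "U *v rd (\<theta> l) = U *v (- rd (\<theta> j))"
          by (simp add: linear_neg[OF matrix_vector_mul_linear])
        then have "Ut (U *v rd (\<theta> l)) = Ut (U *v (- rd (\<theta> j)))" by simp
        then show ?thesis by simp
      qed
      then show ?thesis by (auto simp: kink_uminus)
    qed
  qed (auto simp: U_in_column_span)
  also have "\<dots> \<longleftrightarrow> smooth L (\<lambda>l. rd (\<theta> l))" by (auto simp: smooth_def U_eq_0)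
  finally have iff: "(\<forall>v\<in>V. (\<Sum>l<L. w l * kink (rd (\<theta> l)) * \<bar>v \<bullet> (U *v rd (\<theta> l))\<bar>) = 0) \<longleftrightarrow>
      smooth L (\<lambda>l. rd (\<theta> l))" .
  show ?thesis
    unfolding iff[symmetric]
    by (rule gradient_on_ridge_sum[OF subspace_column_span x_i_span])
      (auto simp: U_in_column_span f intro!: shift_cost_derivative)
qed

definition centered_gradient :: "nat \<Rightarrow> (nat \<Rightarrow> real^'k) \<Rightarrow> nat \<Rightarrow> real^'d" where
  "centered_gradient L t l = drift (t l) *\<^sub>R (U *v t l) - (1 / L) *\<^sub>R (\<Sum>j<L. drift (t j) *\<^sub>R (U *v t j))"

lemma gradient_error_eq:
  "gradient_error U p n q1 x m q2 y i L \<theta> =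
    (if smooth L (\<lambda>l. rd (\<theta> l)) then
      (1 / L) *\<^sub>R (\<Sum>l<L. (norm (Ut (\<theta> l)) powr p) *\<^sub>R centered_gradient L (\<lambda>l. rd (\<theta> l)) l) else 0)"
proof -
  have pos: "0 < norm (Ut (\<theta> l)) powr p" if "rd (\<theta> l) \<noteq> 0" for l
    using that by (auto simp: reduced_direction_def)
  have 1: "gradient_on (sw_loss p n q1 x m q2 y i (empirical_measure L \<theta>)) V (x i) =
    (if smooth L (\<lambda>l. rd (\<theta> l)) then
      \<Sum>l<L. ((1 / L * norm (Ut (\<theta> l)) powr p) * drift (rd (\<theta> l))) *\<^sub>R (U *v rd (\<theta> l)) else 0)"
    by (rule gradient_weighted_sum[OF _ sw_loss_eq]) (use pos in \<open>simp add: zero_less_mult_iff\<close>)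
  have 2: "gradient_on (reduced_sw_loss U p n q1 x m q2 y i (empirical_measure L (\<lambda>l. rd (\<theta> l)))) V (x i) =
    (if smooth L (\<lambda>l. rd (\<theta> l)) then
      \<Sum>l<L. ((1 / L) * drift (rd (\<theta> l))) *\<^sub>R (U *v rd (\<theta> l)) else 0)"
    by (rule gradient_weighted_sum[OF _ reduced_sw_loss_eq]) simp
  define c where "c l = norm (Ut (\<theta> l)) powr p" for l
  define g where "g l = drift (rd (\<theta> l)) *\<^sub>R (U *v rd (\<theta> l))" for l
  have "(\<Sum>l<L. ((1 / L * c l) * drift (rd (\<theta> l))) *\<^sub>R (U *v rd (\<theta> l))) = (1 / L) *\<^sub>R (\<Sum>l<L. c l *\<^sub>R g l)"
    by (simp add: g_def scaleR_sum_right)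
  moreover have "(\<Sum>l<L. ((1 / L) * drift (rd (\<theta> l))) *\<^sub>R (U *v rd (\<theta> l))) = (1 / L) *\<^sub>R (\<Sum>l<L. g l)"
    by (simp add: g_def scaleR_sum_right)
  moreover have "(\<Sum>l<L. c l *\<^sub>R (g l - (1 / L) *\<^sub>R (\<Sum>j<L. g j))) =
      (\<Sum>l<L. c l *\<^sub>R g l) - (\<Sum>l<L. c l) *\<^sub>R ((1 / L) *\<^sub>R (\<Sum>j<L. g j))"
    by (simp only: scaleR_diff_right sum_subtractf scaleR_sum_left)
  ultimately show ?thesis
    unfolding gradient_error_def 1 2 empirical_ESSF_def centered_gradient_def
    unfolding c_def[symmetric] g_def[symmetric]
    by (simp add: scaleR_diff_right)
qed

definition gradient_bound :: real where "gradient_bound = p * q1 i * max_dist_pow p n x m y"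

text \<open>The derivative of each power cost is at most \<open>p\<close> times a distance to the
  power \<open>p - 1\<close>, row \<open>i\<close> carries mass \<open>q1 i\<close>, and neither
  \<open>Ut\<close> nor projection on \<open>t\<close> increases distances.\<close>

lemma drift_bound:
  assumes t: "norm t \<le> 1"
  shows "\<bar>drift t\<bar> \<le> gradient_bound"
proof -
  have "\<bar>drift t\<bar> \<le> q1 i * (p * max_dist_pow p n x m y)"
  proof (rule abs_drift_le, rule mult_left_mono)
    fix j assume j: "j < m"
    let ?K = "\<lambda>(i, j). if p = 1 then 1 else norm (x i - y j) powr (p - 1)"
    have "\<bar>(Ut (x i) - Ut (y j)) \<bullet> t\<bar> \<le> norm (Ut (x i - y j)) * norm t"
      by (simp add: Cauchy_Schwarz_ineq2 matrix_vector_mult_diff_distrib)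
    also have "\<dots> \<le> norm (x i - y j) * 1"
      using t by (intro mult_mono norm_Ut_le) auto
    finally have "(if p = 1 then 1 else \<bar>(Ut (x i) - Ut (y j)) \<bullet> t\<bar> powr (p - 1)) \<le> ?K (i, j)"
      using p_ge_1 by (auto intro!: powr_mono2)
    also have "\<dots> \<le> max_dist_pow p n x m y"
      unfolding max_dist_pow_def using i_less j by (intro Max_ge finite_imageI) auto
    finally show "(if p = 1 then 1 else \<bar>(Ut (x i) - Ut (y j)) \<bullet> t\<bar> powr (p - 1)) \<le> max_dist_pow p n x m y" .
  qed (use p_ge_1 in simp)
  then show ?thesis by (simp add: gradient_bound_def mult_ac)
qed

section \<open>Random directions\<close>

context
  fixes M :: "'w measure" and \<Theta> :: "nat \<Rightarrow> 'w \<Rightarrow> real^'d"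
  assumes M: "prob_space M" and indep: "prob_space.indep_vars M (\<lambda>_. borel) \<Theta> UNIV"
    and law: "\<And>l. distr M borel (\<Theta> l) = uniform_sphere"
begin

abbreviation "err L \<omega> \<equiv> gradient_error U p n q1 x m q2 y i L (\<lambda>l. \<Theta> l \<omega>)"

lemma \<Theta>_measurable [measurable]: "\<Theta> l \<in> M \<rightarrow>\<^sub>M borel"
proof -
  interpret prob_space M by (rule M)
  show ?thesis using indep by (auto simp: indep_vars_def)
qed

lemma err_measurable [measurable]: "err L \<in> borel_measurable M"
  unfolding gradient_error_eq smooth_def centered_gradient_def by measurable

text \<open>The positive constant \<open>C\<close> is kept separate because
  \<open>gradient_bound\<close> may be 0, namely when \<open>p > 1\<close> and all support points
  coincide.\<close>

lemma err_tail:
  assumes L: "1 \<le> L" and \<epsilon>: "0 < \<epsilon>" and C: "gradient_bound \<le> C" "0 < C"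
  shows "measure M {\<omega> \<in> space M. \<epsilon> < norm (err L \<omega>)} \<le> 2 * exp (- (\<epsilon>\<^sup>2 * L / C\<^sup>2))"
proof -
  interpret prob_space M by (rule M)
  \<comment> \<open>Cut off outside the unit ball because the tail bound asks for estimates at all
    families of directions. Reduced directions have norm at most 1 and never meet the
    cut-off.\<close>
  define g where "g t = (if norm t \<le> 1 then drift t *\<^sub>R (U *v t) else 0)" for t
  define v where "v t l = g (t l) - (1 / L) *\<^sub>R (\<Sum>j<L. g (t j))" for t l
  have g: "norm (g t) \<le> C" for t
  proof (cases "norm t \<le> 1")
    case True
    then have "\<bar>drift t\<bar> * norm t \<le> gradient_bound * 1"
      using drift_bound[OF True] by (intro mult_mono) auto
    then show ?thesis using True C by (simp add: g_def)
  qed (use C in \<open>simp add: g_def\<close>)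
  have [measurable]: "g \<in> borel_measurable borel" unfolding g_def[abs_def] by measurable
  have norm_rd: "norm (rd \<theta>) \<le> 1" for \<theta> by (simp add: norm_reduced_direction)
  have v_centered: "v (\<lambda>l. rd (\<theta> l)) l = centered_gradient L (\<lambda>l. rd (\<theta> l)) l" for \<theta> l
    by (simp add: v_def g_def centered_gradient_def norm_rd)
  let ?s = "\<lambda>\<omega>. \<Sum>l<L. (norm (Ut (\<Theta> l \<omega>)) powr p) *\<^sub>R v (\<lambda>l. rd (\<Theta> l \<omega>)) l"
  have [measurable]: "?s \<in> borel_measurable M" unfolding v_def by measurable
  have "measure M {\<omega> \<in> space M. \<epsilon> < norm (err L \<omega>)} \<le> measure M {\<omega> \<in> space M. \<epsilon> * L \<le> norm (?s \<omega>)}"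
  proof (rule finite_measure_mono)
    \<comment> \<open>If some kink is present the error is 0, so the event on the left is confined
      to smooth samples.\<close>
    show "{\<omega> \<in> space M. \<epsilon> < norm (err L \<omega>)} \<subseteq> {\<omega> \<in> space M. \<epsilon> * L \<le> norm (?s \<omega>)}"
      using L \<epsilon> by (auto simp: gradient_error_eq v_centered field_simps split: if_splits)
  qed measurable
  \<comment> \<open>Here \<open>r = \<epsilon> * L\<close> absorbs the averaging factor
    \<open>1 / L\<close>, and \<open>S = L * C\<^sup>2\<close> is the bound for the centred
    vectors.\<close>
  also have "\<dots> \<le> 2 * exp (- (2 * (\<epsilon> * L)\<^sup>2 / (L * C\<^sup>2)))"
  proof (rule radius_tail_bound[OF M indep law])
    show "(\<Sum>l<L. v t l) = 0" for t using L by (simp add: v_def sum_subtractf sum_constant_scaleR del: sum_constant)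
    show "(\<Sum>l<L. (norm (v t l))\<^sup>2) \<le> real L * C\<^sup>2" for t
      using sum_norm_centered_le[of "{..<L}" "\<lambda>l. g (t l)" C] L g by (auto simp: v_def lessThan_empty_iff)
    show "(\<lambda>t. v t l) \<in> borel_measurable (PiM {..<L} (\<lambda>_. borel))" if "l \<in> {..<L}" for l
      unfolding v_def using that by measurable
    show "v t l = v t' l" if "l \<in> {..<L}" "\<And>j. j \<in> {..<L} \<Longrightarrow> t j = t' j" for t t' l
    proof -
      have "(\<Sum>j<L. g (t j)) = (\<Sum>j<L. g (t' j))" using that(2) by (intro sum.cong) auto
      then show ?thesis using that by (simp add: v_def)
    qed
  qed (use L \<epsilon> C p_ge_1 in \<open>auto simp: lessThan_empty_iff\<close>)
  also have "2 * (\<epsilon> * L)\<^sup>2 / (L * C\<^sup>2) = 2 * (\<epsilon>\<^sup>2 * L / C\<^sup>2)"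
    using L C by (simp add: field_simps power2_eq_square)
  also have "2 * exp (- (2 * (\<epsilon>\<^sup>2 * L / C\<^sup>2))) \<le> 2 * exp (- (\<epsilon>\<^sup>2 * L / C\<^sup>2))"
  proof -
    have "0 \<le> \<epsilon>\<^sup>2 * L / C\<^sup>2" by simp
    then have "- (2 * (\<epsilon>\<^sup>2 * L / C\<^sup>2)) \<le> - (\<epsilon>\<^sup>2 * L / C\<^sup>2)" by linarith
    then show ?thesis by (intro mult_left_mono iffD2[OF exp_le_cancel_iff]) auto
  qed
  finally show ?thesis .
qed

lemma err_tendsto_in_prob: "tendsto_in_prob M err 0"
  unfolding tendsto_in_prob_def
proof (intro conjI allI impI)
  fix \<delta> :: real assume \<delta>: "0 < \<delta>"
  define C where "C = \<bar>gradient_bound\<bar> + 1"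
  have C: "gradient_bound \<le> C" "0 < C" by (auto simp: C_def)
  show "(\<lambda>L. measure M {\<omega> \<in> space M. \<delta> < norm (err L \<omega> - 0)}) \<longlonglongrightarrow> 0"
  proof (rule tendsto_sandwich[where f = "\<lambda>_. 0" and h = "\<lambda>L. 2 * exp (- (\<delta>\<^sup>2 * real L / C\<^sup>2))"])
    show "\<forall>\<^sub>F L in sequentially. measure M {\<omega> \<in> space M. \<delta> < norm (err L \<omega> - 0)} \<le> 2 * exp (- (\<delta>\<^sup>2 * real L / C\<^sup>2))"
      using err_tail[OF _ \<delta> C] by (auto simp: eventually_sequentially intro!: exI[of _ 1])
    have "filterlim (\<lambda>L. (\<delta>\<^sup>2 / C\<^sup>2) * real L) at_top sequentially"
      using \<delta> C by (intro filterlim_tendsto_pos_mult_at_top[OF tendsto_const] filterlim_real_sequentially) simp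
    then have "((\<lambda>L. exp (- (\<delta>\<^sup>2 / C\<^sup>2 * real L))) \<longlongrightarrow> 0) sequentially"
      by (intro filterlim_compose[OF exp_at_bot]) (simp add: filterlim_uminus_at_bot)
    from tendsto_mult_left[OF this, of 2] show "(\<lambda>L. 2 * exp (- (\<delta>\<^sup>2 * real L / C\<^sup>2))) \<longlonglongrightarrow> 0"
      by simp
  qed auto
qed measurable

lemma err_concentration:
  assumes L: "1 \<le> L" and \<epsilon>: "0 < \<epsilon>"
  shows "measure M {\<omega> \<in> space M. norm (err L \<omega>) \<le> \<epsilon>} \<ge> 1 - 2 * exp (- (\<epsilon>\<^sup>2 * L / gradient_bound\<^sup>2))"
proof (cases "0 < gradient_bound")
  case True
  interpret prob_space M by (rule M)
  have "space M - {\<omega> \<in> space M. \<epsilon> < norm (err L \<omega>)} = {\<omega> \<in> space M. norm (err L \<omega>) \<le> \<epsilon>}" by auto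
  moreover have "prob (space M - {\<omega> \<in> space M. \<epsilon> < norm (err L \<omega>)}) = 1 - prob {\<omega> \<in> space M. \<epsilon> < norm (err L \<omega>)}"
    by (rule prob_compl) measurable
  ultimately show ?thesis using err_tail[OF L \<epsilon> order_refl True] by simp
next
  \<comment> \<open>The bound is then 0, and division by 0 turns the exponent into 0. The asserted
    lower bound for the probability is therefore \<open>1 - 2\<close>, which is negative.\<close>
  case False
  have "\<bar>drift 0\<bar> \<le> gradient_bound" by (rule drift_bound) simp
  with False have "gradient_bound = 0" by linarith
  then have "1 - 2 * exp (- (\<epsilon>\<^sup>2 * L / gradient_bound\<^sup>2)) \<le> 0" by simp
  also have "0 \<le> measure M {\<omega> \<in> space M. norm (err L \<omega>) \<le> \<epsilon>}" by (rule measure_nonneg)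
  finally show ?thesis .
qed

end

end

lemma support_discrete_measure:
  fixes x :: "nat \<Rightarrow> 'a::topological_space"
  assumes "i < n" "0 < q i" "\<And>j. j < n \<Longrightarrow> 0 \<le> q j"
  shows "x i \<in> measure_support (discrete_measure n q x)"
  unfolding measure_support_def
proof (intro CollectI allI impI)
  fix S :: "'a set" assume S: "open S" "x i \<in> S"
  have "0 < ennreal (q i) * indicator S (x i)" using S assms by simp
  also have "\<dots> \<le> (\<Sum>j<n. ennreal (q j) * indicator S (x j))"
    using assms(1) by (intro member_le_sum) auto
  finally show "0 < emeasure (discrete_measure n q x) S"
    using S by (simp add: emeasure_discrete_measure)
qed

theorem proposition4p12:
  fixes U :: "real^'k^'d" and p :: real and n m :: nat
    and q1 q2 :: "nat \<Rightarrow> real" and x y :: "nat \<Rightarrow> real^'d"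
    and M :: "'w measure" and \<Theta> :: "nat \<Rightarrow> 'w \<Rightarrow> real^'d"
  assumes "p \<ge> 1"
    and "\<And>i. i < n \<Longrightarrow> q1 i \<ge> 0" and "(\<Sum>i<n. q1 i) = 1"
    and "\<And>j. j < m \<Longrightarrow> q2 j \<ge> 0" and "(\<Sum>j<m. q2 j) = 1"
    and "effective_structure U (discrete_measure n q1 x) (discrete_measure m q2 y)"
  shows
    "(\<forall>i<n. q1 i > 0 \<longrightarrow>
       (\<forall>\<theta>\<in>sphere 0 1.
          ((\<exists>g. has_gradient_on (slice_loss p n q1 x m q2 y i \<theta>) (column_span U) (x i) g) \<longleftrightarrow>
           (\<exists>g. has_gradient_on (reduced_slice_loss U p n q1 x m q2 y i (reduced_direction U \<theta>))
                  (column_span U) (x i) g)) \<and>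
          gradient_on (slice_loss p n q1 x m q2 y i \<theta>) (column_span U) (x i) =
          norm (transpose U *v \<theta>) powr p *\<^sub>R
            gradient_on (reduced_slice_loss U p n q1 x m q2 y i (reduced_direction U \<theta>))
              (column_span U) (x i)))
     \<and>
     (prob_space M \<longrightarrow>
      prob_space.indep_vars M (\<lambda>_. borel) \<Theta> UNIV \<longrightarrow>
      (\<forall>l. distr M borel (\<Theta> l) = uniform_sphere) \<longrightarrow>
      (\<forall>i<n. q1 i > 0 \<longrightarrow>
        tendsto_in_prob M
          (\<lambda>L \<omega>. gradient_error U p n q1 x m q2 y i L (\<lambda>l. \<Theta> l \<omega>)) 0
        \<and>
        (\<forall>L\<ge>1. \<forall>\<epsilon>>0.
           measure M {\<omega> \<in> space M.
             norm (gradient_error U p n q1 x m q2 y i L (\<lambda>l. \<Theta> l \<omega>)) \<le> \<epsilon>}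
           \<ge> 1 - 2 * exp (- (\<epsilon>\<^sup>2 * real L / (p * q1 i * max_dist_pow p n x m y)\<^sup>2)))))"
proof -
  note eff = assms(6)[unfolded effective_structure_def]
  note orth = eff[THEN conjunct1]
    and supp = eff[THEN conjunct2, THEN conjunct1] eff[THEN conjunct2, THEN conjunct2, THEN conjunct1]
  have x_span: "x i \<in> column_span U" if "i < n" "q1 i \<noteq> 0" for i
  proof -
    have "0 < q1 i" using assms(2)[OF that(1)] that(2) by simp
    then show ?thesis
      using support_discrete_measure[of i n q1 x] assms(2) that(1) supp(1) by blast
  qed
  have y_span: "y j \<in> column_span U" if "j < m" "q2 j \<noteq> 0" for j
  proof -
    have "0 < q2 j" using assms(4)[OF that(1)] that(2) by simp
    then show ?thesis
      using support_discrete_measure[of j m q2 y] assms(4) that(1) supp(2) by blast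
  qed
  have setting: "sliced_gradient n m q1 q2 U p x y i" if "i < n" "0 < q1 i" for i
    by unfold_locales (use assms(1-5) orth x_span y_span that in auto)
  show ?thesis
  proof (intro conjI allI impI ballI)
    fix i \<theta> assume "i < n" "0 < q1 i"
    then interpret sliced_gradient n m q1 q2 U p x y i by (rule setting)
    show "(\<exists>g. has_gradient_on (slice_loss p n q1 x m q2 y i \<theta>) (column_span U) (x i) g) \<longleftrightarrow>
           (\<exists>g. has_gradient_on (reduced_slice_loss U p n q1 x m q2 y i (reduced_direction U \<theta>))
                  (column_span U) (x i) g)"
      by (rule slice_gradient(1))
    show "gradient_on (slice_loss p n q1 x m q2 y i \<theta>) (column_span U) (x i) =
          norm (transpose U *v \<theta>) powr p *\<^sub>R
            gradient_on (reduced_slice_loss U p n q1 x m q2 y i (reduced_direction U \<theta>))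
              (column_span U) (x i)"
      by (rule slice_gradient(2))
  next
    fix i
    assume M: "prob_space M" "prob_space.indep_vars M (\<lambda>_. borel) \<Theta> UNIV"
      "\<forall>l. distr M borel (\<Theta> l) = uniform_sphere" and i: "i < n" "0 < q1 i"
    from i interpret sliced_gradient n m q1 q2 U p x y i by (rule setting)
    show "tendsto_in_prob M (\<lambda>L \<omega>. gradient_error U p n q1 x m q2 y i L (\<lambda>l. \<Theta> l \<omega>)) 0"
      by (rule err_tendsto_in_prob) (use M in auto)
    show "measure M {\<omega> \<in> space M.
             norm (gradient_error U p n q1 x m q2 y i L (\<lambda>l. \<Theta> l \<omega>)) \<le> \<epsilon>}
           \<ge> 1 - 2 * exp (- (\<epsilon>\<^sup>2 * real L / (p * q1 i * max_dist_pow p n x m y)\<^sup>2))"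
      if "1 \<le> L" "0 < \<epsilon>" for L \<epsilon>
      unfolding gradient_bound_def[symmetric]
      by (rule err_concentration) (use M that in auto)
  qed
qed

end
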